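(* Let $L=\mathtt{while}(x<n)\{P\}$ be a $\mathtt{ReDiP}$ loop with loop-free body $P$ that is universally almost-surely terminating, and let $I$ be a loop-free $\mathtt{ReDiP}$ program. It is decidable whether $[\![L]\!]=[\![I]\!]$.
   Context: FPS in $\vec X=(X_1,\dots,X_k)$: maps $\mathbb{N}^k\to\mathbb{R}$ as formal sums, with coefficient-wise addition and Cauchy product; a PGF is an FPS with nonnegative coefficients summing to at most 1, ordered coefficient-wise (lifted pointwise to maps PGF$\to$PGF). $\mathtt{ReDiP}$ programs over $\mathbb{N}$-valued variables (indeterminate $X$ for variable $x$): $P ::= x := n \mid x{-}{-} \mid x \mathrel{+}= \mathrm{iid}(D, y) \mid \mathtt{if}(x<n)\{P_1\}\mathtt{else}\{P_2\} \mid P_1; P_2 \mid \mathtt{while}(x<n)\{P_1\}$, $n\in\mathbb{N}$, $D$ a distribution expression whose PGF $[\![D]\!]\in\mathbb{R}[[T]]$ has a rational closed form (e.g. Dirac, Bernoulli, uniform, geometric, binomial, negative binomial with rational parameters). Loop-free means no $\mathtt{while}$. Semantics: $[\![x:=n]\!](g)=g[X/1]X^n$; $[\![x{-}{-}]\!](g)=(g-g[X/0])X^{-1}+g[X/0]$; $[\![x\mathrel{+}=\mathrm{iid}(D,y)]\!](g)=g[Y/Y[\![D]\!][T/X]]$; $[\![\mathtt{if}(x<n)\{P_1\}\mathtt{else}\{P_2\}]\!](g)=[\![P_1]\!](g_{x<n})+[\![P_2]\!](g-g_{x<n})$, $g_{x<n}=\sum_{i=0}^{n-1}\frac1{i!}(\partial_X^ig)[X/0]X^i$;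 $[\![P_1;P_2]\!]=[\![P_2]\!]\circ[\![P_1]\!]$; $[\![\mathtt{while}(x<n)\{P\}]\!]$ is the least fixed point of $\psi\mapsto\lambda f.(f-f_{x<n})+\psi([\![P]\!](f_{x<n}))$. For $f=\sum_if(i)X^i$: $f[X/h]=\sum_if(i)h^i$, $f[X/0]=f(0)$, $f[X/1]=\sum_if(i)$. $P$ is universally almost-surely terminating if $[\![P]\!](g)[\vec X/\vec 1]=g[\vec X/\vec 1]$ for every PGF $g$. *)

theory Defs
  imports
    "HOL-Analysis.Infinite_Sum"
    "HOL-Computational_Algebra.Polynomial_FPS"
    "HOL-Library.FuncSet"
    "HOL-Library.Nat_Bijection"
    "HOL-Library.Poly_Mapping"
begin

section \<open>Multivariate formal power series\<close>

text \<open>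
  A monomial is a finitely supported exponent vector; the program variable \<open>x :: nat\<close> has the
  indeterminate with index \<open>x\<close>.  Series in the indeterminates \<open>X\<^sub>0, \<dots>, X\<^sub>k\<^sub>-\<^sub>1\<close> are the functions
  that vanish at every exponent vector whose support is not contained in \<open>{..<k}\<close>.  This keeps
  \<open>k\<close> an ordinary number, so that it can be part of the input of an algorithm.
\<close>

type_synonym mfps = "(nat \<Rightarrow>\<^sub>0 nat) \<Rightarrow> real"

definition mconst :: "real \<Rightarrow> mfps" where
  "mconst c = (\<lambda>\<sigma>. if \<sigma> = 0 then c else 0)"

definition mvar_pow :: "nat \<Rightarrow> nat \<Rightarrow> mfps" where
  "mvar_pow x n = (\<lambda>\<sigma>. if \<sigma> = Poly_Mapping.single x n then 1 else 0)"

definition madd :: "mfps \<Rightarrow> mfps \<Rightarrow> mfps" where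
  "madd f g = (\<lambda>\<sigma>. f \<sigma> + g \<sigma>)"

definition mdiff :: "mfps \<Rightarrow> mfps \<Rightarrow> mfps" where
  "mdiff f g = (\<lambda>\<sigma>. f \<sigma> - g \<sigma>)"

definition mmult :: "mfps \<Rightarrow> mfps \<Rightarrow> mfps" where
  "mmult f g = (\<lambda>\<sigma>. \<Sum>(\<alpha>, \<beta>) \<in> {(\<alpha>, \<beta>). \<alpha> + \<beta> = \<sigma>}. f \<alpha> * g \<beta>)"

primrec mpower :: "mfps \<Rightarrow> nat \<Rightarrow> mfps" where
  "mpower f 0 = mconst 1"
| "mpower f (Suc n) = mmult f (mpower f n)"

text \<open>The coefficient \<open>f(i)\<close> in \<open>f = \<Sum>\<^sub>i f(i) X\<^sup>i\<close>, a series in which \<open>X\<close> does not occur.\<close>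

definition mcoeff :: "nat \<Rightarrow> mfps \<Rightarrow> nat \<Rightarrow> mfps" where
  "mcoeff x f i =
     (\<lambda>\<sigma>. if Poly_Mapping.lookup \<sigma> x = 0 then f (\<sigma> + Poly_Mapping.single x i) else 0)"

text \<open>\<open>f[X/h] = \<Sum>\<^sub>i f(i) h\<^sup>i\<close>, the infinite sum being taken coefficient-wise.\<close>

definition msubst :: "nat \<Rightarrow> mfps \<Rightarrow> mfps \<Rightarrow> mfps" where
  "msubst x h f = (\<lambda>\<sigma>. \<Sum>\<^sub>\<infinity>i. mmult (mcoeff x f i) (mpower h i) \<sigma>)"

text \<open>\<open>f X\<^sup>-\<^sup>1\<close>, for series \<open>f\<close> divisible by \<open>X\<close>.\<close>

definition mdiv_var :: "nat \<Rightarrow> mfps \<Rightarrow> mfps" where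
  "mdiv_var x f = (\<lambda>\<sigma>. f (\<sigma> + Poly_Mapping.single x 1))"

definition mderiv :: "nat \<Rightarrow> mfps \<Rightarrow> mfps" where
  "mderiv x f =
     (\<lambda>\<sigma>. real (Poly_Mapping.lookup \<sigma> x + 1) * f (\<sigma> + Poly_Mapping.single x 1))"

text \<open>\<open>f\<^sub>x\<^sub><\<^sub>n = \<Sum>\<^sub>i\<^sub><\<^sub>n 1/i! (\<partial>\<^sub>X\<^sup>i f)[X/0] X\<^sup>i\<close>\<close>

definition mbelow :: "nat \<Rightarrow> nat \<Rightarrow> mfps \<Rightarrow> mfps" where
  "mbelow x n f =
     (\<lambda>\<sigma>. \<Sum>i<n. 1 / fact i * mmult (msubst x (mconst 0) ((mderiv x ^^ i) f)) (mvar_pow x i) \<sigma>)"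

text \<open>The univariate series \<open>d\<close> with its indeterminate \<open>T\<close> replaced by \<open>X\<close>.\<close>

definition mfps_of_fps :: "nat \<Rightarrow> real fps \<Rightarrow> mfps" where
  "mfps_of_fps x d =
     (\<lambda>\<sigma>. if Poly_Mapping.keys \<sigma> \<subseteq> {x} then fps_nth d (Poly_Mapping.lookup \<sigma> x) else 0)"

text \<open>\<open>f[X\<^sub>0/1, X\<^sub>1/1, \<dots>]\<close>\<close>

definition mass :: "mfps \<Rightarrow> real" where
  "mass f = (\<Sum>\<^sub>\<infinity>\<sigma>. f \<sigma>)"

definition pgfs :: "nat \<Rightarrow> mfps set" where
  "pgfs k = {f. (\<forall>\<sigma>. 0 \<le> f \<sigma>) \<and>
                (\<forall>\<sigma>. f \<sigma> \<noteq> 0 \<longrightarrow> Poly_Mapping.keys \<sigma> \<subseteq> {..<k}) \<and>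
                f summable_on UNIV \<and> mass f \<le> 1}"

section \<open>Programs\<close>

text \<open>
  A distribution expression is a rational closed form \<open>p / q\<close> of a univariate PGF.  Clearing
  denominators, rational coefficients are represented by integer ones; e.g. the geometric
  distribution with parameter \<open>1/2\<close> is \<open>Ratio [:1:] [:2, -1:]\<close>.
\<close>

datatype dist = Ratio "int poly" "int poly"

primrec dist_fps :: "dist \<Rightarrow> real fps" where
  "dist_fps (Ratio p q) = fps_of_poly (map_poly of_int p) / fps_of_poly (map_poly of_int q)"

primrec valid_dist :: "dist \<Rightarrow> bool" where
  "valid_dist (Ratio p q) \<longleftrightarrow>
     coeff q 0 \<noteq> 0 \<and>
     (\<forall>i. 0 \<le> fps_nth (dist_fps (Ratio p q)) i) \<and>
     summable (fps_nth (dist_fps (Ratio p q))) \<and>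
     suminf (fps_nth (dist_fps (Ratio p q))) \<le> 1"

datatype prog =
    Assign nat nat              \<comment> \<open>\<open>x := n\<close>\<close>
  | Decr nat                    \<comment> \<open>\<open>x--\<close>\<close>
  | IncrIid nat dist nat        \<comment> \<open>\<open>x += iid(D, y)\<close>\<close>
  | IfLess nat nat prog prog    \<comment> \<open>\<open>if (x < n) {P1} else {P2}\<close>\<close>
  | Seq prog prog               \<comment> \<open>\<open>P1; P2\<close>\<close>
  | WhileLess nat nat prog      \<comment> \<open>\<open>while (x < n) {P}\<close>\<close>

primrec loop_free :: "prog \<Rightarrow> bool" where
  "loop_free (Assign x n) \<longleftrightarrow> True"
| "loop_free (Decr x) \<longleftrightarrow> True"
| "loop_free (IncrIid x D y) \<longleftrightarrow> True"
| "loop_free (IfLess x n P Q) \<longleftrightarrow> loop_free P \<and> loop_free Q"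
| "loop_free (Seq P Q) \<longleftrightarrow> loop_free P \<and> loop_free Q"
| "loop_free (WhileLess x n P) \<longleftrightarrow> False"

text \<open>Programs over the variables \<open>0, \<dots>, k - 1\<close>.\<close>

primrec redip :: "nat \<Rightarrow> prog \<Rightarrow> bool" where
  "redip k (Assign x n) \<longleftrightarrow> x < k"
| "redip k (Decr x) \<longleftrightarrow> x < k"
| "redip k (IncrIid x D y) \<longleftrightarrow> x < k \<and> y < k \<and> valid_dist D"
| "redip k (IfLess x n P Q) \<longleftrightarrow> x < k \<and> redip k P \<and> redip k Q"
| "redip k (Seq P Q) \<longleftrightarrow> redip k P \<and> redip k Q"
| "redip k (WhileLess x n P) \<longleftrightarrow> x < k \<and> redip k P"

section \<open>Semantics\<close>

text \<open>
  The fixed points of \<open>\<Phi>\<close> are sought among the maps from PGFs to PGFs, ordered pointwise by the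
  coefficient-wise order.  Such a map is made a unique HOL function by extensionality
  (\<open>\<rightarrow>\<^sub>E\<close>), so \<open>\<Phi> \<psi>\<close> and \<open>\<psi>\<close> are compared on PGFs only.
\<close>

definition fixpoints :: "nat \<Rightarrow> ((mfps \<Rightarrow> mfps) \<Rightarrow> (mfps \<Rightarrow> mfps)) \<Rightarrow> (mfps \<Rightarrow> mfps) set" where
  "fixpoints k \<Phi> = {\<psi> \<in> pgfs k \<rightarrow>\<^sub>E pgfs k. \<forall>f\<in>pgfs k. \<Phi> \<psi> f = \<psi> f}"

definition least_fixpoint ::
  "nat \<Rightarrow> ((mfps \<Rightarrow> mfps) \<Rightarrow> (mfps \<Rightarrow> mfps)) \<Rightarrow> (mfps \<Rightarrow> mfps)" where
  "least_fixpoint k \<Phi> =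
     (THE \<psi>. \<psi> \<in> fixpoints k \<Phi> \<and> (\<forall>\<psi>'\<in>fixpoints k \<Phi>. \<forall>f\<in>pgfs k. \<psi> f \<le> \<psi>' f))"

primrec sem :: "nat \<Rightarrow> prog \<Rightarrow> mfps \<Rightarrow> mfps" where
  "sem k (Assign x n) = (\<lambda>g. mmult (msubst x (mconst 1) g) (mvar_pow x n))"
| "sem k (Decr x) =
     (\<lambda>g. madd (mdiv_var x (mdiff g (msubst x (mconst 0) g))) (msubst x (mconst 0) g))"
| "sem k (IncrIid x D y) =
     (\<lambda>g. msubst y (mmult (mvar_pow y 1) (mfps_of_fps x (dist_fps D))) g)"
| "sem k (IfLess x n P Q) =
     (\<lambda>g. madd (sem k P (mbelow x n g)) (sem k Q (mdiff g (mbelow x n g))))"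
| "sem k (Seq P Q) = sem k Q \<circ> sem k P"
| "sem k (WhileLess x n P) =
     least_fixpoint k (\<lambda>\<psi> f. madd (mdiff f (mbelow x n f)) (\<psi> (sem k P (mbelow x n f))))"

text \<open>The semantics as a map on the PGFs in \<open>k\<close> indeterminates.\<close>

definition denotation :: "nat \<Rightarrow> prog \<Rightarrow> mfps \<Rightarrow> mfps" where
  "denotation k P = restrict (sem k P) (pgfs k)"

definition universally_ast :: "nat \<Rightarrow> prog \<Rightarrow> bool" where
  "universally_ast k P \<longleftrightarrow> (\<forall>g\<in>pgfs k. mass (denotation k P g) = mass g)"

section \<open>Decidability\<close>

text \<open>
  The unary partial recursive functions, arguments being combined by the Cantor pairing
  function; this avoids arities and yields the usual class of functions.
\<close>

inductive partial_recursive :: "(nat \<rightharpoonup> nat) \<Rightarrow> bool" where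
  zero: "partial_recursive (\<lambda>a. Some 0)"
| succ: "partial_recursive (\<lambda>a. Some (Suc a))"
| left: "partial_recursive (\<lambda>a. Some (fst (prod_decode a)))"
| right: "partial_recursive (\<lambda>a. Some (snd (prod_decode a)))"
| pair: "partial_recursive f \<Longrightarrow> partial_recursive g \<Longrightarrow>
    partial_recursive
      (\<lambda>a. Option.bind (f a) (\<lambda>u. Option.bind (g a) (\<lambda>v. Some (prod_encode (u, v)))))"
| comp: "partial_recursive f \<Longrightarrow> partial_recursive g \<Longrightarrow>
    partial_recursive (\<lambda>a. Option.bind (g a) f)"
| prec: "partial_recursive f \<Longrightarrow> partial_recursive g \<Longrightarrow>
    partial_recursive
      (\<lambda>a. case prod_decode a of (b, n) \<Rightarrow>
         rec_nat (f b) (\<lambda>i r. Option.bind r (\<lambda>v. g (prod_encode (b, prod_encode (i, v))))) n)"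
| mu: "partial_recursive f \<Longrightarrow>
    partial_recursive
      (\<lambda>a. if \<exists>n. f (prod_encode (a, n)) = Some 0 \<and>
                   (\<forall>m<n. \<exists>v. f (prod_encode (a, m)) = Some (Suc v))
            then Some (LEAST n. f (prod_encode (a, n)) = Some 0)
            else None)"

text \<open>
  Decidability of the property \<open>Q\<close> for instances in \<open>A\<close>, which are presented to the algorithm
  through the numbering \<open>enc\<close>.  On numbers that do not represent an instance in \<open>A\<close> the
  algorithm may answer arbitrarily or diverge.
\<close>

definition decidable_on :: "('a \<Rightarrow> nat) \<Rightarrow> 'a set \<Rightarrow> ('a \<Rightarrow> bool) \<Rightarrow> bool" where
  "decidable_on enc A Q \<longleftrightarrow>
     (\<exists>d. partial_recursive d \<and> (\<forall>a\<in>A. d (enc a) = Some (if Q a then 1 else 0)))"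

definition poly_encode :: "int poly \<Rightarrow> nat" where
  "poly_encode p = list_encode (map int_encode (coeffs p))"

primrec dist_encode :: "dist \<Rightarrow> nat" where
  "dist_encode (Ratio p q) = prod_encode (poly_encode p, poly_encode q)"

primrec prog_encode :: "prog \<Rightarrow> nat" where
  "prog_encode (Assign x n) = prod_encode (0, prod_encode (x, n))"
| "prog_encode (Decr x) = prod_encode (1, x)"
| "prog_encode (IncrIid x D y) = prod_encode (2, prod_encode (x, prod_encode (dist_encode D, y)))"
| "prog_encode (IfLess x n P Q) =
     prod_encode (3, prod_encode (prod_encode (x, n),
                                  prod_encode (prog_encode P, prog_encode Q)))"
| "prog_encode (Seq P Q) = prod_encode (4, prod_encode (prog_encode P, prog_encode Q))"
| "prog_encode (WhileLess x n P) =
     prod_encode (5, prod_encode (prod_encode (x, n), prog_encode P))"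

text \<open>An instance consists of the number of variables and two programs.\<close>

fun instance_encode :: "nat \<times> prog \<times> prog \<Rightarrow> nat" where
  "instance_encode (k, P, Q) = prod_encode (k, prod_encode (prog_encode P, prog_encode Q))"

end

theory Submission
  imports Defs "HOL-Computational_Algebra.Polynomial_Factorial" "HOL-Computational_Algebra.Field_as_Ring"
    "Jordan_Normal_Form.Determinant"
begin

hide_const (open) Module.smult

text \<open>
  For an almost surely terminating loop the least fixed point is the series over all unrollings, so
  \<open>\<lbrakk>L\<rbrakk> = \<lbrakk>I\<rbrakk>\<close> iff \<open>\<lbrakk>I\<rbrakk>\<close> is a fixed point, that is, iff \<open>I\<close> is equivalent to the loop-free
  program \<open>if (x < n) {P; I} else {skip}\<close>: the mass of the part still running after \<open>j\<close> rounds tends to \<open>0\<close>.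

  Equivalence of loop-free programs is decided with the backward transformer \<open>wp\<close>, dual to the
  semantics.  Two programs are equivalent iff they agree on the functions \<open>s \<mapsto> \<Prod>i. u\<^sub>i ^ s\<^sub>i\<close> with
  \<open>0 < u\<^sub>i < 1\<close>.  As functions of one coordinate of \<open>u\<close> and of the state, the values of \<open>wp\<close> are
  combinations of a finite family closed under shifts of the state, with coefficients that are
  rational in the coordinate.  This survives the sampling operators because
  \<open>D = p / q\<close> acts on the family as \<open>q(A)\<^sup>-\<^sup>1 p(A)\<close> for the matrix \<open>A\<close> of the shift.  Dimension and
  degrees are bounded effectively, so agreement on a finite grid of states and rational points
  suffices.  The values at grid points are rational and are certified by finite
  tables, which are found by unbounded search.
\<close>

subsection \<open>Recursive functions\<close>

text \<open>Working backwards keeps everything finite: an assignment sends a series to an infinite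
  marginal sum, while its dual only evaluates an observation at another state, and the product
  functions form a family with one member, rescaled by each increment. Following one coordinate of
  \<open>u\<close> at a time keeps the coefficients univariate. The delicate statement is the draw,
  since nothing is assumed about where the nonzero roots of the denominator of \<open>D\<close> lie.
  Boundedness replaces a study of poles: if \<open>q D = p\<close> and \<open>a p + b q = 1\<close>,
  then a bounded sequence killed by \<open>q(S)\<close>, with \<open>S\<close> the shift, is also
  killed by \<open>p(S) = D(S) q(S)\<close> and is therefore zero. This injectivity keeps the
  determinant of \<open>q(A)\<close> away from 0 for every parameter in \<open>(0, 1)\<close>, makes
  \<open>D(S) F\<close> the only bounded solution \<open>H\<close> of
  \<open>q(S) H = p(S) F\<close>, and yields that solution as \<open>c(S) F\<close> with a rational
  polynomial \<open>c\<close>. An infinite expectation thus has a finite certificate. Searching for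
  certificates asks only that checking be recursive, and the check is local because every entry
  refers to smaller continuations.\<close>

definition tot_rec :: "(nat \<Rightarrow> nat) \<Rightarrow> bool" where
  "tot_rec f \<longleftrightarrow> partial_recursive (\<lambda>a. Some (f a))"

definition dec_pred :: "(nat \<Rightarrow> bool) \<Rightarrow> bool" where
  "dec_pred P \<longleftrightarrow> tot_rec (\<lambda>a. if P a then 1 else 0)"

abbreviation pfst :: "nat \<Rightarrow> nat" where "pfst z \<equiv> fst (prod_decode z)"
abbreviation psnd :: "nat \<Rightarrow> nat" where "psnd z \<equiv> snd (prod_decode z)"

lemma tot_rec_fst0: "tot_rec (\<lambda>a. pfst a)"
  unfolding tot_rec_def by (rule partial_recursive.left)

lemma tot_rec_snd0: "tot_rec (\<lambda>a. psnd a)"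
  unfolding tot_rec_def by (rule partial_recursive.right)

lemma tot_rec_comp: "tot_rec f \<Longrightarrow> tot_rec g \<Longrightarrow> tot_rec (\<lambda>a. f (g a))"
  unfolding tot_rec_def using partial_recursive.comp[of "\<lambda>a. Some (f a)" "\<lambda>a. Some (g a)"] by simp

lemma tot_rec_pair: "tot_rec f \<Longrightarrow> tot_rec g \<Longrightarrow> tot_rec (\<lambda>a. prod_encode (f a, g a))"
  unfolding tot_rec_def using partial_recursive.pair[of "\<lambda>a. Some (f a)" "\<lambda>a. Some (g a)"] by simp

lemma tot_rec_fst: "tot_rec f \<Longrightarrow> tot_rec (\<lambda>a. pfst (f a))"
  by (rule tot_rec_comp[OF tot_rec_fst0])

lemma tot_rec_snd: "tot_rec f \<Longrightarrow> tot_rec (\<lambda>a. psnd (f a))"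
  by (rule tot_rec_comp[OF tot_rec_snd0])

lemma tot_rec_Suc: "tot_rec f \<Longrightarrow> tot_rec (\<lambda>a. Suc (f a))"
  by (rule tot_rec_comp[of Suc]) (simp_all add: tot_rec_def partial_recursive.succ)

lemma tot_rec_const: "tot_rec (\<lambda>a. c)"
proof (induction c)
  case 0
  show ?case by (simp add: tot_rec_def partial_recursive.zero)
qed (rule tot_rec_Suc)

lemma tot_rec_id: "tot_rec (\<lambda>a. a)"
  using tot_rec_pair[OF tot_rec_fst0 tot_rec_snd0] by simp

text \<open>The scheme \<open>prec\<close> recurses on the second half of its argument. Pairing
  \<open>a\<close> with \<open>n a\<close> turns it into a recursion whose base, step and length all
  depend on \<open>a\<close>; the \<open>Option\<close> layer collapses because all functions
  involved are total.\<close>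

lemma tot_rec_rec:
  assumes "tot_rec f" and "tot_rec (\<lambda>z. g (pfst z) (pfst (psnd z)) (psnd (psnd z)))" and "tot_rec n"
  shows "tot_rec (\<lambda>a. rec_nat (f a) (g a) (n a))"
proof -
  let ?g = "\<lambda>z. g (pfst z) (pfst (psnd z)) (psnd (psnd z))"
  have eq: "rec_nat (Some (f b))
      (\<lambda>i r. Option.bind r (\<lambda>v. Some (?g (prod_encode (b, prod_encode (i, v)))))) m
      = Some (rec_nat (f b) (g b) m)" for b m
    by (induction m) simp_all
  have "tot_rec (\<lambda>z. rec_nat (f (pfst z)) (g (pfst z)) (psnd z))"
    using partial_recursive.prec[of "\<lambda>a. Some (f a)" "\<lambda>a. Some (?g a)"] assms(1,2)
    unfolding tot_rec_def by (simp only: eq case_prod_beta)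
  from tot_rec_comp[OF this tot_rec_pair[OF tot_rec_id assms(3)]] show ?thesis by simp
qed

lemma tot_rec_add: "tot_rec f \<Longrightarrow> tot_rec g \<Longrightarrow> tot_rec (\<lambda>a. f a + g a)"
proof -
  assume f: "tot_rec f" and g: "tot_rec g"
  have eq: "rec_nat m (\<lambda>i r. Suc r) n = m + n" for m n :: nat by (induction n) auto
  show ?thesis using tot_rec_rec[OF f _ g, of "\<lambda>a i r. Suc r"]
    by (simp add: eq tot_rec_Suc tot_rec_snd tot_rec_id)
qed

lemma tot_rec_mult: "tot_rec f \<Longrightarrow> tot_rec g \<Longrightarrow> tot_rec (\<lambda>a. f a * g a)"
proof -
  assume f: "tot_rec f" and g: "tot_rec g"
  have eq: "rec_nat 0 (\<lambda>i r. r + m) n = m * n" for m n :: nat by (induction n) auto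
  have "tot_rec (\<lambda>a. rec_nat 0 (\<lambda>i r. r + f a) (g a))"
    by (intro tot_rec_rec tot_rec_const tot_rec_add tot_rec_snd tot_rec_id g tot_rec_comp[OF f] tot_rec_fst)
  then show ?thesis by (simp add: eq)
qed

lemma tot_rec_power: "tot_rec f \<Longrightarrow> tot_rec g \<Longrightarrow> tot_rec (\<lambda>a. f a ^ g a)"
proof -
  assume f: "tot_rec f" and g: "tot_rec g"
  have eq: "rec_nat 1 (\<lambda>i r. r * m) n = m ^ n" for m n :: nat by (induction n) auto
  have "tot_rec (\<lambda>a. rec_nat 1 (\<lambda>i r. r * f a) (g a))"
    by (intro tot_rec_rec tot_rec_const tot_rec_mult tot_rec_snd tot_rec_id g tot_rec_comp[OF f] tot_rec_fst)
  then show ?thesis by (simp only: eq)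
qed

lemma tot_rec_pred: "tot_rec f \<Longrightarrow> tot_rec (\<lambda>a. f a - 1)"
proof -
  assume f: "tot_rec f"
  have eq: "rec_nat 0 (\<lambda>i r. i) n = n - 1" for n :: nat by (induction n) auto
  have "tot_rec (\<lambda>a. rec_nat 0 (\<lambda>i r. i) (f a))"
    by (intro tot_rec_rec tot_rec_const tot_rec_snd tot_rec_id f tot_rec_fst)
  then show ?thesis by (simp add: eq)
qed

lemma tot_rec_diff: "tot_rec f \<Longrightarrow> tot_rec g \<Longrightarrow> tot_rec (\<lambda>a. f a - g a)"
proof -
  assume f: "tot_rec f" and g: "tot_rec g"
  have eq: "rec_nat m (\<lambda>i r. r - 1) n = m - n" for m n :: nat by (induction n) auto
  have "tot_rec (\<lambda>a. rec_nat (f a) (\<lambda>i r. r - 1) (g a))"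
    by (intro tot_rec_rec tot_rec_const tot_rec_snd tot_rec_id f g tot_rec_fst tot_rec_pred)
  then show ?thesis by (simp only: eq)
qed

lemma dec_pred_pos: "tot_rec f \<Longrightarrow> dec_pred (\<lambda>a. 0 < f a)"
proof -
  assume f: "tot_rec f"
  have "(\<lambda>a. if 0 < f a then 1 else 0) = (\<lambda>a. 1 - (1 - f a))" by auto
  then show ?thesis unfolding dec_pred_def by (simp only:) (intro tot_rec_diff tot_rec_const f)
qed

lemma dec_pred_less: "tot_rec f \<Longrightarrow> tot_rec g \<Longrightarrow> dec_pred (\<lambda>a. f a < g a)"
  using dec_pred_pos[OF tot_rec_diff, of g f] by simp

lemma dec_pred_not: "dec_pred P \<Longrightarrow> dec_pred (\<lambda>a. \<not> P a)"
proof -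
  assume P: "dec_pred P"
  have "(\<lambda>a. if \<not> P a then 1 else 0) = (\<lambda>a. 1 - (if P a then 1 else 0 :: nat))" by auto
  then show ?thesis using P unfolding dec_pred_def by (simp only:) (intro tot_rec_diff tot_rec_const)
qed

lemma dec_pred_conj: "dec_pred P \<Longrightarrow> dec_pred Q \<Longrightarrow> dec_pred (\<lambda>a. P a \<and> Q a)"
proof -
  assume P: "dec_pred P" and Q: "dec_pred Q"
  have "(\<lambda>a. if P a \<and> Q a then 1 else 0) =
      (\<lambda>a. (if P a then 1 else 0) * (if Q a then 1 else 0 :: nat))" by auto
  then show ?thesis using P Q unfolding dec_pred_def by (simp only:) (intro tot_rec_mult)
qed

lemma dec_pred_disj: "dec_pred P \<Longrightarrow> dec_pred Q \<Longrightarrow> dec_pred (\<lambda>a. P a \<or> Q a)"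
  using dec_pred_not[OF dec_pred_conj[OF dec_pred_not dec_pred_not], of P Q] by simp

lemma dec_pred_imp: "dec_pred P \<Longrightarrow> dec_pred Q \<Longrightarrow> dec_pred (\<lambda>a. P a \<longrightarrow> Q a)"
  unfolding imp_conv_disj by (intro dec_pred_disj dec_pred_not)

lemma dec_pred_le: "tot_rec f \<Longrightarrow> tot_rec g \<Longrightarrow> dec_pred (\<lambda>a. f a \<le> g a)"
  using dec_pred_not[OF dec_pred_less, of g f] by (simp add: not_less)

lemma dec_pred_eq: "tot_rec f \<Longrightarrow> tot_rec g \<Longrightarrow> dec_pred (\<lambda>a. f a = g a)"
  using dec_pred_conj[OF dec_pred_le dec_pred_le, of f g g f] by (simp add: eq_iff)

lemma tot_rec_If: "dec_pred P \<Longrightarrow> tot_rec f \<Longrightarrow> tot_rec g \<Longrightarrow> tot_rec (\<lambda>a. if P a then f a else g a)"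
proof -
  assume P: "dec_pred P" and f: "tot_rec f" and g: "tot_rec g"
  have "(\<lambda>a. if P a then f a else g a) = (\<lambda>a. (if P a then 1 else 0) * f a
      + (1 - (if P a then 1 else 0)) * g a)" by auto
  then show ?thesis using P f g unfolding dec_pred_def
    by (simp only:) (intro tot_rec_add tot_rec_diff tot_rec_mult tot_rec_const)
qed

lemma dec_pred_If: "dec_pred P \<Longrightarrow> dec_pred f \<Longrightarrow> dec_pred g \<Longrightarrow> dec_pred (\<lambda>a. if P a then f a else g a)"
  unfolding if_bool_eq_conj by (intro dec_pred_conj dec_pred_imp dec_pred_not)

lemma tot_rec_sum:
  assumes "tot_rec (\<lambda>z. f (pfst z) (psnd z))" and "tot_rec b"
  shows "tot_rec (\<lambda>a. \<Sum>i<b a. f a i)"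
proof -
  have eq: "rec_nat 0 (\<lambda>i r. r + f a i) n = (\<Sum>i<n. f a i)" for a n by (induction n) auto
  have "tot_rec (\<lambda>z. f (pfst z) (pfst (psnd z)))"
    using tot_rec_comp[OF assms(1) tot_rec_pair[OF tot_rec_fst0 tot_rec_fst[OF tot_rec_snd0]]] by simp
  then have "tot_rec (\<lambda>a. rec_nat 0 (\<lambda>i r. r + f a i) (b a))"
    by (intro tot_rec_rec tot_rec_const tot_rec_add tot_rec_snd tot_rec_id assms(2))
  then show ?thesis by (simp only: eq)
qed

lemma dec_pred_ex:
  assumes "dec_pred (\<lambda>z. P (pfst z) (psnd z))" and "tot_rec b"
  shows "dec_pred (\<lambda>a. \<exists>i<b a. P a i)"
proof -
  have "dec_pred (\<lambda>a. 0 < (\<Sum>i<b a. if P a i then 1 else 0 :: nat))"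
    using assms unfolding dec_pred_def[of "\<lambda>z. P (pfst z) (psnd z)"]
    by (intro dec_pred_pos tot_rec_sum)
  moreover have "0 < (\<Sum>i<b a. if P a i then 1 else 0 :: nat) \<longleftrightarrow> (\<exists>i<b a. P a i)" for a
    by (subst zero_less_iff_neq_zero) (auto simp: sum_eq_0_iff)
  ultimately show ?thesis by simp
qed

lemma dec_pred_all:
  assumes "dec_pred (\<lambda>z. P (pfst z) (psnd z))" and "tot_rec b"
  shows "dec_pred (\<lambda>a. \<forall>i<b a. P a i)"
  using dec_pred_not[OF dec_pred_ex[OF dec_pred_not[OF assms(1)] assms(2)]] by simp

lemma tot_rec_div: "tot_rec f \<Longrightarrow> tot_rec g \<Longrightarrow> tot_rec (\<lambda>a. f a div g a)"
proof -
  assume f: "tot_rec f" and g: "tot_rec g"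
  \<comment> \<open>The quotient counts the positive multiples of \<open>n\<close> up to
    \<open>m\<close>. The guard \<open>0 < n\<close> produces the value 0 of division by
    zero.\<close>
  have eq: "(\<Sum>i<m. if 0 < n \<and> Suc i * n \<le> m then 1 else 0) = m div n" for m n :: nat
  proof (cases "n = 0")
    case False
    then have iff: "0 < n \<and> Suc i * n \<le> m \<longleftrightarrow> i < m div n" for i
      by (simp only: less_eq_div_iff_mult_less_eq[symmetric] Suc_le_eq neq0_conv) simp
    have "{..<m} \<inter> {i. i < m div n} = {..<m div n}"
      using div_le_dividend[of m n] by (auto simp del: div_le_dividend)
    then show ?thesis unfolding iff by (simp add: sum.If_cases)
  qed simp
  have "tot_rec (\<lambda>a. \<Sum>i<f a. if 0 < g a \<and> Suc i * g a \<le> f a then 1 else 0)"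
    by (intro tot_rec_sum tot_rec_If dec_pred_conj dec_pred_pos dec_pred_le tot_rec_mult tot_rec_Suc tot_rec_snd tot_rec_id
        tot_rec_const f g tot_rec_comp[OF f] tot_rec_comp[OF g] tot_rec_fst)
  then show ?thesis by (simp only: eq)
qed

lemma tot_rec_mod: "tot_rec f \<Longrightarrow> tot_rec g \<Longrightarrow> tot_rec (\<lambda>a. f a mod g a)"
proof -
  assume "tot_rec f" "tot_rec g"
  then have "tot_rec (\<lambda>a. f a - f a div g a * g a)" by (intro tot_rec_diff tot_rec_mult tot_rec_div)
  then show ?thesis by (simp only: minus_div_mult_eq_mod)
qed

text \<open>Sequences are coded as by \<open>list_encode\<close>, and reading beyond the end gives \<open>0\<close>.\<close>

definition seq_tl :: "nat \<Rightarrow> nat" where "seq_tl n = psnd (n - 1)"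

definition el :: "nat \<Rightarrow> nat \<Rightarrow> nat" where
  "el s i = pfst ((seq_tl ^^ i) s - 1)"

definition seq_cons :: "nat \<Rightarrow> nat \<Rightarrow> nat" where
  "seq_cons x s = Suc (prod_encode (x, s))"

text \<open>Since \<open>prod_decode 0 = (0, 0)\<close>, the code 0 of the empty list is its own
  tail, which is why reading past the end of a sequence keeps returning 0.\<close>

lemma seq_tl_0 [simp]: "seq_tl 0 = 0"
  by (simp add: seq_tl_def prod_decode_def prod_decode_aux.simps)

lemma el_0 [simp]: "el 0 i = 0"
proof -
  have "(seq_tl ^^ i) 0 = 0" by (induction i) auto
  then show ?thesis by (simp add: el_def prod_decode_def prod_decode_aux.simps)
qed

lemma seq_tl_cons [simp]: "seq_tl (seq_cons x s) = s"
  by (simp add: seq_tl_def seq_cons_def)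

lemma el_cons_0 [simp]: "el (seq_cons x s) 0 = x"
  by (simp add: el_def seq_cons_def)

lemma el_cons_Suc [simp]: "el (seq_cons x s) (Suc i) = el s i"
  by (simp add: el_def funpow_Suc_right del: funpow.simps)

lemma list_encode_Cons: "list_encode (x # xs) = seq_cons x (list_encode xs)"
  by (simp add: seq_cons_def)

lemma el_list_encode: "el (list_encode xs) i = (if i < length xs then xs ! i else 0)"
proof (induction xs arbitrary: i)
  case (Cons x xs)
  then show ?case
    by (cases i) (simp_all add: list_encode_Cons del: list_encode.simps(2))
qed simp

lemma tot_rec_seq_tl: "tot_rec f \<Longrightarrow> tot_rec (\<lambda>a. seq_tl (f a))"
  unfolding seq_tl_def by (intro tot_rec_snd tot_rec_pred)

lemma tot_rec_el: "tot_rec f \<Longrightarrow> tot_rec g \<Longrightarrow> tot_rec (\<lambda>a. el (f a) (g a))"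
proof -
  assume f: "tot_rec f" and g: "tot_rec g"
  have eq: "rec_nat s (\<lambda>i r. seq_tl r) n = (seq_tl ^^ n) s" for s n by (induction n) auto
  have "tot_rec (\<lambda>a. rec_nat (f a) (\<lambda>i r. seq_tl r) (g a))"
    by (intro tot_rec_rec f g tot_rec_seq_tl tot_rec_snd tot_rec_id)
  then show ?thesis unfolding el_def eq[symmetric] by (intro tot_rec_fst tot_rec_pred)
qed

lemma tot_rec_seq_cons: "tot_rec f \<Longrightarrow> tot_rec g \<Longrightarrow> tot_rec (\<lambda>a. seq_cons (f a) (g a))"
  unfolding seq_cons_def by (intro tot_rec_Suc tot_rec_pair)

section \<open>Computable rational arithmetic\<close>

text \<open>A code stands for \<open>(a - b) / (c + 1)\<close>: with two naturals for the sign and a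
  successor as denominator every natural number is a code, and arithmetic needs no reduction to
  lowest terms. Codes are not unique, so equality is tested on values.\<close>

definition rat_val :: "nat \<Rightarrow> real" where
  "rat_val n = (real (pfst n) - real (pfst (psnd n))) / real (Suc (psnd (psnd n)))"

text \<open>The functions are real-valued so that checks can be written with ordinary sums and
  products; the existential hides the codes on which the algorithm works.\<close>

definition rat_rec :: "(nat \<Rightarrow> real) \<Rightarrow> bool" where
  "rat_rec f \<longleftrightarrow> (\<exists>F. tot_rec F \<and> (\<forall>a. f a = rat_val (F a)))"

lemma rat_val_encode:
  "rat_val (prod_encode (a, prod_encode (b, c))) = (real a - real b) / real (Suc c)"
  by (simp add: rat_val_def)

lemma rat_rec_val: "tot_rec f \<Longrightarrow> rat_rec (\<lambda>a. rat_val (f a))"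
  unfolding rat_rec_def by blast

lemma rat_rec_nat: "tot_rec f \<Longrightarrow> rat_rec (\<lambda>a. real (f a))"
  using rat_rec_val[OF tot_rec_pair[OF _ tot_rec_const[of "prod_encode (0, 0)"]], of f]
  by (simp add: rat_val_encode)

lemma rat_rec_const_nat: "rat_rec (\<lambda>a. 0)" "rat_rec (\<lambda>a. 1)"
  using rat_rec_nat[OF tot_rec_const[of 0]] rat_rec_nat[OF tot_rec_const[of 1]] by simp_all

lemma rat_rec_inverse_Suc: "tot_rec f \<Longrightarrow> rat_rec (\<lambda>a. 1 / real (Suc (f a)))"
  using rat_rec_val[OF tot_rec_pair[OF tot_rec_const[of 1] tot_rec_pair[OF tot_rec_const[of 0]]], of f]
  by (simp add: rat_val_encode)

lemma rat_rec_uminus: "rat_rec f \<Longrightarrow> rat_rec (\<lambda>a. - f a)"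
proof -
  assume "rat_rec f"
  then obtain F where F: "tot_rec F" "\<And>a. f a = rat_val (F a)" unfolding rat_rec_def by blast
  have "- f a = rat_val (prod_encode (pfst (psnd (F a)), prod_encode (pfst (F a), psnd (psnd (F a)))))"
    for a by (simp add: F rat_val_encode rat_val_def diff_divide_distrib)
  with F(1) show ?thesis
    by (simp only:) (intro rat_rec_val tot_rec_pair tot_rec_fst tot_rec_snd)
qed

lemma rat_rec_mult: "rat_rec f \<Longrightarrow> rat_rec g \<Longrightarrow> rat_rec (\<lambda>a. f a * g a)"
proof -
  assume "rat_rec f" "rat_rec g"
  then obtain F G where F: "tot_rec F" "\<And>a. f a = rat_val (F a)"
    and G: "tot_rec G" "\<And>a. g a = rat_val (G a)" unfolding rat_rec_def by blast
  define m where "m x y = prod_encode (pfst x * pfst y + pfst (psnd x) * pfst (psnd y),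
    prod_encode (pfst x * pfst (psnd y) + pfst (psnd x) * pfst y,
      Suc (psnd (psnd x)) * Suc (psnd (psnd y)) - 1))" for x y
  have "rat_val (m x y) = rat_val x * rat_val y" for x y
    unfolding m_def rat_val_encode unfolding rat_val_def
    by (simp add: algebra_simps diff_divide_distrib add_divide_distrib)
  then have "f a * g a = rat_val (m (F a) (G a))" for a by (simp add: F G)
  moreover have "tot_rec (\<lambda>a. m (F a) (G a))"
    unfolding m_def
    by (intro tot_rec_pair tot_rec_add tot_rec_mult tot_rec_fst tot_rec_snd tot_rec_Suc tot_rec_pred F(1) G(1))
  ultimately show ?thesis by (simp only: rat_rec_val)
qed

lemma rat_rec_add: "rat_rec f \<Longrightarrow> rat_rec g \<Longrightarrow> rat_rec (\<lambda>a. f a + g a)"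
proof -
  assume "rat_rec f" "rat_rec g"
  then obtain F G where F: "tot_rec F" "\<And>a. f a = rat_val (F a)"
    and G: "tot_rec G" "\<And>a. g a = rat_val (G a)" unfolding rat_rec_def by blast
  define m where "m x y = prod_encode (pfst x * Suc (psnd (psnd y)) + pfst y * Suc (psnd (psnd x)),
    prod_encode (pfst (psnd x) * Suc (psnd (psnd y)) + pfst (psnd y) * Suc (psnd (psnd x)),
      Suc (psnd (psnd x)) * Suc (psnd (psnd y)) - 1))" for x y
  have "rat_val (m x y) = rat_val x + rat_val y" for x y
  proof -
    have "(a - b) / c + (a' - b') / c' = ((a * c' + a' * c) - (b * c' + b' * c)) / (c * c')"
      if "c > 0" "c' > 0" for a b c a' b' c' :: real
      using that by (simp add: field_simps)
    then show ?thesis unfolding m_def rat_val_encode unfolding rat_val_def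
      by (simp del: mult_Suc mult_Suc_right of_nat_Suc)
  qed
  then have "f a + g a = rat_val (m (F a) (G a))" for a by (simp add: F G)
  moreover have "tot_rec (\<lambda>a. m (F a) (G a))"
    unfolding m_def
    by (intro tot_rec_pair tot_rec_add tot_rec_mult tot_rec_fst tot_rec_snd tot_rec_Suc tot_rec_pred F(1) G(1))
  ultimately show ?thesis by (simp only: rat_rec_val)
qed

lemma rat_rec_If: "dec_pred P \<Longrightarrow> rat_rec f \<Longrightarrow> rat_rec g \<Longrightarrow> rat_rec (\<lambda>a. if P a then f a else g a)"
proof -
  assume P: "dec_pred P" and "rat_rec f" "rat_rec g"
  then obtain F G where F: "tot_rec F" "\<And>a. f a = rat_val (F a)"
    and G: "tot_rec G" "\<And>a. g a = rat_val (G a)" unfolding rat_rec_def by blast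
  have "(if P a then f a else g a) = rat_val (if P a then F a else G a)" for a
    by (simp add: F G)
  then show ?thesis by (simp only:) (intro rat_rec_val tot_rec_If P F(1) G(1))
qed

lemma rat_rec_rec:
  assumes "tot_rec F" and "tot_rec (\<lambda>z. G (pfst z) (pfst (psnd z)) (psnd (psnd z)))" and "tot_rec n"
    and "\<And>a. f a = rat_val (F a)" "\<And>a i r. g a i (rat_val r) = rat_val (G a i r)"
  shows "rat_rec (\<lambda>a. rec_nat (f a) (g a) (n a))"
proof -
  have "rec_nat (f a) (g a) m = rat_val (rec_nat (F a) (G a) m)" for a m
    by (induction m) (simp_all add: assms)
  then show ?thesis by (simp only: rat_rec_val[OF tot_rec_rec[OF assms(1-3)]])
qed

text \<open>Applied to the two decoded projections of a pair, the closure property \<open>op\<close>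
  yields one recursive function on codes that implements \<open>h\<close>; iterating it is primitive
  recursion.\<close>

lemma rat_rec_fold:
  assumes op: "\<And>f g. rat_rec f \<Longrightarrow> rat_rec g \<Longrightarrow> rat_rec (\<lambda>a. h (f a) (g a))"
    and f: "rat_rec (\<lambda>z. f (pfst z) (psnd z))" and c: "rat_rec (\<lambda>a. c)" and n: "tot_rec n"
  shows "rat_rec (\<lambda>a. rec_nat c (\<lambda>i r. h r (f a i)) (n a))"
proof -
  obtain C where C: "c = rat_val C" using c unfolding rat_rec_def by auto
  obtain F where F: "tot_rec F" "\<And>z. f (pfst z) (psnd z) = rat_val (F z)" using f unfolding rat_rec_def by auto
  have "rat_rec (\<lambda>z. h (rat_val (pfst z)) (rat_val (psnd z)))"
    by (intro op rat_rec_val tot_rec_fst0 tot_rec_snd0)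
  then obtain H where H: "tot_rec H" "\<And>z. h (rat_val (pfst z)) (rat_val (psnd z)) = rat_val (H z)"
    unfolding rat_rec_def by blast
  show ?thesis
  proof (rule rat_rec_rec[where F = "\<lambda>a. C" and G = "\<lambda>a i r. H (prod_encode (r, F (prod_encode (a, i))))"])
    show "tot_rec (\<lambda>z. H (prod_encode (psnd (psnd z), F (prod_encode (pfst z, pfst (psnd z))))))"
      by (intro tot_rec_comp[OF H(1)] tot_rec_comp[OF F(1)] tot_rec_pair tot_rec_fst tot_rec_snd tot_rec_id)
    show "h (rat_val r) (f a i) = rat_val (H (prod_encode (r, F (prod_encode (a, i)))))" for a i r
      using H(2)[of "prod_encode (r, F (prod_encode (a, i)))"] F(2)[of "prod_encode (a, i)"] by simp
  qed (simp_all add: tot_rec_const n C)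
qed

lemma rat_rec_sum:
  assumes "rat_rec (\<lambda>z. f (pfst z) (psnd z))" and "tot_rec n"
  shows "rat_rec (\<lambda>a. \<Sum>i<n a. f a i)"
proof -
  have "rec_nat 0 (\<lambda>i r. r + f a i) m = (\<Sum>i<m. f a i)" for a m by (induction m) auto
  then show ?thesis
    using rat_rec_fold[of "(+)" f 0 n] assms rat_rec_add rat_rec_const_nat(1) by simp
qed

lemma rat_rec_prod:
  assumes "rat_rec (\<lambda>z. f (pfst z) (psnd z))" and "tot_rec n"
  shows "rat_rec (\<lambda>a. \<Prod>i<n a. f a i)"
proof -
  have "rec_nat 1 (\<lambda>i r. r * f a i) m = (\<Prod>i<m. f a i)" for a m by (induction m) auto
  then show ?thesis
    using rat_rec_fold[of "(*)" f 1 n] assms rat_rec_mult rat_rec_const_nat(2) by simp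
qed

lemma rat_rec_comp: "rat_rec f \<Longrightarrow> tot_rec g \<Longrightarrow> rat_rec (\<lambda>a. f (g a))"
  unfolding rat_rec_def using tot_rec_comp by fastforce

lemma rat_rec_power:
  assumes f: "rat_rec f" and g: "tot_rec g"
  shows "rat_rec (\<lambda>a. f a ^ g a)"
  using rat_rec_prod[OF rat_rec_comp[OF f tot_rec_fst0] g] by simp

text \<open>The difference has a computable code, and its value is zero iff the two naturals in the
  numerator agree.\<close>

lemma dec_pred_req: "rat_rec f \<Longrightarrow> rat_rec g \<Longrightarrow> dec_pred (\<lambda>a. f a = g a)"
proof -
  assume "rat_rec f" "rat_rec g"
  from rat_rec_add[OF this(1) rat_rec_uminus[OF this(2)]]
  obtain F where F: "tot_rec F" "\<And>a. f a + - g a = rat_val (F a)" unfolding rat_rec_def by blast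
  have "f a = g a \<longleftrightarrow> pfst (F a) = pfst (psnd (F a))" for a
    using F(2)[of a] unfolding rat_val_def by auto
  then show ?thesis by (simp only:) (intro dec_pred_eq tot_rec_fst tot_rec_snd F(1))
qed

definition int_code_val :: "nat \<Rightarrow> real" where
  "int_code_val c = real_of_int (int_decode c)"

lemma rat_rec_int_code: "tot_rec f \<Longrightarrow> rat_rec (\<lambda>a. int_code_val (f a))"
proof -
  assume f: "tot_rec f"
  have eq: "int_code_val c = (if c mod 2 = 0 then real (c div 2) else - real (Suc (c div 2)))" for c
    by (cases "even c") (auto simp: int_code_val_def int_decode_def sum_decode_def mod2_eq_if)
  show ?thesis unfolding eq
    by (intro rat_rec_If dec_pred_eq rat_rec_uminus rat_rec_nat tot_rec_Suc tot_rec_mod tot_rec_div tot_rec_const f)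
qed

lemma rat_val_surj: "x \<in> \<rat> \<Longrightarrow> \<exists>c. rat_val c = x"
proof -
  assume "x \<in> \<rat>"
  then obtain p q where pq: "q > 0" "x = real_of_int p / real_of_int q"
    by (metis Rats_cases' of_int_0_less_iff)
  obtain c where c: "nat q = Suc c" using pq(1) by (metis gr0_implies_Suc zero_less_nat_eq)
  have "rat_val (prod_encode (nat p, prod_encode (nat (- p), c))) = x"
  proof -
    have "real (Suc c) = real_of_int q" using pq(1) by (simp add: c[symmetric])
    moreover have "real (nat p) - real (nat (- p)) = real_of_int p" by (cases "p \<ge> 0") auto
    ultimately show ?thesis by (simp add: rat_val_encode pq(2) del: of_nat_Suc)
  qed
  then show ?thesis by blast
qed

lemma rat_val_Rats: "rat_val c \<in> \<rat>"
  unfolding rat_val_def by simp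

text \<open>\<open>P\<close> is what the search waits for, \<open>Q\<close> the answer read off its
  result. Only the existence of some found \<open>n\<close> is recorded, because in the application
  all certificates lead to the same answer.\<close>

lemma search_partial_recursive:
  assumes P: "dec_pred (\<lambda>z. P (pfst z) (psnd z))" and Q: "dec_pred (\<lambda>z. Q (pfst z) (psnd z))"
  shows "\<exists>d. partial_recursive d \<and>
    (\<forall>a. (\<exists>n. P a n) \<longrightarrow> (\<exists>n. P a n \<and> d a = Some (if Q a n then 1 else 0)))"
proof -
  let ?f = "\<lambda>z. if P (pfst z) (psnd z) then 0 else 1 :: nat"
  let ?q = "\<lambda>z. if Q (pfst z) (psnd z) then 1 else 0 :: nat"
  let ?mu = "\<lambda>a. if \<exists>n. P a n then Some (LEAST n. P a n) else None"
  have "partial_recursive (\<lambda>z. Some (?f z))"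
    using tot_rec_If[OF P tot_rec_const tot_rec_const] unfolding tot_rec_def .
  note m = partial_recursive.mu[OF this]
  have e: "(Some (if b then 0 else 1 :: nat) = Some 0) = b"
      "(\<exists>v. Some (if b then 0 else 1 :: nat) = Some (Suc v)) = (\<not> b)" for b
    by auto
  from m have "partial_recursive (\<lambda>a. if \<exists>n. P a n \<and> (\<forall>m<n. \<not> P a m) then Some (LEAST n. P a n) else None)"
    by (simp only: prod_encode_inverse fst_conv snd_conv e)
  moreover have "(\<exists>n. P a n \<and> (\<forall>m<n. \<not> P a m)) \<longleftrightarrow> (\<exists>n. P a n)" for a
    using exists_least_iff[of "P a"] by blast
  ultimately have mu: "partial_recursive ?mu" by simp
  have q: "partial_recursive (\<lambda>z. Some (?q z))"
    using Q unfolding dec_pred_def tot_rec_def .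
  have pr: "partial_recursive (\<lambda>a. Option.bind (Some a)
      (\<lambda>u. Option.bind (?mu a) (\<lambda>v. Some (prod_encode (u, v)))))"
    using partial_recursive.pair[OF _ mu, of Some] tot_rec_id[unfolded tot_rec_def] by blast
  define d where "d = (\<lambda>a. Option.bind
    (Option.bind (Some a) (\<lambda>u. Option.bind (?mu a) (\<lambda>v. Some (prod_encode (u, v))))) (\<lambda>z. Some (?q z)))"
  have "partial_recursive d"
    unfolding d_def by (rule partial_recursive.comp[OF q pr])
  moreover have "\<exists>n. P a n \<and> d a = Some (if Q a n then 1 else 0)" if "\<exists>n. P a n" for a
  proof (rule exI, rule conjI)
    show "P a (LEAST n. P a n)" using that by (rule LeastI_ex)
    show "d a = Some (if Q a (LEAST n. P a n) then 1 else 0)"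
      unfolding d_def using that by simp
  qed
  ultimately show ?thesis by blast
qed

section \<open>Absolutely convergent sums and image measures\<close>

abbreviation single :: "nat \<Rightarrow> nat \<Rightarrow> (nat \<Rightarrow>\<^sub>0 nat)" where
  "single \<equiv> Poly_Mapping.single"

abbreviation lookup :: "(nat \<Rightarrow>\<^sub>0 nat) \<Rightarrow> nat \<Rightarrow> nat" where
  "lookup \<equiv> Poly_Mapping.lookup"

definition unit_bounded :: "('a \<Rightarrow> real) \<Rightarrow> bool" where
  "unit_bounded f \<longleftrightarrow> (\<forall>s. \<bar>f s\<bar> \<le> 1)"

lemma summable_on_abs_le:
  fixes f g :: "'a \<Rightarrow> real"
  assumes "g summable_on A" "\<And>x. x \<in> A \<Longrightarrow> \<bar>f x\<bar> \<le> g x"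
  shows "f summable_on A"
proof -
  have "(\<lambda>x. \<bar>f x\<bar>) summable_on A"
    by (rule summable_on_comparison_test[OF assms(1)]) (use assms(2) in auto)
  then show ?thesis using abs_summable_summable[of f A] by simp
qed

lemma abs_infsum_le:
  fixes f g :: "'a \<Rightarrow> real"
  assumes "g summable_on A" "\<And>x. x \<in> A \<Longrightarrow> \<bar>f x\<bar> \<le> g x"
  shows "\<bar>infsum f A\<bar> \<le> infsum g A"
proof -
  have f: "f summable_on A" by (rule summable_on_abs_le[OF assms])
  have "infsum f A \<le> infsum g A"
    by (rule infsum_mono[OF f assms(1)]) (use assms(2) abs_le_D1 in blast)
  moreover have "infsum (\<lambda>x. - f x) A \<le> infsum g A"
    by (rule infsum_mono) (use assms f summable_on_uminus abs_le_D2 in blast)+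
  ultimately show ?thesis by (simp add: infsum_uminus abs_le_iff)
qed

lemma summable_on_mult_unit_bounded:
  fixes g f :: "'a \<Rightarrow> real"
  assumes "g summable_on A" "\<And>x. x \<in> A \<Longrightarrow> 0 \<le> g x" "unit_bounded f"
  shows "(\<lambda>x. g x * f x) summable_on A"
  by (rule summable_on_abs_le[OF assms(1)])
    (use assms(2,3) in \<open>auto simp: abs_mult unit_bounded_def intro: mult_left_le\<close>)

text \<open>Image measure and change of variables: the index set is the disjoint union of the fibres
  of \<open>\<phi>\<close>, and summing over fibres first is Fubini for absolutely convergent sums.
  The semantics of every atomic statement is brought into this form.\<close>

lemma pushforward:
  fixes F :: "'i \<Rightarrow> real" and \<phi> :: "'i \<Rightarrow> 'a" and f :: "'a \<Rightarrow> real"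
  assumes F: "\<And>i. 0 \<le> F i" "F summable_on UNIV" and f: "unit_bounded f"
  defines "g \<equiv> \<lambda>\<tau>. infsum F {i. \<phi> i = \<tau>}"
  shows "0 \<le> g \<tau>" and "g summable_on UNIV"
    and "infsum (\<lambda>\<tau>. g \<tau> * f \<tau>) UNIV = infsum (\<lambda>i. F i * f (\<phi> i)) UNIV"
proof -
  let ?S = "Sigma UNIV (\<lambda>\<tau>. {i. \<phi> i = \<tau>})"
  show "0 \<le> g \<tau>" by (simp add: g_def infsum_nonneg F(1))
  have bij: "bij_betw (\<lambda>i. (\<phi> i, i)) UNIV ?S"
    by (rule bij_betw_byWitness[where f' = snd]) auto
  have sub: "F summable_on B" for B
    by (rule summable_on_subset[OF F(2)]) auto
  have sum1: "(\<lambda>p. F (snd p)) summable_on ?S"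
    using summable_on_reindex_bij_betw[OF bij, of "\<lambda>p. F (snd p)"] F(2) by simp
  have "(\<lambda>\<tau>. infsum (\<lambda>i. F (snd (\<tau>, i))) {i. \<phi> i = \<tau>}) summable_on UNIV"
    by (rule summable_on_Sigma_banach) (use sum1 in \<open>simp add: case_prod_unfold\<close>)
  then show "g summable_on UNIV" by (simp add: g_def)
  have sum2: "(\<lambda>p. F (snd p) * f (fst p)) summable_on ?S"
    by (rule summable_on_abs_le[OF sum1])
      (use F f in \<open>auto simp: abs_mult unit_bounded_def intro: mult_left_le\<close>)
  have "infsum (\<lambda>i. F i * f (\<phi> i)) UNIV = infsum (\<lambda>p. F (snd p) * f (fst p)) ?S"
    using infsum_reindex_bij_betw[OF bij, of "\<lambda>p. F (snd p) * f (fst p)"] by simp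
  also have "\<dots> = infsum (\<lambda>\<tau>. infsum (\<lambda>i. F (snd (\<tau>, i)) * f (fst (\<tau>, i))) {i. \<phi> i = \<tau>}) UNIV"
    by (rule infsum_Sigma_banach[OF sum2, symmetric])
  also have "\<dots> = infsum (\<lambda>\<tau>. g \<tau> * f \<tau>) UNIV"
    by (rule infsum_cong) (simp add: g_def infsum_cmult_left sub)
  finally show "infsum (\<lambda>\<tau>. g \<tau> * f \<tau>) UNIV = infsum (\<lambda>i. F i * f (\<phi> i)) UNIV" by simp
qed

subsection \<open>Sub-probability distributions\<close>

definition subprob :: "real fps \<Rightarrow> bool" where
  "subprob D \<longleftrightarrow> (\<forall>i. 0 \<le> fps_nth D i) \<and> fps_nth D summable_on UNIV \<and> infsum (fps_nth D) UNIV \<le> 1"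

lemma subprob_dist: "valid_dist D \<Longrightarrow> subprob (dist_fps D)"
proof (cases D)
  case (Ratio p q)
  assume v: "valid_dist D"
  let ?d = "fps_nth (dist_fps D)"
  have d: "\<And>i. 0 \<le> ?d i" "summable ?d" "suminf ?d \<le> 1" using v Ratio by auto
  have "?d summable_on UNIV"
    by (rule summable_nonneg_imp_summable_on) (use d in auto)
  moreover from this have "infsum ?d UNIV = suminf ?d"
    using has_sum_imp_sums[OF has_sum_infsum] sums_unique by force
  ultimately show ?thesis using d by (simp add: subprob_def)
qed

lemma subprob_1: "subprob 1"
proof -
  have "(fps_nth (1 :: real fps) has_sum 1) UNIV"
    by (rule has_sum_finite_neutralI[of "{0}"]) auto
  then show ?thesis using infsumI summable_on_def by (fastforce simp: subprob_def)
qed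

lemma subprob_pair_summable:
  assumes "subprob D" "\<And>i. subprob (E i)"
  shows "(\<lambda>p. fps_nth D (fst p) * fps_nth (E (fst p)) (snd p)) summable_on UNIV"
    and "infsum (\<lambda>p. fps_nth D (fst p) * fps_nth (E (fst p)) (snd p)) UNIV \<le> 1"
proof -
  let ?h = "\<lambda>p. fps_nth D (fst p) * fps_nth (E (fst p)) (snd p)"
  let ?m = "\<lambda>i. fps_nth D i * infsum (fps_nth (E i)) UNIV"
  have 1: "((\<lambda>j. ?h (i, j)) has_sum ?m i) UNIV" for i
    using assms(2)[of i] by (auto simp: subprob_def intro!: has_sum_cmult_right)
  have e: "0 \<le> infsum (fps_nth (E i)) UNIV" "infsum (fps_nth (E i)) UNIV \<le> 1" for i
    using assms(2)[of i] by (auto simp: subprob_def intro: infsum_nonneg)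
  have m: "?m summable_on UNIV"
    by (rule summable_on_abs_le[of "fps_nth D"])
       (use assms(1) e in \<open>auto simp: subprob_def abs_mult intro: mult_left_le\<close>)
  have S: "?h summable_on UNIV \<times> UNIV"
    by (rule summable_on_SigmaI[OF 1 m]) (use assms in \<open>auto simp: subprob_def\<close>)
  then show "?h summable_on UNIV" by simp
  have "infsum ?h UNIV = infsum (\<lambda>i. infsum (\<lambda>j. ?h (i, j)) UNIV) UNIV"
    using infsum_Sigma_banach[OF S] by simp
  also have "\<dots> = infsum ?m UNIV" using infsumI[OF 1] by simp
  also have "\<dots> \<le> infsum (fps_nth D) UNIV"
    by (rule infsum_mono[OF m]) (use assms(1) e in \<open>auto simp: subprob_def intro: mult_left_le\<close>)
  finally show "infsum ?h UNIV \<le> 1" using assms(1) by (simp add: subprob_def)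
qed

lemma fps_mult_pushforward:
  "fps_nth (D * E) n = infsum (\<lambda>p. fps_nth D (fst p) * fps_nth E (snd p)) {p. fst p + snd p = n}"
proof -
  have eq: "{p. fst p + snd p = n} = (\<lambda>i. (i, n - i)) ` {0..n}"
    by (auto simp: image_iff)
  show ?thesis unfolding fps_mult_nth eq
    by (subst infsum_finite) (auto simp: sum.reindex inj_on_def)
qed

lemma subprob_mult: assumes "subprob D" "subprob E" shows "subprob (D * E)"
proof -
  let ?h = "\<lambda>p. fps_nth D (fst p) * fps_nth E (snd p)"
  have h: "0 \<le> ?h p" for p using assms by (auto simp: subprob_def)
  note s = subprob_pair_summable[of D "\<lambda>_. E", OF assms]
  have b: "unit_bounded (\<lambda>n::nat. 1)" by (simp add: unit_bounded_def)
  note pf = pushforward[of ?h "\<lambda>n. 1" "\<lambda>p. fst p + snd p", OF h s(1) b]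
  have eq: "fps_nth (D * E) = (\<lambda>n. infsum ?h {p. fst p + snd p = n})"
    by (rule ext) (rule fps_mult_pushforward)
  show ?thesis unfolding subprob_def eq using pf s(2) by simp
qed

lemma subprob_power: "subprob D \<Longrightarrow> subprob (D ^ n)"
  by (induction n) (simp_all add: subprob_1 subprob_mult)

section \<open>Draws and the backward transformer\<close>

definition drawop :: "nat \<Rightarrow> real fps \<Rightarrow> ((nat \<Rightarrow> nat) \<Rightarrow> real) \<Rightarrow> (nat \<Rightarrow> nat) \<Rightarrow> real" where
  "drawop x D f s = (\<Sum>\<^sub>\<infinity>j. fps_nth D j * f (s(x := s x + j)))"

lemma drawop_unit_bounded: assumes "subprob D" "unit_bounded f" shows "unit_bounded (drawop x D f)"
proof -
  have "\<bar>drawop x D f s\<bar> \<le> infsum (fps_nth D) UNIV" for s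
    unfolding drawop_def
    by (rule abs_infsum_le) (use assms in \<open>auto simp: subprob_def unit_bounded_def abs_mult intro: mult_left_le\<close>)
  then show ?thesis using assms(1) unfolding unit_bounded_def subprob_def by (meson order_trans)
qed

lemma drawop_1: "drawop x 1 f s = f s"
proof -
  have "((\<lambda>j. fps_nth 1 j * f (s(x := s x + j))) has_sum f s) UNIV"
    by (rule has_sum_finite_neutralI[of "{0}"]) auto
  then show ?thesis by (simp add: drawop_def infsumI)
qed

text \<open>A sum of independent samples has the product as its generating function, so drawing from
  \<open>D\<close> and then from \<open>E\<close> amounts to one draw from
  \<open>D * E\<close>.\<close>

lemma drawop_mult:
  assumes "subprob D" "subprob E" "unit_bounded f"
  shows "drawop x (D * E) f = drawop x D (drawop x E f)"
proof
  fix s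
  let ?h = "\<lambda>p. fps_nth D (fst p) * fps_nth E (snd p)"
  let ?f = "\<lambda>n. f (s(x := s x + n))"
  have h: "0 \<le> ?h p" for p using assms by (auto simp: subprob_def)
  note S = subprob_pair_summable[of D "\<lambda>_. E", OF assms(1,2)]
  have b: "unit_bounded ?f" using assms(3) by (simp add: unit_bounded_def)
  have "drawop x (D * E) f s = infsum (\<lambda>p. ?h p * ?f (fst p + snd p)) UNIV"
    unfolding drawop_def
    using pushforward(3)[of ?h ?f "\<lambda>p. fst p + snd p", OF h S(1) b, folded fps_mult_pushforward] .
  also have "\<dots> = infsum (\<lambda>i. infsum (\<lambda>j. ?h (i, j) * ?f (i + j)) UNIV) UNIV"
  proof -
    have "(\<lambda>p. ?h p * ?f (fst p + snd p)) summable_on UNIV \<times> UNIV"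
      using summable_on_mult_unit_bounded[OF S(1) h, of "\<lambda>p. ?f (fst p + snd p)"] b by (simp add: unit_bounded_def)
    from infsum_Sigma_banach[OF this] show ?thesis by simp
  qed
  also have "\<dots> = drawop x D (drawop x E f) s"
    unfolding drawop_def
    by (rule infsum_cong) (simp add: infsum_cmult_right' mult.assoc add.assoc flip: infsum_cmult_right')
  finally show "drawop x (D * E) f s = drawop x D (drawop x E f) s" .
qed

lemma drawop_funpow_unit_bounded: "subprob D \<Longrightarrow> unit_bounded f \<Longrightarrow> unit_bounded ((drawop x D ^^ n) f)"
  by (induction n) (simp_all add: drawop_unit_bounded)

lemma drawop_power:
  assumes "subprob D" "unit_bounded f"
  shows "drawop x (D ^ n) f = (drawop x D ^^ n) f"
proof (induction n)
  case 0
  show ?case by (simp add: drawop_1 fun_eq_iff)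
next
  case (Suc n)
  have "drawop x (D ^ Suc n) f = drawop x D (drawop x (D ^ n) f)"
    using drawop_mult[OF assms(1) subprob_power[OF assms(1), of n] assms(2)] by simp
  then show ?case by (simp add: Suc)
qed

text \<open>For loop-free \<open>P\<close> this is the expected value of \<open>f\<close> after
  running \<open>P\<close> from \<open>s\<close>. In a sampling statement the count
  \<open>s y\<close> is read before the first draw, which covers the case
  \<open>x = y\<close>.\<close>

primrec wp :: "prog \<Rightarrow> ((nat \<Rightarrow> nat) \<Rightarrow> real) \<Rightarrow> (nat \<Rightarrow> nat) \<Rightarrow> real" where
  "wp (Assign x n) f = (\<lambda>s. f (s(x := n)))"
| "wp (Decr x) f = (\<lambda>s. f (s(x := s x - 1)))"
| "wp (IncrIid x D y) f = (\<lambda>s. (drawop x (dist_fps D) ^^ s y) f s)"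
| "wp (IfLess x n P Q) f = (\<lambda>s. if s x < n then wp P f s else wp Q f s)"
| "wp (Seq P Q) f = wp P (wp Q f)"
| "wp (WhileLess x n P) f = f"

lemma wp_unit_bounded: "redip k P \<Longrightarrow> unit_bounded f \<Longrightarrow> unit_bounded (wp P f)"
proof (induction P arbitrary: f)
  case (IncrIid x D y)
  then have "unit_bounded ((drawop x (dist_fps D) ^^ n) f)" for n by (simp add: drawop_funpow_unit_bounded subprob_dist)
  then show ?case by (simp add: unit_bounded_def)
qed (auto simp: unit_bounded_def)

subsection \<open>Coefficients of the series operations\<close>

text \<open>A split is determined by its first part, which vanishes outside the finite support of
  \<open>\<sigma>\<close> and is bounded by \<open>\<sigma>\<close> on it.\<close>

lemma finite_splits: "finite {(\<alpha>, \<beta>). \<alpha> + \<beta> = (\<sigma> :: nat \<Rightarrow>\<^sub>0 nat)}"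
proof -
  let ?S = "{(\<alpha>, \<beta>). \<alpha> + \<beta> = \<sigma>}"
  let ?r = "\<lambda>p. (\<lambda>i. if i \<in> Poly_Mapping.keys \<sigma> then lookup (fst p) i else undefined)"
  have "?r ` ?S \<subseteq> PiE (Poly_Mapping.keys \<sigma>) (\<lambda>i. {..lookup \<sigma> i})"
    by (auto simp: PiE_def extensional_def lookup_add)
  moreover have "finite (PiE (Poly_Mapping.keys \<sigma>) (\<lambda>i. {..lookup \<sigma> i}))"
    by (intro finite_PiE) auto
  ultimately have "finite (?r ` ?S)" by (rule finite_subset)
  moreover have "inj_on ?r ?S"
  proof (rule inj_onI)
    fix p p' assume p: "p \<in> ?S" "p' \<in> ?S" and eq: "?r p = ?r p'"
    have "lookup (fst p) i = lookup (fst p') i" for i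
    proof (cases "i \<in> Poly_Mapping.keys \<sigma>")
      case True
      then show ?thesis using fun_cong[OF eq, of i] by simp
    next
      case False
      then have "lookup \<sigma> i = 0" by (simp add: in_keys_iff)
      moreover have "lookup (fst q) i + lookup (snd q) i = lookup \<sigma> i" if "q \<in> ?S" for q
        using that by (auto simp: lookup_add)
      ultimately show ?thesis using p by (metis add_is_0)
    qed
    then have "fst p = fst p'" by (rule poly_mapping_eqI)
    then show "p = p'" using p by (auto simp: prod_eq_iff)
  qed
  ultimately show ?thesis by (rule finite_imageD)
qed

lemma mmult_mvar_pow:
  "mmult A (mvar_pow x n) \<tau> = (if n \<le> lookup \<tau> x then A (\<tau> - single x n) else 0)"
proof -
  have eq: "\<tau> - single x n + single x n = \<tau>" if "n \<le> lookup \<tau> x"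
    by (rule poly_mapping_eqI) (use that in \<open>auto simp: lookup_add lookup_minus lookup_single when_def\<close>)
  have "mmult A (mvar_pow x n) \<tau> = (\<Sum>(\<alpha>, \<beta>) \<in> {(\<alpha>, \<beta>). \<alpha> + \<beta> = \<tau>} \<inter> {(\<alpha>, \<beta>). \<beta> = single x n}. A \<alpha>)"
    unfolding mmult_def mvar_pow_def
    by (rule sum.mono_neutral_cong_right[OF finite_splits]) (auto split: if_splits)
  also have "{(\<alpha>, \<beta>). \<alpha> + \<beta> = \<tau>} \<inter> {(\<alpha>, \<beta>). \<beta> = single x n} =
      (if n \<le> lookup \<tau> x then {(\<tau> - single x n, single x n)} else {})"
    using eq by (auto simp: lookup_add)
  finally show ?thesis by simp
qed

lemma mmult_mconst: "mmult A (mconst c) = (\<lambda>\<tau>. c * A \<tau>)"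
proof
  fix \<tau>
  have "mmult A (mconst c) \<tau> = c * mmult A (mvar_pow 0 0) \<tau>"
    unfolding mmult_def mvar_pow_def mconst_def sum_distrib_left by (rule sum.cong) auto
  then show "mmult A (mconst c) \<tau> = c * A \<tau>" by (simp add: mmult_mvar_pow)
qed

lemma mpower_mconst: "mpower (mconst c) i = mconst (c ^ i)"
  by (induction i) (simp_all add: mmult_mconst, simp_all add: mconst_def fun_eq_iff)

lemma msubst_0: "msubst x (mconst 0) g = mcoeff x g 0"
proof
  fix \<sigma>
  have "((\<lambda>i. (0::real) ^ i * mcoeff x g i \<sigma>) has_sum mcoeff x g 0 \<sigma>) UNIV"
    by (rule has_sum_finite_neutralI[of "{0}"]) auto
  then show "msubst x (mconst 0) g \<sigma> = mcoeff x g 0 \<sigma>"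
    by (simp add: msubst_def mpower_mconst mmult_mconst infsumI)
qed

lemma mderiv_funpow:
  "lookup \<sigma> x = 0 \<Longrightarrow> (mderiv x ^^ i) f \<sigma> = fact i * f (\<sigma> + single x i)"
proof -
  \<comment> \<open>For general \<open>\<sigma>\<close> the factor is a quotient of factorials;
    multiplied out, the claim passes through the induction, which moves to
    \<open>\<sigma> + single x 1\<close>.\<close>
  have "(mderiv x ^^ i) f \<sigma> * fact (lookup \<sigma> x) = fact (lookup \<sigma> x + i) * f (\<sigma> + single x i)" for \<sigma>
  proof (induction i arbitrary: \<sigma>)
    case (Suc i)
    have "single x (Suc i) = single x (Suc 0) + single x i" using single_add[of x 1 i] by simp
    then show ?case using Suc[of "\<sigma> + single x 1"]
      by (simp add: mderiv_def lookup_add algebra_simps)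
  qed simp
  from this[of \<sigma>] show "lookup \<sigma> x = 0 \<Longrightarrow> ?thesis" by simp
qed

lemma mbelow_eq: "mbelow x n f = (\<lambda>\<sigma>. if lookup \<sigma> x < n then f \<sigma> else 0)"
proof
  fix \<sigma>
  have "1 / fact i * mmult (msubst x (mconst 0) ((mderiv x ^^ i) f)) (mvar_pow x i) \<sigma> =
      (if i = lookup \<sigma> x then f \<sigma> else 0)" for i
  proof -
    have 1: "lookup (\<sigma> - single x i) x = lookup \<sigma> x - i" for i by (simp add: lookup_minus)
    have 2: "\<sigma> - single x i + single x i = \<sigma>" if "i \<le> lookup \<sigma> x" for i
      by (rule poly_mapping_eqI) (use that in \<open>auto simp: lookup_add lookup_minus lookup_single when_def\<close>)
    show ?thesis
      by (auto simp: msubst_0 mmult_mvar_pow mcoeff_def 1 2 mderiv_funpow)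
  qed
  then show "mbelow x n f \<sigma> = (if lookup \<sigma> x < n then f \<sigma> else 0)"
    by (simp add: mbelow_def)
qed

text \<open>Substituting 1 sums over all old values of \<open>x\<close>, and multiplying by the
  power of \<open>X\<close> installs the new one. As a sum over a fibre of the state update this
  fits \<open>pushforward\<close>.\<close>

lemma sem_Assign:
  "sem k (Assign x n) g = (\<lambda>\<tau>. infsum g {\<sigma>. Poly_Mapping.update x n \<sigma> = \<tau>})"
proof
  fix \<tau>
  show "sem k (Assign x n) g \<tau> = infsum g {\<sigma>. Poly_Mapping.update x n \<sigma> = \<tau>}"
  proof (cases "lookup \<tau> x = n")
    case True
    have 1: "\<tau> - single x n + single x i = Poly_Mapping.update x i \<tau>" for i
      by (rule poly_mapping_eqI) (use True in \<open>auto simp: lookup_add lookup_minus lookup_single lookup_update when_def\<close>)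
    have eq: "sem k (Assign x n) g \<tau> = (\<Sum>\<^sub>\<infinity>i. g (Poly_Mapping.update x i \<tau>))"
      using True by (simp add: mmult_mvar_pow msubst_def mpower_mconst mmult_mconst mcoeff_def 1 lookup_minus)
    have bij: "bij_betw (\<lambda>i. Poly_Mapping.update x i \<tau>) UNIV {\<sigma>. Poly_Mapping.update x n \<sigma> = \<tau>}"
    proof (rule bij_betw_byWitness[where f' = "\<lambda>\<sigma>. lookup \<sigma> x"])
      show "\<forall>\<sigma>\<in>{\<sigma>. Poly_Mapping.update x n \<sigma> = \<tau>}. Poly_Mapping.update x (lookup \<sigma> x) \<tau> = \<sigma>"
        by (auto intro!: poly_mapping_eqI simp: lookup_update)
      show "(\<lambda>i. Poly_Mapping.update x i \<tau>) ` UNIV \<subseteq> {\<sigma>. Poly_Mapping.update x n \<sigma> = \<tau>}"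
        using True by (auto intro!: poly_mapping_eqI simp: lookup_update)
    qed (auto simp: lookup_update)
    show ?thesis unfolding eq by (rule infsum_reindex_bij_betw[OF bij])
  next
    case False
    then have "{\<sigma>. Poly_Mapping.update x n \<sigma> = \<tau>} = {}" by (auto simp: lookup_update)
    moreover have "sem k (Assign x n) g \<tau> = 0"
      using False by (auto simp: mmult_mvar_pow msubst_def mpower_mconst mmult_mconst mcoeff_def lookup_minus)
    ultimately show ?thesis by simp
  qed
qed

text \<open>The fibre over \<open>\<tau>\<close> contains \<open>\<tau> + single x 1\<close>, and
  also \<open>\<tau>\<close> itself when \<open>x\<close> is 0 there, since decrementing stops at 0.
  The two summands of the semantics are these two points.\<close>

lemma sem_Decr:
  "sem k (Decr x) g = (\<lambda>\<tau>. infsum g {\<sigma>. Poly_Mapping.update x (lookup \<sigma> x - 1) \<sigma> = \<tau>})"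
proof
  fix \<tau>
  have "{\<sigma>. Poly_Mapping.update x (lookup \<sigma> x - 1) \<sigma> = \<tau>} =
      insert (\<tau> + single x 1) (if lookup \<tau> x = 0 then {\<tau>} else {})" (is "?L = ?R")
  proof (rule Set.set_eqI, rule iffI)
    fix \<sigma> assume "\<sigma> \<in> ?L"
    then have \<tau>: "\<tau> = Poly_Mapping.update x (lookup \<sigma> x - 1) \<sigma>" by simp
    show "\<sigma> \<in> ?R"
    proof (cases "lookup \<sigma> x = 0")
      case True
      then have "\<tau> = \<sigma>" unfolding \<tau> by (intro poly_mapping_eqI) (auto simp: lookup_update)
      then show ?thesis using True by simp
    next
      case False
      then have "\<sigma> = \<tau> + single x 1" unfolding \<tau>
        by (intro poly_mapping_eqI) (auto simp: lookup_update lookup_add lookup_single when_def)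
      then show ?thesis by simp
    qed
  next
    fix \<sigma> assume "\<sigma> \<in> ?R"
    then consider "\<sigma> = \<tau> + single x 1" | "lookup \<tau> x = 0" "\<sigma> = \<tau>" by (auto split: if_splits)
    then show "\<sigma> \<in> ?L"
      by cases (auto intro!: poly_mapping_eqI simp: lookup_update lookup_add lookup_single when_def)
  qed
  moreover have "\<tau> + single x 1 \<noteq> \<tau>" by (metis add_cancel_left_right one_neq_zero single_zero lookup_single_eq lookup_zero)
  ultimately show "sem k (Decr x) g \<tau> = infsum g {\<sigma>. Poly_Mapping.update x (lookup \<sigma> x - 1) \<sigma> = \<tau>}"
    by (auto simp: msubst_0 madd_def mdiff_def mdiv_var_def mcoeff_def lookup_add)
qed

subsection \<open>Duality between the semantics and the backward transformer\<close>

definition hpow :: "nat \<Rightarrow> nat \<Rightarrow> real fps \<Rightarrow> nat \<Rightarrow> mfps" where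
  "hpow y x D i = mpower (mmult (mvar_pow y 1) (mfps_of_fps x D)) i"

lemma single_eq_iff [simp]: "single x a = single x b \<longleftrightarrow> a = b"
  by (metis lookup_single_eq)

lemma E_inj: "single y i + single x j = single y i + single x j' \<longleftrightarrow> j = j'"
  by (metis add_left_cancel lookup_single_eq)

text \<open>A series in the monomials \<open>Y^a X^j\<close> with fixed \<open>a\<close> multiplies
  like a univariate series in \<open>j\<close>. The parametrisation
  \<open>single y a + single x j\<close> is injective in \<open>j\<close> even for
  \<open>x = y\<close>, so that case is included.\<close>

lemma mmult_spread:
  assumes A: "\<And>j. A (single y a + single x j) = d j" "\<And>\<alpha>. (\<nexists>j. \<alpha> = single y a + single x j) \<Longrightarrow> A \<alpha> = 0"
    and B: "\<And>j. B (single y b + single x j) = e j" "\<And>\<alpha>. (\<nexists>j. \<alpha> = single y b + single x j) \<Longrightarrow> B \<alpha> = 0"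
  shows "mmult A B (single y (a + b) + single x j) = (\<Sum>i=0..j. d i * e (j - i))"
    and "(\<nexists>j. \<alpha> = single y (a + b) + single x j) \<Longrightarrow> mmult A B \<alpha> = 0"
proof -
  have E: "single y a + single x i + (single y b + single x i') = single y (a + b) + single x (i + i')" for i i'
    by (simp add: single_add algebra_simps)
  let ?\<tau> = "single y (a + b) + single x j"
  let ?e = "\<lambda>i. (single y a + single x i, single y b + single x (j - i))"
  have "(\<Sum>i=0..j. d i * e (j - i)) = (\<Sum>(\<alpha>, \<beta>)\<in>?e ` {0..j}. A \<alpha> * B \<beta>)"
    by (subst sum.reindex) (auto simp: inj_on_def E_inj A B)
  also have "\<dots> = mmult A B ?\<tau>"
    unfolding mmult_def
  proof (rule sum.mono_neutral_left[OF finite_splits], goal_cases)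
    case 1
    show ?case using E by auto
  next
    case 2
    show ?case
    proof (rule ballI, rule ccontr)
      fix p assume p: "p \<in> {(\<alpha>, \<beta>). \<alpha> + \<beta> = ?\<tau>} - ?e ` {0..j}"
        and nz: "(case p of (\<alpha>, \<beta>) \<Rightarrow> A \<alpha> * B \<beta>) \<noteq> 0"
      obtain \<alpha> \<beta> where pp: "p = (\<alpha>, \<beta>)" by fastforce
      from nz pp obtain i i' where i: "\<alpha> = single y a + single x i" "\<beta> = single y b + single x i'"
        using A(2)[of \<alpha>] B(2)[of \<beta>] by auto
      from p pp i have "i + i' = j" using E E_inj by auto
      with p pp i show False by (auto simp: image_iff)
    qed
  qed
  finally show "mmult A B ?\<tau> = (\<Sum>i=0..j. d i * e (j - i))" by simp
  show "mmult A B \<alpha> = 0" if n: "\<nexists>j. \<alpha> = single y (a + b) + single x j"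
    unfolding mmult_def
  proof (rule sum.neutral, rule ballI, rule ccontr)
    fix p assume p: "p \<in> {(\<beta>, \<gamma>). \<beta> + \<gamma> = \<alpha>}" and nz: "(case p of (\<alpha>, \<beta>) \<Rightarrow> A \<alpha> * B \<beta>) \<noteq> 0"
    obtain \<beta> \<gamma> where pp: "p = (\<beta>, \<gamma>)" by fastforce
    from nz pp obtain i i' where "\<beta> = single y a + single x i" "\<gamma> = single y b + single x i'"
      using A(2)[of \<beta>] B(2)[of \<gamma>] by auto
    with p pp n E[of i i'] show False by auto
  qed
qed

lemma hpow_coeffs:
  "hpow y x D i (single y i + single x j) = fps_nth (D ^ i) j"
  "(\<nexists>j. \<alpha> = single y i + single x j) \<Longrightarrow> hpow y x D i \<alpha> = 0"
proof -
  let ?T = "mfps_of_fps x D"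
  have T0: "?T (single y 0 + single x j) = fps_nth D j" for j
    by (auto simp: mfps_of_fps_def)
  have T1: "?T \<alpha> = 0" if "\<nexists>j. \<alpha> = single y 0 + single x j" for \<alpha>
  proof -
    have "\<not> Poly_Mapping.keys \<alpha> \<subseteq> {x}"
    proof
      assume "Poly_Mapping.keys \<alpha> \<subseteq> {x}"
      then have "\<alpha> = single x (lookup \<alpha> x)"
        by (intro poly_mapping_eqI) (auto simp: lookup_single when_def in_keys_iff subset_iff)
      then show False using that by (metis add_0 single_zero)
    qed
    then show ?thesis by (simp add: mfps_of_fps_def)
  qed
  have V0: "mvar_pow y 1 (single y 1 + single x j) = fps_nth 1 j" for j
    using E_inj[of y 1 x j 0] by (auto simp: mvar_pow_def)
  have V1: "mvar_pow y 1 \<alpha> = 0" if "\<nexists>j. \<alpha> = single y 1 + single x j" for \<alpha>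
    using that by (auto simp: mvar_pow_def) (metis add.right_neutral single_zero)
  have H0: "mmult (mvar_pow y 1) ?T (single y 1 + single x j) = fps_nth D j" for j
    using mmult_spread(1)[where A = "mvar_pow y 1" and y = y and a = 1 and x = x and d = "fps_nth 1" and B = "?T" and b = 0 and e = "fps_nth D", OF V0 V1 T0 T1, of j] fps_mult_nth[of 1 D j] by simp
  have H1: "mmult (mvar_pow y 1) ?T \<alpha> = 0" if "\<nexists>j. \<alpha> = single y 1 + single x j" for \<alpha>
    using mmult_spread(2)[where A = "mvar_pow y 1" and y = y and a = 1 and x = x and d = "fps_nth 1" and B = "?T" and b = 0 and e = "fps_nth D", OF V0 V1 T0 T1, of \<alpha>] that by simp
  have "(\<forall>j. hpow y x D i (single y i + single x j) = fps_nth (D ^ i) j) \<and>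
      (\<forall>\<alpha>. (\<nexists>j. \<alpha> = single y i + single x j) \<longrightarrow> hpow y x D i \<alpha> = 0)"
  proof (induction i)
    case 0
    have "hpow y x D 0 (single y 0 + single x j) = fps_nth 1 j" for j
      by (simp add: hpow_def mconst_def) (metis lookup_single_eq lookup_zero single_zero)
    moreover have "hpow y x D 0 \<alpha> = 0" if "\<nexists>j. \<alpha> = single y 0 + single x j" for \<alpha>
      using that by (auto simp: hpow_def mconst_def) (metis single_zero)
    ultimately show ?case by auto
  next
    case (Suc i)
    then have I: "\<And>j. hpow y x D i (single y i + single x j) = fps_nth (D ^ i) j"
      "\<And>\<alpha>. (\<nexists>j. \<alpha> = single y i + single x j) \<Longrightarrow> hpow y x D i \<alpha> = 0" by auto
    have S: "hpow y x D (Suc i) = mmult (mmult (mvar_pow y 1) ?T) (hpow y x D i)"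
      by (simp add: hpow_def)
    show ?case
      using mmult_spread[where A = "mmult (mvar_pow y 1) ?T" and y = y and a = 1 and x = x and d = "fps_nth D" and B = "hpow y x D i" and b = i and e = "fps_nth (D ^ i)", OF H0 H1 I] unfolding S by (auto simp: fps_mult_nth)
  qed
  then show "hpow y x D i (single y i + single x j) = fps_nth (D ^ i) j"
    "(\<nexists>j. \<alpha> = single y i + single x j) \<Longrightarrow> hpow y x D i \<alpha> = 0" by auto
qed

lemma sem_IncrIid:
  "sem k (IncrIid x D y) g = (\<lambda>\<tau>. infsum
     (\<lambda>p. g (fst p) * fps_nth (dist_fps D ^ lookup (fst p) y) (snd p)) {p. fst p + single x (snd p) = \<tau>})"
proof
  fix \<tau>
  let ?d = "dist_fps D"
  let ?S = "{p. fst p + single x (snd p) = \<tau>}"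
  let ?F = "\<lambda>p. g (fst p) * fps_nth (?d ^ lookup (fst p) y) (snd p)"
  \<comment> \<open>Only finitely many pairs of a state and an outcome lead to
    \<open>\<tau>\<close>, so the infinite sum of the substitution has finitely many nonzero terms;
    its term \<open>i\<close> collects the pairs whose state has the value \<open>i\<close> at
    \<open>y\<close>.\<close>
  have finS: "finite ?S"
  proof (rule finite_surj)
    show "finite ({(\<alpha>, \<beta>). \<alpha> + \<beta> = \<tau>})" by (rule finite_splits)
    show "?S \<subseteq> (\<lambda>(\<alpha>, \<beta>). (\<alpha>, lookup \<beta> x)) ` {(\<alpha>, \<beta>). \<alpha> + \<beta> = \<tau>}"
      by (force simp: image_iff)
  qed
  have T: "mmult (mcoeff y g i) (hpow y x ?d i) \<tau> = (\<Sum>p\<in>{p\<in>?S. lookup (fst p) y = i}. ?F p)" for i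
  proof -
    let ?P = "{p\<in>?S. lookup (fst p) y = i}"
    let ?e = "\<lambda>p. (fst p - single y i, single y i + single x (snd p))"
    have sub: "fst p - single y i + single y i = fst p" if "lookup (fst p) y = i" for p :: "(nat \<Rightarrow>\<^sub>0 nat) \<times> nat"
      by (rule poly_mapping_eqI) (use that in \<open>auto simp: lookup_add lookup_minus lookup_single when_def\<close>)
    have inj: "inj_on ?e ?P"
    proof (rule inj_onI)
      fix p q assume pq: "p \<in> ?P" "q \<in> ?P" and "?e p = ?e q"
      then have "fst p - single y i + single y i = fst q - single y i + single y i" "snd p = snd q"
        by simp_all
      moreover have "lookup (fst p) y = i" "lookup (fst q) y = i" using pq by simp_all
      ultimately show "p = q" using sub[of p] sub[of q] by (metis prod_eqI)
    qed
    have "(\<Sum>p\<in>?P. ?F p) = (\<Sum>(\<alpha>, \<beta>)\<in>?e ` ?P. mcoeff y g i \<alpha> * hpow y x ?d i \<beta>)"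
      unfolding sum.reindex[OF inj]
      by (rule sum.cong) (auto simp: mcoeff_def lookup_minus hpow_coeffs sub)
    also have "\<dots> = mmult (mcoeff y g i) (hpow y x ?d i) \<tau>"
      unfolding mmult_def
    proof (rule sum.mono_neutral_left[OF finite_splits], goal_cases)
      case 1
      show ?case
      proof
        fix q assume "q \<in> ?e ` ?P"
        then obtain p where p: "p \<in> ?P" "q = ?e p" by blast
        have "fst q + snd q = fst p - single y i + single y i + single x (snd p)"
          using p(2) by (simp add: add.assoc)
        also have "\<dots> = \<tau>" using sub[of p] p(1) by simp
        finally show "q \<in> {(\<alpha>, \<beta>). \<alpha> + \<beta> = \<tau>}" by (simp add: case_prod_unfold)
      qed
    next
      case 2
      show ?case
      proof (rule ballI, rule ccontr)
        fix q assume q: "q \<in> {(\<alpha>, \<beta>). \<alpha> + \<beta> = \<tau>} - ?e ` ?P"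
          and nz: "(case q of (\<alpha>, \<beta>) \<Rightarrow> mcoeff y g i \<alpha> * hpow y x ?d i \<beta>) \<noteq> 0"
        obtain \<alpha> \<beta> where qq: "q = (\<alpha>, \<beta>)" by fastforce
        from nz qq obtain j where j: "\<beta> = single y i + single x j"
          using hpow_coeffs(2)[of \<beta> y i x ?d] by auto
        have \<alpha>: "lookup \<alpha> y = 0" using nz qq by (auto simp: mcoeff_def split: if_splits)
        have "(\<alpha> + single y i, j) \<in> ?P"
          using q qq j \<alpha> by (auto simp: lookup_add add.assoc)
        moreover have "q = ?e (\<alpha> + single y i, j)" using qq j by simp
        ultimately show False using q by blast
      qed
    qed
    finally show ?thesis by simp
  qed
  let ?I = "(\<lambda>p. lookup (fst p) y) ` ?S"
  have "((\<lambda>i. mmult (mcoeff y g i) (hpow y x ?d i) \<tau>) has_sum (\<Sum>p\<in>?S. ?F p)) UNIV"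
  proof (rule has_sum_finite_neutralI)
    show "finite ?I" using finS by simp
    show "(\<Sum>p\<in>?S. ?F p) = (\<Sum>i\<in>?I. mmult (mcoeff y g i) (hpow y x ?d i) \<tau>)"
      unfolding T by (rule sum.image_gen[OF finS])
    show "mmult (mcoeff y g i) (hpow y x ?d i) \<tau> = 0" if "i \<in> UNIV - ?I" for i
    proof -
      have "{p \<in> ?S. lookup (fst p) y = i} = {}" using that by blast
      then show ?thesis unfolding T by (simp only: sum.empty)
    qed
  qed simp
  then show "sem k (IncrIid x D y) g \<tau> = infsum ?F ?S"
    using finS by (simp add: msubst_def infsumI hpow_def)
qed

text \<open>Pairing with bounded functions makes \<open>W\<close>, acting on observations, the
  adjoint of \<open>S\<close>, acting on series. Preservation of PGFs is bundled in so that duality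
  composes.\<close>

definition dual :: "nat \<Rightarrow> (mfps \<Rightarrow> mfps) \<Rightarrow> (((nat \<Rightarrow> nat) \<Rightarrow> real) \<Rightarrow> (nat \<Rightarrow> nat) \<Rightarrow> real) \<Rightarrow> bool" where
  "dual k S W \<longleftrightarrow> (\<forall>g\<in>pgfs k. S g \<in> pgfs k \<and>
     (\<forall>f. unit_bounded f \<longrightarrow> (\<Sum>\<^sub>\<infinity>\<tau>. S g \<tau> * f (lookup \<tau>)) = (\<Sum>\<^sub>\<infinity>\<sigma>. g \<sigma> * W f (lookup \<sigma>))))"

lemma pgfs_mult_summable:
  assumes "g \<in> pgfs k" "unit_bounded f"
  shows "(\<lambda>\<sigma>. g \<sigma> * f (lookup \<sigma>)) summable_on UNIV"
  by (rule summable_on_mult_unit_bounded) (use assms in \<open>auto simp: pgfs_def unit_bounded_def\<close>)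

lemma unit_bounded_1: "unit_bounded (\<lambda>s. 1)" by (simp add: unit_bounded_def)

lemma pgfs_integral_le:
  assumes "g \<in> pgfs k" "unit_bounded f"
  shows "(\<Sum>\<^sub>\<infinity>\<sigma>. g \<sigma> * f (lookup \<sigma>)) \<le> mass g"
proof -
  have "f s \<le> 1" for s using assms(2) by (auto simp: unit_bounded_def dest: abs_le_D1)
  then show ?thesis
    unfolding mass_def
    by (intro infsum_mono pgfs_mult_summable[OF assms])
      (use assms(1) in \<open>auto simp: pgfs_def intro: mult_left_le\<close>)
qed

text \<open>\<open>c \<sigma> j\<close> is the probability that state \<open>\<sigma>\<close> moves
  to \<open>\<phi> (\<sigma>, j)\<close>; \<open>c'\<close> packs these weights into a series, so
  that \<open>subprob\<close> can speak about them. That the result has mass at most 1 is duality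
  applied to the constant 1.\<close>

lemma dual_pushforward:
  assumes S: "\<And>g. S g = (\<lambda>\<tau>. infsum (\<lambda>p. g (fst p) * c (fst p) (snd p)) {p. \<phi> p = \<tau>})"
    and c: "\<And>\<sigma>. subprob (c' \<sigma>)" "\<And>\<sigma>. c \<sigma> = fps_nth (c' \<sigma>)"
    and W: "\<And>f \<sigma>. unit_bounded f \<Longrightarrow> W f (lookup \<sigma>) = (\<Sum>\<^sub>\<infinity>j. c \<sigma> j * f (lookup (\<phi> (\<sigma>, j))))"
    and Wb: "\<And>f. unit_bounded f \<Longrightarrow> unit_bounded (W f)"
    and \<phi>: "\<And>\<sigma> j. Poly_Mapping.keys \<sigma> \<subseteq> {..<k} \<Longrightarrow> Poly_Mapping.keys (\<phi> (\<sigma>, j)) \<subseteq> {..<k}"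
  shows "dual k S W"
  unfolding dual_def
proof (rule ballI, rule conjI)
  fix g assume g: "g \<in> pgfs k"
  let ?F = "\<lambda>p. g (fst p) * c (fst p) (snd p)"
  have F0: "0 \<le> ?F p" for p using g c by (auto simp: pgfs_def subprob_def)
  have c1: "c \<sigma> summable_on UNIV" "0 \<le> infsum (c \<sigma>) UNIV" "infsum (c \<sigma>) UNIV \<le> 1" for \<sigma>
    using c[of \<sigma>] by (auto simp: subprob_def infsum_nonneg)
  have 1: "((\<lambda>j. ?F (\<sigma>, j)) has_sum (g \<sigma> * infsum (c \<sigma>) UNIV)) UNIV" for \<sigma>
    using c1 by (auto intro!: has_sum_cmult_right)
  have m: "(\<lambda>\<sigma>. g \<sigma> * infsum (c \<sigma>) UNIV) summable_on UNIV"
    by (rule summable_on_mult_unit_bounded) (use g c1 in \<open>auto simp: pgfs_def unit_bounded_def\<close>)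
  have F: "?F summable_on UNIV \<times> UNIV"
    by (rule summable_on_SigmaI[OF 1 m]) (use F0 in auto)
  have F': "?F summable_on UNIV" using F by simp
  have dual: "(\<Sum>\<^sub>\<infinity>\<tau>. S g \<tau> * f (lookup \<tau>)) = (\<Sum>\<^sub>\<infinity>\<sigma>. g \<sigma> * W f (lookup \<sigma>))" if f: "unit_bounded f" for f
  proof -
    have b: "unit_bounded (\<lambda>\<tau>. f (lookup \<tau>))" using f by (simp add: unit_bounded_def)
    have "(\<Sum>\<^sub>\<infinity>\<tau>. S g \<tau> * f (lookup \<tau>)) = (\<Sum>\<^sub>\<infinity>p. ?F p * f (lookup (\<phi> p)))"
      unfolding S by (rule pushforward(3)[OF F0 F' b])
    also have "\<dots> = (\<Sum>\<^sub>\<infinity>\<sigma>. \<Sum>\<^sub>\<infinity>j. ?F (\<sigma>, j) * f (lookup (\<phi> (\<sigma>, j))))"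
    proof -
      have "(\<lambda>p. ?F p * f (lookup (\<phi> p))) summable_on UNIV \<times> UNIV"
        using summable_on_mult_unit_bounded[OF F F0, of "\<lambda>p. f (lookup (\<phi> p))"] f by (simp add: unit_bounded_def)
      from infsum_Sigma_banach[OF this] show ?thesis by simp
    qed
    also have "\<dots> = (\<Sum>\<^sub>\<infinity>\<sigma>. g \<sigma> * W f (lookup \<sigma>))"
      by (simp add: W[OF f] mult.assoc flip: infsum_cmult_right')
    finally show ?thesis .
  qed
  have keys: "Poly_Mapping.keys \<tau> \<subseteq> {..<k}" if nz: "S g \<tau> \<noteq> 0" for \<tau>
  proof -
    have "\<exists>p. \<phi> p = \<tau> \<and> ?F p \<noteq> 0"
    proof (rule ccontr)
      assume "\<nexists>p. \<phi> p = \<tau> \<and> ?F p \<noteq> 0"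
      then have "infsum ?F {p. \<phi> p = \<tau>} = 0" by (intro infsum_0) auto
      then show False using nz by (simp add: S)
    qed
    then obtain p where p: "\<phi> p = \<tau>" "g (fst p) \<noteq> 0" by auto
    then have "Poly_Mapping.keys (fst p) \<subseteq> {..<k}" using g by (auto simp: pgfs_def)
    from \<phi>[OF this, of "snd p"] p(1) show ?thesis by simp
  qed
  have Sg: "0 \<le> S g \<tau>" "S g summable_on UNIV" for \<tau>
    unfolding S using pushforward(1,2)[OF F0 F', of "\<lambda>_. 0" \<phi>] by (auto simp: unit_bounded_def)
  have "mass (S g) = (\<Sum>\<^sub>\<infinity>\<sigma>. g \<sigma> * W (\<lambda>s. 1) (lookup \<sigma>))"
    using dual[OF unit_bounded_1] by (simp add: mass_def)
  also have "\<dots> \<le> mass g" by (rule pgfs_integral_le[OF g Wb[OF unit_bounded_1]])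
  finally have "mass (S g) \<le> 1" using g by (simp add: pgfs_def)
  then show "S g \<in> pgfs k" using Sg keys by (simp add: pgfs_def)
  show "\<forall>f. unit_bounded f \<longrightarrow> (\<Sum>\<^sub>\<infinity>\<tau>. S g \<tau> * f (lookup \<tau>)) = (\<Sum>\<^sub>\<infinity>\<sigma>. g \<sigma> * W f (lookup \<sigma>))"
    using dual by blast
qed

lemma infsum_fps_one: "(\<Sum>\<^sub>\<infinity>j. fps_nth (1::real fps) j * h j) = h 0"
proof -
  have "((\<lambda>j. fps_nth (1::real fps) j * h j) has_sum h 0) UNIV"
    by (rule has_sum_finite_neutralI[of "{0}"]) auto
  then show ?thesis by (rule infsumI)
qed

text \<open>A deterministic step is the kernel whose outcome distribution is the series 1, with all
  mass at \<open>j = 0\<close>.\<close>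

lemma dual_deterministic:
  assumes S: "\<And>g. S g = (\<lambda>\<tau>. infsum g {\<sigma>. \<phi> \<sigma> = \<tau>})"
    and W: "\<And>f \<sigma>. W f (lookup \<sigma>) = f (lookup (\<phi> \<sigma>))"
    and Wb: "\<And>f. unit_bounded f \<Longrightarrow> unit_bounded (W f)"
    and \<phi>: "\<And>\<sigma>. Poly_Mapping.keys \<sigma> \<subseteq> {..<k} \<Longrightarrow> Poly_Mapping.keys (\<phi> \<sigma>) \<subseteq> {..<k}"
  shows "dual k S W"
proof (rule dual_pushforward[where c = "\<lambda>_. fps_nth 1" and c' = "\<lambda>_. 1" and \<phi> = "\<lambda>p. \<phi> (fst p)"])
  fix g
  show "S g = (\<lambda>\<tau>. \<Sum>\<^sub>\<infinity>p | \<phi> (fst p) = \<tau>. g (fst p) * fps_nth 1 (snd p))"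
  proof
    fix \<tau>
    have "(\<Sum>\<^sub>\<infinity>p | \<phi> (fst p) = \<tau>. g (fst p) * fps_nth 1 (snd p)) = infsum (\<lambda>p. g (fst p)) ((\<lambda>\<sigma>. (\<sigma>, 0::nat)) ` {\<sigma>. \<phi> \<sigma> = \<tau>})"
    proof (rule infsum_cong_neutral, goal_cases)
      case (1 p)
      then show ?case by force
    next
      case (2 p)
      then have "snd p \<noteq> 0" by (metis (mono_tags, lifting) DiffD1 DiffD2 image_eqI mem_Collect_eq prod.collapse)
      then show ?case by simp
    next
      case (3 p)
      then have "snd p = 0" by (elim IntE imageE) simp
      then show ?case by simp
    qed
    also have "\<dots> = infsum g {\<sigma>. \<phi> \<sigma> = \<tau>}"
      by (subst infsum_reindex) (auto simp: inj_on_def o_def)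
    finally show "S g \<tau> = (\<Sum>\<^sub>\<infinity>p | \<phi> (fst p) = \<tau>. g (fst p) * fps_nth 1 (snd p))"
      by (simp add: S)
  qed
  show "W f (lookup \<sigma>) = (\<Sum>\<^sub>\<infinity>j. fps_nth 1 j * f (lookup (\<phi> (fst (\<sigma>, j)))))" for f \<sigma>
    by (subst infsum_fps_one) (simp add: W)
qed (use Wb \<phi> in \<open>auto simp: subprob_1\<close>)

lemma mbelow_pgfs:
  assumes "g \<in> pgfs k"
  shows "mbelow x n g \<in> pgfs k" "mdiff g (mbelow x n g) \<in> pgfs k"
proof -
  have g: "g summable_on UNIV" "\<And>\<sigma>. 0 \<le> g \<sigma>" "mass g \<le> 1" using assms by (auto simp: pgfs_def)
  have *: "h \<in> pgfs k" if h: "\<And>\<sigma>. h \<sigma> = 0 \<or> h \<sigma> = g \<sigma>" for h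
  proof -
    have hg: "0 \<le> h \<sigma>" "h \<sigma> \<le> g \<sigma>" for \<sigma> using h[of \<sigma>] g(2)[of \<sigma>] by auto
    have hs: "h summable_on UNIV" by (rule summable_on_comparison_test[OF g(1)]) (use hg in auto)
    have "mass h \<le> mass g" unfolding mass_def by (rule infsum_mono[OF hs g(1)]) (use hg in auto)
    moreover have "Poly_Mapping.keys \<sigma> \<subseteq> {..<k}" if "h \<sigma> \<noteq> 0" for \<sigma>
      using that h[of \<sigma>] assms by (auto simp: pgfs_def)
    ultimately show ?thesis using hg hs g(3) by (auto simp: pgfs_def)
  qed
  show "mbelow x n g \<in> pgfs k" "mdiff g (mbelow x n g) \<in> pgfs k"
    by (rule *; simp add: mbelow_eq mdiff_def)+
qed

lemma pgfs_splits:
  assumes g: "g \<in> pgfs k" and f: "unit_bounded f"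
  shows "(\<Sum>\<^sub>\<infinity>\<sigma>. g \<sigma> * f (lookup \<sigma>)) = (\<Sum>\<^sub>\<infinity>\<sigma>. mbelow x n g \<sigma> * f (lookup \<sigma>))
     + (\<Sum>\<^sub>\<infinity>\<sigma>. mdiff g (mbelow x n g) \<sigma> * f (lookup \<sigma>))"
proof -
  have "(\<Sum>\<^sub>\<infinity>\<sigma>. mbelow x n g \<sigma> * f (lookup \<sigma>)) + (\<Sum>\<^sub>\<infinity>\<sigma>. mdiff g (mbelow x n g) \<sigma> * f (lookup \<sigma>))
    = (\<Sum>\<^sub>\<infinity>\<sigma>. mbelow x n g \<sigma> * f (lookup \<sigma>) + mdiff g (mbelow x n g) \<sigma> * f (lookup \<sigma>))"
    by (rule infsum_add[symmetric]; rule pgfs_mult_summable[OF mbelow_pgfs(1)[OF g] f]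
        pgfs_mult_summable[OF mbelow_pgfs(2)[OF g] f])
  also have "\<dots> = (\<Sum>\<^sub>\<infinity>\<sigma>. g \<sigma> * f (lookup \<sigma>))"
    by (rule infsum_cong) (simp add: mdiff_def algebra_simps)
  finally show ?thesis by simp
qed

lemma mass_splits:
  assumes g: "g \<in> pgfs k"
  shows "mass g = mass (mbelow x n g) + mass (mdiff g (mbelow x n g))"
  using pgfs_splits[OF g unit_bounded_1, of x n] by (simp add: mass_def)

lemma sem_dual: "loop_free P \<Longrightarrow> redip k P \<Longrightarrow> dual k (sem k P) (wp P)"
proof (induction P)
  case (Assign x n)
  show ?case
  proof (rule dual_deterministic[where \<phi> = "Poly_Mapping.update x n"])
    show "sem k (Assign x n) g = (\<lambda>\<tau>. infsum g {\<sigma>. Poly_Mapping.update x n \<sigma> = \<tau>})" for g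
      by (rule sem_Assign)
    show "Poly_Mapping.keys (Poly_Mapping.update x n \<sigma>) \<subseteq> {..<k}" if "Poly_Mapping.keys \<sigma> \<subseteq> {..<k}" for \<sigma>
      using that Assign by (auto simp: keys_update split: if_splits)
    have "lookup (Poly_Mapping.update x n \<sigma>) = (lookup \<sigma>)(x := n)" for \<sigma>
      by (auto simp: lookup_update fun_eq_iff)
    then show "wp (Assign x n) f (lookup \<sigma>) = f (lookup (Poly_Mapping.update x n \<sigma>))" for f \<sigma> by simp
  qed (rule wp_unit_bounded[OF Assign(2)])
next
  case (Decr x)
  let ?\<phi> = "\<lambda>\<sigma>. Poly_Mapping.update x (lookup \<sigma> x - 1) \<sigma>"
  show ?case
  proof (rule dual_deterministic[where \<phi> = ?\<phi>])
    show "sem k (Decr x) g = (\<lambda>\<tau>. infsum g {\<sigma>. ?\<phi> \<sigma> = \<tau>})" for g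
      by (rule sem_Decr)
    show "Poly_Mapping.keys (?\<phi> \<sigma>) \<subseteq> {..<k}" if "Poly_Mapping.keys \<sigma> \<subseteq> {..<k}" for \<sigma>
      using that Decr by (auto simp: keys_update split: if_splits)
    have "lookup (?\<phi> \<sigma>) = (lookup \<sigma>)(x := lookup \<sigma> x - 1)" for \<sigma>
      by (auto simp: lookup_update fun_eq_iff)
    then show "wp (Decr x) f (lookup \<sigma>) = f (lookup (?\<phi> \<sigma>))" for f \<sigma> by simp
  qed (rule wp_unit_bounded[OF Decr(2)])
next
  case (IncrIid x D y)
  then have D: "subprob (dist_fps D)" by (simp add: subprob_dist)
  let ?c' = "\<lambda>\<sigma>. dist_fps D ^ lookup \<sigma> y"
  let ?\<phi> = "\<lambda>p. fst p + single x (snd p)"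
  show ?case
  proof (rule dual_pushforward[where c = "\<lambda>\<sigma>. fps_nth (?c' \<sigma>)" and c' = ?c' and \<phi> = ?\<phi>])
    show "sem k (IncrIid x D y) g = (\<lambda>\<tau>. infsum (\<lambda>p. g (fst p) * fps_nth (?c' (fst p)) (snd p)) {p. ?\<phi> p = \<tau>})" for g
      by (rule sem_IncrIid)
    show "subprob (?c' \<sigma>)" for \<sigma> by (rule subprob_power[OF D])
    have "lookup (?\<phi> (\<sigma>, j)) = (lookup \<sigma>)(x := lookup \<sigma> x + j)" for \<sigma> j
      by (auto simp: lookup_add lookup_single when_def fun_eq_iff)
    then show "wp (IncrIid x D y) f (lookup \<sigma>) =
        (\<Sum>\<^sub>\<infinity>j. fps_nth (?c' \<sigma>) j * f (lookup (?\<phi> (\<sigma>, j))))" if "unit_bounded f" for f \<sigma>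
      by (simp add: drawop_power[OF D that, symmetric]) (simp add: drawop_def)
    show "Poly_Mapping.keys (?\<phi> (\<sigma>, j)) \<subseteq> {..<k}" if "Poly_Mapping.keys \<sigma> \<subseteq> {..<k}" for \<sigma> j
      using that IncrIid(2) Poly_Mapping.keys_add[of \<sigma> "single x j"] by (fastforce split: if_splits)
  qed (rule refl, rule wp_unit_bounded[OF IncrIid(2)])
next
  case (IfLess x n P Q)
  then have P: "dual k (sem k P) (wp P)" and Q: "dual k (sem k Q) (wp Q)" by auto
  show ?case unfolding dual_def
  proof (rule ballI, rule conjI)
    fix g assume g: "g \<in> pgfs k"
    let ?l = "mbelow x n g" and ?h = "mdiff g (mbelow x n g)"
    note lh = mbelow_pgfs[OF g, of x n]
    have SP: "sem k P ?l \<in> pgfs k" and SQ: "sem k Q ?h \<in> pgfs k"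
      using P Q lh by (auto simp: dual_def)
    have d: "(\<Sum>\<^sub>\<infinity>\<tau>. sem k (IfLess x n P Q) g \<tau> * f (lookup \<tau>)) =
        (\<Sum>\<^sub>\<infinity>\<sigma>. g \<sigma> * wp (IfLess x n P Q) f (lookup \<sigma>))" if f: "unit_bounded f" for f
    proof -
      have "(\<Sum>\<^sub>\<infinity>\<tau>. sem k (IfLess x n P Q) g \<tau> * f (lookup \<tau>)) =
          (\<Sum>\<^sub>\<infinity>\<tau>. sem k P ?l \<tau> * f (lookup \<tau>) + sem k Q ?h \<tau> * f (lookup \<tau>))"
        by (simp add: madd_def algebra_simps)
      also have "\<dots> = (\<Sum>\<^sub>\<infinity>\<tau>. sem k P ?l \<tau> * f (lookup \<tau>)) + (\<Sum>\<^sub>\<infinity>\<tau>. sem k Q ?h \<tau> * f (lookup \<tau>))"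
        by (rule infsum_add; rule pgfs_mult_summable[OF SP f] pgfs_mult_summable[OF SQ f])
      also have "\<dots> = (\<Sum>\<^sub>\<infinity>\<sigma>. ?l \<sigma> * wp P f (lookup \<sigma>)) + (\<Sum>\<^sub>\<infinity>\<sigma>. ?h \<sigma> * wp Q f (lookup \<sigma>))"
        using P Q lh f by (simp add: dual_def)
      also have "\<dots> = (\<Sum>\<^sub>\<infinity>\<sigma>. ?l \<sigma> * wp (IfLess x n P Q) f (lookup \<sigma>)) + (\<Sum>\<^sub>\<infinity>\<sigma>. ?h \<sigma> * wp (IfLess x n P Q) f (lookup \<sigma>))"
        by (intro arg_cong2[of _ _ _ _ "(+)"] infsum_cong) (auto simp: mbelow_eq mdiff_def)
      also have "\<dots> = (\<Sum>\<^sub>\<infinity>\<sigma>. g \<sigma> * wp (IfLess x n P Q) f (lookup \<sigma>))"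
        by (rule pgfs_splits[OF g wp_unit_bounded[OF IfLess(4) f], symmetric])
      finally show ?thesis .
    qed
    then show "\<forall>f. unit_bounded f \<longrightarrow> (\<Sum>\<^sub>\<infinity>\<tau>. sem k (IfLess x n P Q) g \<tau> * f (lookup \<tau>)) =
        (\<Sum>\<^sub>\<infinity>\<sigma>. g \<sigma> * wp (IfLess x n P Q) f (lookup \<sigma>))" by blast
    \<comment> \<open>That both branches yield PGFs bounds the mass of their sum only by 2; duality
      with the constant 1 bounds it by the mass of \<open>g\<close>.\<close>
    have "mass (sem k (IfLess x n P Q) g) \<le> mass g"
      using d[OF unit_bounded_1] pgfs_integral_le[OF g wp_unit_bounded[OF IfLess(4) unit_bounded_1]]
      by (simp add: mass_def del: sem.simps wp.simps)
    then have m: "mass (sem k (IfLess x n P Q) g) \<le> 1" using g by (simp add: pgfs_def)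
    have eq: "sem k (IfLess x n P Q) g = (\<lambda>\<tau>. sem k P ?l \<tau> + sem k Q ?h \<tau>)"
      by (simp add: madd_def)
    have "(\<lambda>\<tau>. sem k P ?l \<tau> + sem k Q ?h \<tau>) summable_on UNIV"
      by (rule summable_on_add) (use SP SQ in \<open>simp_all add: pgfs_def\<close>)
    moreover have "0 \<le> sem k P ?l \<tau> + sem k Q ?h \<tau>" for \<tau>
      using SP SQ by (simp add: pgfs_def)
    moreover have "Poly_Mapping.keys \<tau> \<subseteq> {..<k}" if "sem k P ?l \<tau> + sem k Q ?h \<tau> \<noteq> 0" for \<tau>
    proof -
      from that have "sem k P ?l \<tau> \<noteq> 0 \<or> sem k Q ?h \<tau> \<noteq> 0" by auto
      then show ?thesis using SP SQ unfolding pgfs_def by blast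
    qed
    ultimately show "sem k (IfLess x n P Q) g \<in> pgfs k"
      using m unfolding eq pgfs_def by blast
  qed
next
  case (Seq P Q)
  then have P: "dual k (sem k P) (wp P)" and Q: "dual k (sem k Q) (wp Q)" by auto
  have "unit_bounded (wp Q f)" if "unit_bounded f" for f using wp_unit_bounded[OF _ that] Seq(4) by auto
  with P Q show ?case by (simp add: dual_def)
qed simp

lemma sem_pgfs: "loop_free P \<Longrightarrow> redip k P \<Longrightarrow> g \<in> pgfs k \<Longrightarrow> sem k P g \<in> pgfs k"
  using sem_dual unfolding dual_def by blast

lemma mass_sem_le:
  assumes "loop_free P" "redip k P" "g \<in> pgfs k"
  shows "mass (sem k P g) \<le> mass g"
proof -
  have "mass (sem k P g) = (\<Sum>\<^sub>\<infinity>\<sigma>. g \<sigma> * wp P (\<lambda>s. 1) (lookup \<sigma>))"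
    using sem_dual[OF assms(1,2)] assms(3) unit_bounded_1 unfolding dual_def mass_def by fastforce
  also have "\<dots> \<le> mass g" by (rule pgfs_integral_le[OF assms(3) wp_unit_bounded[OF assms(2) unit_bounded_1]])
  finally show ?thesis .
qed

section \<open>Generating functions are determined by their values on the open unit cube\<close>

lemma summable_on_diff:
  fixes f g :: "'a \<Rightarrow> real"
  assumes "f summable_on A" "g summable_on A"
  shows "(\<lambda>x. f x - g x) summable_on A"
  using summable_on_add[of f A "\<lambda>x. - g x"] assms by (simp add: summable_on_uminus)

lemma infsum_diff:
  fixes f g :: "'a \<Rightarrow> real"
  assumes "f summable_on A" "g summable_on A"
  shows "(\<Sum>\<^sub>\<infinity>x\<in>A. f x - g x) = infsum f A - infsum g A"
  using infsum_add[of f A "\<lambda>x. - g x"] assms by (simp add: summable_on_uminus infsum_uminus)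

text \<open>The value of the monomial with exponent vector \<open>s\<close> at the point
  \<open>u\<close>: pairing this observation with a series evaluates the generating function at
  \<open>u\<close>.\<close>

definition pvals :: "nat \<Rightarrow> (nat \<Rightarrow> real) \<Rightarrow> (nat \<Rightarrow> nat) \<Rightarrow> real" where
  "pvals k u s = (\<Prod>i<k. u i ^ s i)"

lemma prod_power_unit:
  fixes u :: "nat \<Rightarrow> real"
  assumes "\<And>i. 0 < u i \<and> u i < 1"
  shows "0 \<le> (\<Prod>i\<in>A. u i ^ s i)" "(\<Prod>i\<in>A. u i ^ s i) \<le> 1"
  by (intro prod_nonneg prod_le_1 ballI conjI; use assms in \<open>simp add: less_imp_le power_le_one\<close>)+

lemma unit_bounded_pvals: "(\<And>i. 0 < u i \<and> u i < 1) \<Longrightarrow> unit_bounded (pvals k u)"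
  unfolding unit_bounded_def pvals_def using prod_power_unit[of u] by simp

lemma power_series_zero:
  fixes b :: "nat \<Rightarrow> real"
  assumes b: "b summable_on UNIV" and z: "\<And>t. 0 < t \<Longrightarrow> t < 1 \<Longrightarrow> (\<Sum>\<^sub>\<infinity>m. b m * t ^ m) = 0"
  shows "b m = 0"
proof (induction m rule: less_induct)
  case (less m)
  have ab: "(\<lambda>i. \<bar>b i\<bar>) summable_on UNIV"
    using b summable_on_iff_abs_summable_on_real[of b UNIV] by simp
  define B where "B = (\<Sum>\<^sub>\<infinity>i. \<bar>b i\<bar>)"
  have B0: "0 \<le> B" unfolding B_def by (rule infsum_nonneg) simp
  \<comment> \<open>The lower coefficients vanish by induction, so the sum without term
    \<open>m\<close> is at most \<open>B t^(m+1)\<close>; dividing by \<open>t^m\<close> leaves a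
    bound that tends to 0 with \<open>t\<close>.\<close>
  have main: "\<bar>b m\<bar> \<le> t * B" if t: "0 < t" "t < 1" for t
  proof -
    have tp: "\<bar>b i * t ^ i\<bar> \<le> \<bar>b i\<bar>" for i
      using t by (auto simp: abs_mult intro!: mult_left_le power_le_one)
    have s: "(\<lambda>i. b i * t ^ i) summable_on A" for A
      by (rule summable_on_abs_le[OF summable_on_subset[OF ab]]) (use tp in auto)
    have "0 = (\<Sum>\<^sub>\<infinity>i. b i * t ^ i)" using z[OF t] by simp
    also have "\<dots> = (\<Sum>\<^sub>\<infinity>i\<in>{m}. b i * t ^ i) + (\<Sum>\<^sub>\<infinity>i\<in>UNIV - {m}. b i * t ^ i)"
      by (subst infsum_Un_disjoint[symmetric]) (auto intro: s simp: insert_UNIV)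
    finally have "b m * t ^ m = - (\<Sum>\<^sub>\<infinity>i\<in>UNIV - {m}. b i * t ^ i)" by simp
    moreover have "\<bar>b m\<bar> * t ^ m = \<bar>b m * t ^ m\<bar>" using t by (simp add: abs_mult)
    ultimately have "\<bar>b m\<bar> * t ^ m = \<bar>\<Sum>\<^sub>\<infinity>i\<in>UNIV - {m}. b i * t ^ i\<bar>"
      by (metis abs_minus_cancel)
    also have "\<dots> \<le> (\<Sum>\<^sub>\<infinity>i\<in>UNIV - {m}. \<bar>b i\<bar> * t ^ Suc m)"
    proof (rule abs_infsum_le)
      show "(\<lambda>i. \<bar>b i\<bar> * t ^ Suc m) summable_on UNIV - {m}"
        by (intro summable_on_cmult_left summable_on_subset[OF ab]) auto
      show "\<bar>b i * t ^ i\<bar> \<le> \<bar>b i\<bar> * t ^ Suc m" if "i \<in> UNIV - {m}" for i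
      proof (cases "i < m")
        case True
        then show ?thesis using less t by simp
      next
        case False
        then have "Suc m \<le> i" using that by auto
        then have "t ^ i \<le> t ^ Suc m" using t by (intro power_decreasing) auto
        then show ?thesis using t by (auto simp: abs_mult intro!: mult_left_mono)
      qed
    qed
    also have "\<dots> = (\<Sum>\<^sub>\<infinity>i\<in>UNIV - {m}. \<bar>b i\<bar>) * t ^ Suc m"
      by (rule infsum_cmult_left) (auto intro: summable_on_subset[OF ab])
    also have "\<dots> \<le> B * t ^ Suc m"
      unfolding B_def using t
      by (intro mult_right_mono infsum_mono2 ab summable_on_subset[OF ab]) auto
    finally have "\<bar>b m\<bar> * t ^ m \<le> (t * B) * t ^ m" by (simp add: algebra_simps)
    then show ?thesis using t by simp
  qed
  show "b m = 0"
  proof (rule ccontr)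
    assume nz: "b m \<noteq> 0"
    \<comment> \<open>Small enough that \<open>t * B\<close> is at most half of the positive number
      it is supposed to bound.\<close>
    define t where "t = min (1/2) (\<bar>b m\<bar> / (2 * (B + 1)))"
    have t: "0 < t" "t < 1" using nz B0 by (auto simp: t_def)
    have "t * B \<le> \<bar>b m\<bar> / (2 * (B + 1)) * B" using B0 by (intro mult_right_mono) (auto simp: t_def)
    also have "\<dots> \<le> \<bar>b m\<bar> / 2"
    proof -
      have "B / (B + 1) \<le> 1" using B0 by simp
      then have "\<bar>b m\<bar> / 2 * (B / (B + 1)) \<le> \<bar>b m\<bar> / 2" by (intro mult_left_le) auto
      then show ?thesis using B0 by (simp add: field_simps)
    qed
    finally show False using main[OF t] nz by simp
  qed
qed

lemma multi_power_series_zero: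
  fixes a :: mfps
  assumes a: "a summable_on UNIV" and keys: "\<And>\<tau>. a \<tau> \<noteq> 0 \<Longrightarrow> Poly_Mapping.keys \<tau> \<subseteq> {..<k}"
    and z: "\<And>u. (\<And>i. 0 < u i \<and> u i < 1) \<Longrightarrow> (\<Sum>\<^sub>\<infinity>\<tau>. a \<tau> * pvals k u (lookup \<tau>)) = 0"
  shows "a \<tau> = 0"
proof -
  let ?S = "\<lambda>j \<rho>. {\<tau>. \<forall>i<j. lookup \<tau> i = \<rho> i}"
  let ?p = "\<lambda>j u \<tau>. \<Prod>i\<in>{j..<k}. u i ^ lookup \<tau> i"
  have summ: "(\<lambda>\<tau>. a \<tau> * ?p j u \<tau>) summable_on A" if "\<And>i. 0 < u i \<and> u i < 1" for j u A
  proof (rule summable_on_abs_le)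
    have "(\<lambda>\<tau>. \<bar>a \<tau>\<bar>) summable_on UNIV"
      using a summable_on_iff_abs_summable_on_real[of a UNIV] by simp
    then show "(\<lambda>\<tau>. \<bar>a \<tau>\<bar>) summable_on A" by (rule summable_on_subset) simp
    show "\<bar>a \<tau> * ?p j u \<tau>\<bar> \<le> \<bar>a \<tau>\<bar>" for \<tau>
      using prod_power_unit[where u = u and s = "lookup \<tau>" and A = "{j..<k}"] that by (simp add: abs_mult mult_left_le)
  qed
  \<comment> \<open>One indeterminate at a time: after \<open>j\<close> rounds the first
    \<open>j\<close> exponents are fixed to those of \<open>\<rho>\<close> and only the others are
    still evaluated. A round reads the sum as a power series in coordinate \<open>j\<close> and
    concludes that its coefficients vanish.\<close>
  have claim: "\<forall>\<rho> u. (\<forall>i. 0 < u i \<and> u i < 1) \<longrightarrow> (\<Sum>\<^sub>\<infinity>\<tau>\<in>?S j \<rho>. a \<tau> * ?p j u \<tau>) = 0" if "j \<le> k" for j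
    using that
  proof (induction j)
    case 0
    then show ?case using z unfolding pvals_def by (simp add: lessThan_atLeast0)
  next
    case (Suc j)
    show ?case
    proof (intro allI impI)
      fix \<rho> and u :: "nat \<Rightarrow> real" assume u: "\<forall>i. 0 < u i \<and> u i < 1"
      define b where "b m = (\<Sum>\<^sub>\<infinity>\<tau>\<in>?S (Suc j) (\<rho>(j := m)). a \<tau> * ?p (Suc j) u \<tau>)" for m
      let ?R = "Sigma UNIV (\<lambda>m. ?S (Suc j) (\<rho>(j := m)))"
      have bij: "bij_betw (\<lambda>\<tau>. (lookup \<tau> j, \<tau>)) (?S j \<rho>) ?R"
        by (rule bij_betw_byWitness[where f' = snd]) (auto simp: less_Suc_eq)
      have sums: "(\<Sum>\<^sub>\<infinity>\<tau>\<in>?S j \<rho>. a \<tau> * ?p (Suc j) u \<tau> * t ^ lookup \<tau> j) = (\<Sum>\<^sub>\<infinity>m. b m * t ^ m)"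
        "(\<lambda>m. b m * t ^ m) summable_on UNIV"
        if t: "0 < t" "t \<le> 1" for t
      proof -
        let ?h = "\<lambda>q. a (snd q) * ?p (Suc j) u (snd q) * t ^ fst q"
        have "(\<lambda>\<tau>. a \<tau> * ?p (Suc j) u \<tau> * t ^ lookup \<tau> j) summable_on ?S j \<rho>"
        proof (rule summable_on_abs_le)
          show "(\<lambda>\<tau>. \<bar>a \<tau> * ?p (Suc j) u \<tau>\<bar>) summable_on ?S j \<rho>"
            using summable_on_iff_abs_summable_on_real[THEN iffD1, OF summ[of u "Suc j" "?S j \<rho>"]] u by simp
          show "\<bar>a \<tau> * ?p (Suc j) u \<tau> * t ^ lookup \<tau> j\<bar> \<le> \<bar>a \<tau> * ?p (Suc j) u \<tau>\<bar>" for \<tau>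
            using t by (simp only: abs_mult[of _ "t ^ _"]) (auto intro!: mult_left_le simp: power_le_one)
        qed
        then have hs: "?h summable_on ?R"
          using summable_on_reindex_bij_betw[OF bij, of ?h] by simp
        have inner: "(\<Sum>\<^sub>\<infinity>\<tau>\<in>?S (Suc j) (\<rho>(j := m)). ?h (m, \<tau>)) = b m * t ^ m" for m
          unfolding b_def fst_conv snd_conv
          by (rule infsum_cmult_left) (use summ u in blast)
        show "(\<Sum>\<^sub>\<infinity>\<tau>\<in>?S j \<rho>. a \<tau> * ?p (Suc j) u \<tau> * t ^ lookup \<tau> j) = (\<Sum>\<^sub>\<infinity>m. b m * t ^ m)"
          using infsum_reindex_bij_betw[OF bij, of ?h] infsum_Sigma_banach[OF hs] inner by simp
        have "(\<lambda>m. \<Sum>\<^sub>\<infinity>\<tau>\<in>?S (Suc j) (\<rho>(j := m)). ?h (m, \<tau>)) summable_on UNIV"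
          by (rule summable_on_Sigma_banach) (use hs in \<open>simp add: case_prod_unfold\<close>)
        then show "(\<lambda>m. b m * t ^ m) summable_on UNIV" unfolding inner .
      qed
      have "b m = 0" for m
      proof (rule power_series_zero)
        show "b summable_on UNIV" using sums(2)[of 1] by simp
        fix t :: real assume t: "0 < t" "t < 1"
        let ?u = "u(j := t)"
        have u': "\<forall>i. 0 < ?u i \<and> ?u i < 1" using u t by simp
        have eq: "?p j ?u \<tau> = ?p (Suc j) u \<tau> * t ^ lookup \<tau> j" for \<tau>
        proof -
          have "{j..<k} = insert j {Suc j..<k}" using Suc.prems by auto
          moreover have "(\<Prod>i\<in>{Suc j..<k}. ?u i ^ lookup \<tau> i) = ?p (Suc j) u \<tau>"
            by (rule prod.cong) auto
          ultimately show ?thesis by simp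
        qed
        have "(\<Sum>\<^sub>\<infinity>\<tau>\<in>?S j \<rho>. a \<tau> * ?p j ?u \<tau>) = 0" using Suc u' by auto
        then have "(\<Sum>\<^sub>\<infinity>\<tau>\<in>?S j \<rho>. a \<tau> * ?p (Suc j) u \<tau> * t ^ lookup \<tau> j) = 0"
          unfolding eq by (simp add: mult.assoc)
        then show "(\<Sum>\<^sub>\<infinity>m. b m * t ^ m) = 0" using sums(1)[of t] t by simp
      qed
      from this[of "\<rho> j"] show "(\<Sum>\<^sub>\<infinity>\<tau>\<in>?S (Suc j) \<rho>. a \<tau> * ?p (Suc j) u \<tau>) = 0"
        by (simp add: b_def)
    qed
  qed
  show "a \<tau> = 0"
  proof (rule ccontr)
    assume nz: "a \<tau> \<noteq> 0"
    have "(\<Sum>\<^sub>\<infinity>\<tau>'\<in>?S k (lookup \<tau>). a \<tau>') = 0"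
      using claim[OF order_refl, rule_format, of "\<lambda>_. 1/2" "lookup \<tau>"] by simp
    moreover have "(\<Sum>\<^sub>\<infinity>\<tau>'\<in>?S k (lookup \<tau>). a \<tau>') = infsum a {\<tau>}"
    proof (rule infsum_cong_neutral)
      fix \<tau>' assume \<tau>': "\<tau>' \<in> ?S k (lookup \<tau>) - {\<tau>}"
      show "a \<tau>' = 0"
      proof (rule ccontr)
        assume nz': "a \<tau>' \<noteq> 0"
        have "lookup \<tau>' i = lookup \<tau> i" for i
        proof (cases "i < k")
          case False
          then have "i \<notin> Poly_Mapping.keys \<tau>" "i \<notin> Poly_Mapping.keys \<tau>'"
            using keys[OF nz] keys[OF nz'] by auto
          then show ?thesis by (simp add: in_keys_iff)
        qed (use \<tau>' in auto)
        then have "\<tau>' = \<tau>" by (rule poly_mapping_eqI)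
        with \<tau>' show False by simp
      qed
    qed auto
    ultimately show False using nz by simp
  qed
qed

definition states :: "nat \<Rightarrow> (nat \<Rightarrow> nat) set" where
  "states k = {s. \<forall>i\<ge>k. s i = 0}"

lemma states_lookup: "s \<in> states k \<Longrightarrow> \<exists>\<sigma>. lookup \<sigma> = s \<and> Poly_Mapping.keys \<sigma> \<subseteq> {..<k}"
proof -
  assume s: "s \<in> states k"
  have "finite {i. s i \<noteq> 0}"
    by (rule finite_subset[of _ "{..<k}"]) (use s in \<open>auto simp: states_def not_less[symmetric]\<close>)
  then have "lookup (Abs_poly_mapping s) = s" by simp
  moreover from this have "Poly_Mapping.keys (Abs_poly_mapping s) \<subseteq> {..<k}"
    using s by (auto simp: states_def in_keys_iff not_less[symmetric])
  ultimately show ?thesis by blast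
qed

theorem denotation_eq_iff_wp:
  assumes P: "loop_free P" "redip k P" and Q: "loop_free Q" "redip k Q"
  shows "denotation k P = denotation k Q \<longleftrightarrow>
    (\<forall>u s. (\<forall>i. 0 < u i \<and> u i < 1) \<longrightarrow> s \<in> states k \<longrightarrow> wp P (pvals k u) s = wp Q (pvals k u) s)"
proof (intro iffI allI impI)
  fix u :: "nat \<Rightarrow> real" and s assume eq: "denotation k P = denotation k Q" and u: "\<forall>i. 0 < u i \<and> u i < 1" and s: "s \<in> states k"
  obtain \<sigma> where \<sigma>: "lookup \<sigma> = s" "Poly_Mapping.keys \<sigma> \<subseteq> {..<k}" using states_lookup[OF s] by blast
  \<comment> \<open>A point mass turns duality into evaluation of \<open>wp\<close> at a single
    state.\<close>
  define g :: mfps where "g = (\<lambda>\<tau>. if \<tau> = \<sigma> then 1 else 0)"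
  have one: "((\<lambda>\<tau>. g \<tau> * h \<tau>) has_sum h \<sigma>) UNIV" for h
    by (rule has_sum_finite_neutralI[of "{\<sigma>}"]) (auto simp: g_def)
  have gs: "g summable_on UNIV" "mass g = 1"
    using one[of "\<lambda>_. 1"] by (auto simp: mass_def summable_on_def infsumI)
  then have g: "g \<in> pgfs k" using \<sigma>(2) by (auto simp: pgfs_def g_def split: if_splits)
  have b: "unit_bounded (pvals k u)" using u by (intro unit_bounded_pvals) auto
  have "wp R (pvals k u) s = (\<Sum>\<^sub>\<infinity>\<tau>. denotation k R g \<tau> * pvals k u (lookup \<tau>))"
    if "loop_free R" "redip k R" for R
    using sem_dual[OF that] g b infsumI[OF one[of "\<lambda>\<tau>. wp R (pvals k u) (lookup \<tau>)"]] \<sigma>(1)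
    by (simp add: dual_def denotation_def)
  then show "wp P (pvals k u) s = wp Q (pvals k u) s" using P Q eq by simp
next
  assume eq: "\<forall>u s. (\<forall>i. 0 < u i \<and> u i < 1) \<longrightarrow> s \<in> states k \<longrightarrow> wp P (pvals k u) s = wp Q (pvals k u) s"
  show "denotation k P = denotation k Q"
  proof
    fix g
    show "denotation k P g = denotation k Q g"
    proof (cases "g \<in> pgfs k")
      case True
      have SP: "sem k P g \<in> pgfs k" and SQ: "sem k Q g \<in> pgfs k"
        using sem_pgfs P Q True by auto
      let ?a = "\<lambda>\<tau>. sem k P g \<tau> - sem k Q g \<tau>"
      have sum: "sem k P g summable_on UNIV" "sem k Q g summable_on UNIV" using SP SQ by (auto simp: pgfs_def)
      have "?a \<tau> = 0" for \<tau>
      proof (rule multi_power_series_zero[where k = k])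
        show "?a summable_on UNIV" by (rule summable_on_diff[OF sum])
        show "Poly_Mapping.keys \<tau> \<subseteq> {..<k}" if "?a \<tau> \<noteq> 0" for \<tau>
        proof -
          from that have "sem k P g \<tau> \<noteq> 0 \<or> sem k Q g \<tau> \<noteq> 0" by auto
          then show ?thesis using SP SQ unfolding pgfs_def by blast
        qed
        fix u :: "nat \<Rightarrow> real" assume u: "\<And>i. 0 < u i \<and> u i < 1"
        have b: "unit_bounded (pvals k u)" by (rule unit_bounded_pvals[OF u])
        have "(\<Sum>\<^sub>\<infinity>\<sigma>. g \<sigma> * wp P (pvals k u) (lookup \<sigma>)) = (\<Sum>\<^sub>\<infinity>\<sigma>. g \<sigma> * wp Q (pvals k u) (lookup \<sigma>))"
        proof (rule infsum_cong)
          fix \<sigma>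
          show "g \<sigma> * wp P (pvals k u) (lookup \<sigma>) = g \<sigma> * wp Q (pvals k u) (lookup \<sigma>)"
          proof (cases "g \<sigma> = 0")
            case False
            then have "lookup \<sigma> \<in> states k" using True
              by (auto simp: pgfs_def states_def in_keys_iff not_less[symmetric] subset_iff)
            then show ?thesis using eq u by simp
          qed simp
        qed
        then have "(\<Sum>\<^sub>\<infinity>\<tau>. sem k P g \<tau> * pvals k u (lookup \<tau>)) = (\<Sum>\<^sub>\<infinity>\<tau>. sem k Q g \<tau> * pvals k u (lookup \<tau>))"
          using sem_dual[OF P] sem_dual[OF Q] True b by (simp add: dual_def)
        moreover have "(\<Sum>\<^sub>\<infinity>\<tau>. sem k P g \<tau> * pvals k u (lookup \<tau>) - sem k Q g \<tau> * pvals k u (lookup \<tau>))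
            = (\<Sum>\<^sub>\<infinity>\<tau>. sem k P g \<tau> * pvals k u (lookup \<tau>)) - (\<Sum>\<^sub>\<infinity>\<tau>. sem k Q g \<tau> * pvals k u (lookup \<tau>))"
          by (rule infsum_diff[OF pgfs_mult_summable[OF SP b] pgfs_mult_summable[OF SQ b]])
        ultimately show "(\<Sum>\<^sub>\<infinity>\<tau>. ?a \<tau> * pvals k u (lookup \<tau>)) = 0"
          unfolding left_diff_distrib by simp
      qed
      then show ?thesis by (auto simp: denotation_def True)
    qed (simp add: denotation_def)
  qed
qed

subsection \<open>Loops\<close>

text \<open>The language has no such statement. Samples of the point mass at 0, whose generating
  function is 1, change nothing, however many are added.\<close>

definition skip :: "nat \<Rightarrow> prog" where "skip x = IncrIid x (Ratio 1 1) x"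

lemma dist_fps_1: "dist_fps (Ratio 1 1) = 1"
  by simp

lemma sem_skip: "sem k (skip x) g = g"
proof
  fix \<tau>
  have "sem k (skip x) g \<tau> = (\<Sum>\<^sub>\<infinity>p\<in>{p. fst p + single x (snd p) = \<tau>}. g (fst p) * fps_nth 1 (snd p))"
    unfolding skip_def sem_IncrIid dist_fps_1 by simp
  also have "\<dots> = infsum (\<lambda>p. g (fst p)) {(\<tau>, 0 :: nat)}"
    by (rule infsum_cong_neutral) auto
  finally show "sem k (skip x) g \<tau> = g \<tau>" by simp
qed

lemma redip_skip: "x < k \<Longrightarrow> redip k (skip x)" "loop_free (skip x)"
proof -
  have "(fps_nth (1 :: real fps)) sums 1"
    using sums_single[of 0 "\<lambda>_. 1 :: real"] by (simp add: sums_def fps_one_nth if_distrib eq_commute cong: if_cong)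
  then have "summable (fps_nth (1 :: real fps))" "suminf (fps_nth (1 :: real fps)) = 1"
    by (auto simp: sums_iff)
  then show "x < k \<Longrightarrow> redip k (skip x)" "loop_free (skip x)"
    by (simp_all add: skip_def dist_fps_1 del: dist_fps.simps)
qed

context
  fixes k x n :: nat and P :: prog
  assumes P: "loop_free P" "redip k P"
begin

definition "loop_step f = sem k P (mbelow x n f)"
definition "loop_exit f = mdiff f (mbelow x n f)"

lemma loop_step_pgfs: "f \<in> pgfs k \<Longrightarrow> loop_step f \<in> pgfs k"
  unfolding loop_step_def by (intro sem_pgfs P mbelow_pgfs)

lemma loop_exit_pgfs: "f \<in> pgfs k \<Longrightarrow> loop_exit f \<in> pgfs k"
  unfolding loop_exit_def by (rule mbelow_pgfs)

lemma loop_steps_pgfs: "f \<in> pgfs k \<Longrightarrow> (loop_step ^^ j) f \<in> pgfs k"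
  by (induction j) (simp_all add: loop_step_pgfs)

lemma mass_exit_step: "f \<in> pgfs k \<Longrightarrow> mass (loop_exit f) + mass (loop_step f) \<le> mass f"
  using mass_splits[of f k x n] mass_sem_le[OF P mbelow_pgfs(1), of f x n]
  by (simp add: loop_step_def loop_exit_def)

lemma mass_nonneg: "f \<in> pgfs k \<Longrightarrow> 0 \<le> mass f"
  unfolding mass_def by (rule infsum_nonneg) (simp add: pgfs_def)

text \<open>Telescoping over the rounds: mass that has left plus mass still inside never exceeds the
  initial mass. This is what makes the series over all unrollings converge.\<close>

lemma mass_exit_sum: "f \<in> pgfs k \<Longrightarrow> (\<Sum>j<m. mass (loop_exit ((loop_step ^^ j) f))) + mass ((loop_step ^^ m) f) \<le> mass f"
proof (induction m)
  case (Suc m)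
  then show ?case using mass_exit_step[OF loop_steps_pgfs[OF Suc(2), of m]] by simp
qed simp

definition unroll :: "mfps \<Rightarrow> mfps" where
  "unroll f = (\<lambda>\<sigma>. \<Sum>\<^sub>\<infinity>j. loop_exit ((loop_step ^^ j) f) \<sigma>)"

lemma unroll:
  assumes f: "f \<in> pgfs k"
  shows "unroll f \<in> pgfs k" "(\<lambda>j. loop_exit ((loop_step ^^ j) f) \<sigma>) summable_on UNIV"
proof -
  let ?F = "\<lambda>p. loop_exit ((loop_step ^^ fst p) f) (snd p)"
  let ?m = "\<lambda>j. mass (loop_exit ((loop_step ^^ j) f))"
  have h: "loop_exit ((loop_step ^^ j) f) \<in> pgfs k" for j by (intro loop_exit_pgfs loop_steps_pgfs f)
  have F0: "0 \<le> ?F p" for p using h by (simp add: pgfs_def)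
  have le: "(\<Sum>j<m. ?m j) \<le> mass f" for m
    using mass_exit_sum[OF f, of m] mass_nonneg[OF loop_steps_pgfs[OF f, of m]] by simp
  have m0: "0 \<le> ?m j" for j by (rule mass_nonneg[OF h])
  have sm: "summable ?m" by (rule summableI_nonneg_bounded[OF m0 le])
  have m: "?m summable_on UNIV" by (rule summable_nonneg_imp_summable_on) (use sm m0 in auto)
  have "infsum ?m UNIV = suminf ?m"
    using has_sum_imp_sums[OF has_sum_infsum[OF m]] sums_unique by force
  also have "\<dots> \<le> mass f" by (rule suminf_le_const[OF sm le])
  finally have inf: "infsum ?m UNIV \<le> 1" using f by (simp add: pgfs_def)
  have 1: "((\<lambda>\<sigma>. ?F (j, \<sigma>)) has_sum ?m j) UNIV" for j
    using h[of j] by (auto simp: mass_def pgfs_def)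
  have S: "?F summable_on UNIV \<times> UNIV"
    by (rule summable_on_SigmaI[OF 1 m]) (use F0 in auto)
  then have S': "?F summable_on UNIV" by simp
  have bij: "bij_betw (\<lambda>j. (j, \<sigma>)) UNIV {p. snd p = \<sigma>}" for \<sigma> :: "nat \<Rightarrow>\<^sub>0 nat"
    by (rule bij_betw_byWitness[where f' = fst]) auto
  have eq: "unroll f = (\<lambda>\<sigma>. infsum ?F {p. snd p = \<sigma>})"
    using infsum_reindex_bij_betw[OF bij, of ?F] by (simp add: unroll_def)
  have "?F summable_on {p. snd p = \<sigma>}" by (rule summable_on_subset[OF S']) simp
  then show "(\<lambda>j. loop_exit ((loop_step ^^ j) f) \<sigma>) summable_on UNIV"
    using summable_on_reindex_bij_betw[OF bij, of ?F] by simp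
  have b: "unit_bounded (\<lambda>\<sigma> :: nat \<Rightarrow>\<^sub>0 nat. 1)" by (simp add: unit_bounded_def)
  note pf = pushforward[of ?F "\<lambda>_. 1" snd, OF F0 S' b]
  have "mass (unroll f) = infsum ?F UNIV" unfolding eq mass_def using pf(3) by simp
  also have "\<dots> = infsum ?m UNIV"
    using infsum_Sigma_banach[OF S] by (simp add: mass_def)
  finally have mass: "mass (unroll f) \<le> 1" using inf by simp
  have keys: "Poly_Mapping.keys \<sigma> \<subseteq> {..<k}" if nz: "unroll f \<sigma> \<noteq> 0" for \<sigma>
  proof -
    have "\<exists>j. loop_exit ((loop_step ^^ j) f) \<sigma> \<noteq> 0"
    proof (rule ccontr)
      assume "\<nexists>j. loop_exit ((loop_step ^^ j) f) \<sigma> \<noteq> 0"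
      then show False using nz by (simp add: unroll_def)
    qed
    then show ?thesis using h by (auto simp: pgfs_def)
  qed
  have "0 \<le> unroll f \<sigma>" "unroll f summable_on UNIV" for \<sigma>
    unfolding eq using pf(1,2) by auto
  with mass keys show "unroll f \<in> pgfs k" by (simp add: pgfs_def)
qed

lemma unroll_sums: "f \<in> pgfs k \<Longrightarrow> (\<lambda>j. loop_exit ((loop_step ^^ j) f) \<sigma>) sums unroll f \<sigma>"
  using has_sum_imp_sums[OF has_sum_infsum[OF unroll(2)]] by (simp add: unroll_def)

lemma unroll_fixpoint: "f \<in> pgfs k \<Longrightarrow> madd (loop_exit f) (unroll (loop_step f)) = unroll f"
proof
  fix \<sigma> assume f: "f \<in> pgfs k"
  have "(\<lambda>j. loop_exit ((loop_step ^^ j) (loop_step f)) \<sigma>) sums unroll (loop_step f) \<sigma>"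
    by (rule unroll_sums[OF loop_step_pgfs[OF f]])
  then have "(\<lambda>j. loop_exit ((loop_step ^^ Suc j) f) \<sigma>) sums unroll (loop_step f) \<sigma>"
    by (simp only: funpow_Suc_right o_def)
  from sums_Suc[OF this] have "(\<lambda>j. loop_exit ((loop_step ^^ j) f) \<sigma>) sums (unroll (loop_step f) \<sigma> + loop_exit f \<sigma>)" by simp
  then show "madd (loop_exit f) (unroll (loop_step f)) \<sigma> = unroll f \<sigma>"
    using unroll_sums[OF f, of \<sigma>] sums_unique2 by (fastforce simp: madd_def)
qed

text \<open>Unfolding the fixed-point equation \<open>m\<close> times exhibits the first
  \<open>m\<close> terms of the series as a lower bound of \<open>\<psi> f\<close>.\<close>

lemma unroll_least:
  assumes \<psi>: "\<And>f. f \<in> pgfs k \<Longrightarrow> \<psi> f \<in> pgfs k" "\<And>f. f \<in> pgfs k \<Longrightarrow> madd (loop_exit f) (\<psi> (loop_step f)) = \<psi> f"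
    and f: "f \<in> pgfs k"
  shows "unroll f \<le> \<psi> f"
proof (rule le_funI)
  fix \<sigma>
  have "(\<Sum>j<m. loop_exit ((loop_step ^^ j) f) \<sigma>) \<le> \<psi> f \<sigma>" for m
    using f
  proof (induction m arbitrary: f)
    case 0
    then show ?case using \<psi>(1) by (simp add: pgfs_def)
  next
    case (Suc m)
    have "(\<Sum>j<Suc m. loop_exit ((loop_step ^^ j) f) \<sigma>) = loop_exit f \<sigma> + (\<Sum>j<m. loop_exit ((loop_step ^^ j) (loop_step f)) \<sigma>)"
      by (subst sum.lessThan_Suc_shift) (simp only: funpow_Suc_right o_def funpow_0)
    also have "\<dots> \<le> loop_exit f \<sigma> + \<psi> (loop_step f) \<sigma>" using Suc.IH[OF loop_step_pgfs[OF Suc.prems]] by simp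
    also have "\<dots> = \<psi> f \<sigma>" using \<psi>(2)[OF Suc.prems] by (simp add: madd_def fun_eq_iff)
    finally show ?case .
  qed
  then show "unroll f \<sigma> \<le> \<psi> f \<sigma>"
    using unroll_sums[OF f, of \<sigma>] by (metis suminf_le_const sums_iff)
qed

lemma sem_WhileLess: "f \<in> pgfs k \<Longrightarrow> sem k (WhileLess x n P) f = unroll f"
proof -
  let ?\<Phi> = "\<lambda>\<psi> f. madd (mdiff f (mbelow x n f)) (\<psi> (sem k P (mbelow x n f)))"
  have \<Phi>: "?\<Phi> \<psi> f = madd (loop_exit f) (\<psi> (loop_step f))" for \<psi> f by (simp add: loop_exit_def loop_step_def)
  let ?U = "restrict unroll (pgfs k)"
  have U: "?U \<in> Defs.fixpoints k ?\<Phi>"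
    unfolding Defs.fixpoints_def \<Phi> by (auto simp: unroll unroll_fixpoint loop_step_pgfs)
  have least: "?U f \<le> \<psi> f" if "\<psi> \<in> Defs.fixpoints k ?\<Phi>" "f \<in> pgfs k" for \<psi> f
    using that unroll_least[of \<psi> f] unfolding Defs.fixpoints_def \<Phi> by auto
  have "least_fixpoint k ?\<Phi> = ?U"
    unfolding least_fixpoint_def
  proof (rule the_equality)
    show "?U \<in> Defs.fixpoints k ?\<Phi> \<and> (\<forall>\<psi>'\<in>Defs.fixpoints k ?\<Phi>. \<forall>f\<in>pgfs k. ?U f \<le> \<psi>' f)"
      using U least by blast
    fix \<psi> assume \<psi>: "\<psi> \<in> Defs.fixpoints k ?\<Phi> \<and> (\<forall>\<psi>'\<in>Defs.fixpoints k ?\<Phi>. \<forall>f\<in>pgfs k. \<psi> f \<le> \<psi>' f)"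
    \<comment> \<open>Two least fixed points agree on PGFs by antisymmetry, and elsewhere because
      both are extensional.\<close>
    have "\<psi> f = ?U f" if "f \<in> pgfs k" for f
      using \<psi> U least that by (meson order_antisym)
    moreover have "\<psi> \<in> extensional (pgfs k)" using \<psi> by (auto simp: Defs.fixpoints_def PiE_def)
    ultimately show "\<psi> = ?U" by (intro extensionalityI[where A = "pgfs k"]) auto
  qed
  then show "f \<in> pgfs k \<Longrightarrow> sem k (WhileLess x n P) f = unroll f" by simp
qed

lemma loop_eq_iff:
  assumes ast: "universally_ast k (WhileLess x n P)" and I: "loop_free I" "redip k I"
  shows "denotation k (WhileLess x n P) = denotation k I \<longleftrightarrow>
    denotation k I = denotation k (IfLess x n (Seq P I) (skip x))"
proof -
  have W: "denotation k (WhileLess x n P) = restrict unroll (pgfs k)"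
    unfolding denotation_def by (rule restrict_ext) (rule sem_WhileLess)
  have If: "sem k (IfLess x n (Seq P I) (skip x)) f = madd (loop_exit f) (sem k I (loop_step f))" for f
    using sem_skip by (simp add: loop_step_def loop_exit_def madd_def add.commute skip_def del: sem.simps(3))
  show ?thesis
  proof
    assume eq: "denotation k (WhileLess x n P) = denotation k I"
    have u: "unroll f = sem k I f" if "f \<in> pgfs k" for f
      using fun_cong[OF eq, of f] that by (simp add: W) (simp add: denotation_def)
    show "denotation k I = denotation k (IfLess x n (Seq P I) (skip x))"
      unfolding denotation_def
    proof (rule restrict_ext)
      fix f assume f: "f \<in> pgfs k"
      show "sem k I f = sem k (IfLess x n (Seq P I) (skip x)) f"
        unfolding If using unroll_fixpoint[OF f] by (simp add: u f loop_step_pgfs)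
    qed
  next
    assume eq: "denotation k I = denotation k (IfLess x n (Seq P I) (skip x))"
    have fp: "madd (loop_exit f) (sem k I (loop_step f)) = sem k I f" if "f \<in> pgfs k" for f
      using fun_cong[OF eq, of f] that unfolding denotation_def by (simp add: If del: sem.simps)
    have "unroll f = sem k I f" if f: "f \<in> pgfs k" for f
    proof -
      \<comment> \<open>A fixed point dominates the least one. Almost sure termination gives the
        least one the full mass of \<open>f\<close>, which \<open>I\<close> cannot exceed, so the
        nonnegative difference has sum at most 0 and vanishes.\<close>
      have le: "unroll f \<sigma> \<le> sem k I f \<sigma>" for \<sigma>
        using unroll_least[of "sem k I" f] fp sem_pgfs[OF I] f by (auto simp: le_fun_def)
      have "mass (unroll f) = mass f"
        using ast f by (simp add: universally_ast_def W del: denotation_def)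
      then have "mass (sem k I f) \<le> mass (unroll f)" using mass_sem_le[OF I f] by simp
      moreover have s: "sem k I f summable_on UNIV" "unroll f summable_on UNIV"
        using sem_pgfs[OF I f] unroll(1)[OF f] by (auto simp: pgfs_def)
      ultimately have "(\<Sum>\<^sub>\<infinity>\<sigma>. sem k I f \<sigma> - unroll f \<sigma>) \<le> 0"
        by (simp add: infsum_diff mass_def)
      then have "sem k I f \<sigma> - unroll f \<sigma> = 0" for \<sigma>
        by (rule nonneg_infsum_le_0D) (use le s in \<open>auto intro: summable_on_diff\<close>)
      then show "unroll f = sem k I f" by (simp add: fun_eq_iff)
    qed
    then show "denotation k (WhileLess x n P) = denotation k I"
      by (simp add: W restrict_def fun_eq_iff) (simp add: denotation_def)
  qed
qed

end

section \<open>Linear systems, and polynomials in the shift acting on sequences\<close>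

text \<open>Gaussian elimination with one pivot per equation. The field is arbitrary because the
  unknowns are real when a recurrence is sought and rational when a rational annihilator is
  sought.\<close>

lemma homogeneous_system:
  fixes M :: "'s \<Rightarrow> 'i \<Rightarrow> 'a :: field"
  assumes "finite S" "finite I" "card S < card I"
  shows "\<exists>y. (\<exists>i\<in>I. y i \<noteq> 0) \<and> (\<forall>s\<in>S. (\<Sum>i\<in>I. y i * M s i) = 0)"
  using assms
proof (induction S arbitrary: I M rule: finite_induct)
  case empty
  then obtain i where "i \<in> I" by (metis card.empty less_nat_zero_code subset_empty subsetI)
  then show ?case by (intro exI[of _ "\<lambda>_. 1"]) auto
next
  case (insert s S)
  show ?case
  proof (cases "\<forall>i\<in>I. M s i = 0")
    case True
    have "card S < card I" using insert by simp
    then obtain y where "\<exists>i\<in>I. y i \<noteq> 0" "\<forall>s\<in>S. (\<Sum>i\<in>I. y i * M s i) = 0"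
      using insert.IH[of I M] insert.prems by blast
    with True show ?thesis by (intro exI[of _ y]) auto
  next
    case False
    then obtain i0 where i0: "i0 \<in> I" "M s i0 \<noteq> 0" by blast
    let ?I = "I - {i0}"
    have "card S < card ?I" using insert i0 by auto
    then obtain y where y: "\<exists>i\<in>?I. y i \<noteq> 0"
        "\<forall>s'\<in>S. (\<Sum>i\<in>?I. y i * (M s' i - M s' i0 * M s i / M s i0)) = 0"
      using insert.IH[of ?I "\<lambda>s' i. M s' i - M s' i0 * M s i / M s i0"] insert.prems by blast
    \<comment> \<open>The pivot equation is solved for the unknown \<open>i0\<close>, which was
      eliminated from the other equations before the induction hypothesis was applied.\<close>
    define c where "c = - (\<Sum>i\<in>?I. y i * M s i) / M s i0"
    define z where "z = y(i0 := c)"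
    have sum: "(\<Sum>i\<in>I. z i * M s' i) = c * M s' i0 + (\<Sum>i\<in>?I. y i * M s' i)" for s'
    proof -
      have "(\<Sum>i\<in>?I. z i * M s' i) = (\<Sum>i\<in>?I. y i * M s' i)"
        by (rule sum.cong) (auto simp: z_def)
      then show ?thesis using sum.remove[OF insert.prems(1) i0(1), of "\<lambda>i. z i * M s' i"] by (simp add: z_def)
    qed
    have "(\<Sum>i\<in>I. z i * M s' i) = 0" if "s' \<in> S" for s'
    proof -
      have "0 = (\<Sum>i\<in>?I. y i * (M s' i - M s' i0 * M s i / M s i0))" using y(2) that by simp
      also have "\<dots> = (\<Sum>i\<in>?I. y i * M s' i) - (\<Sum>i\<in>?I. y i * M s i) * M s' i0 / M s i0"
      proof -
        have "(\<Sum>i\<in>?I. y i * (M s' i0 * M s i / M s i0)) = (\<Sum>i\<in>?I. y i * M s i) * M s' i0 / M s i0"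
          unfolding sum_distrib_right sum_divide_distrib by (rule sum.cong) auto
        then show ?thesis by (simp only: right_diff_distrib sum_subtractf)
      qed
      finally show ?thesis unfolding sum c_def by simp
    qed
    moreover have "(\<Sum>i\<in>I. z i * M s i) = 0" unfolding sum c_def using i0(2) by simp
    moreover have "\<exists>i\<in>I. z i \<noteq> 0" using y(1) by (auto simp: z_def)
    ultimately show ?thesis by (intro exI[of _ z]) auto
  qed
qed

text \<open>\<open>act p F\<close> is \<open>p(S) F\<close> for the shift \<open>S\<close>.
  Sequences become a module over the polynomials, with \<open>act_mult\<close> as its associativity
  law.\<close>

definition act :: "'a :: comm_semiring_0 poly \<Rightarrow> (nat \<Rightarrow> 'a) \<Rightarrow> nat \<Rightarrow> 'a" where
  "act p F n = (\<Sum>i\<le>degree p. coeff p i * F (n + i))"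

lemma act_alt: "degree p \<le> N \<Longrightarrow> act p F n = (\<Sum>i\<le>N. coeff p i * F (n + i))"
  unfolding act_def by (rule sum.mono_neutral_left) (auto simp: coeff_eq_0)

lemma act_alt_less: "degree p < N \<Longrightarrow> act p F n = (\<Sum>i<N. coeff p i * F (n + i))"
  using act_alt[of p "N - 1" F n] by (cases N) (auto simp: lessThan_Suc_atMost)

lemma act_0 [simp]: "act 0 F n = 0" by (simp add: act_def)

lemma act_1 [simp]: "act 1 F n = F n"
  by (simp add: act_def)

lemma act_pCons: "act (pCons a p) F n = a * F n + act p F (Suc n)"
proof -
  have "act (pCons a p) F n = (\<Sum>i\<le>Suc (degree p). coeff (pCons a p) i * F (n + i))"
    by (rule act_alt) (rule degree_pCons_le)
  also have "\<dots> = a * F n + (\<Sum>i\<le>degree p. coeff p i * F (Suc n + i))"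
    by (subst sum.atMost_Suc_shift) simp
  finally show ?thesis by (simp add: act_def)
qed

lemma act_add: "act (p + q) F n = act p F n + act q F n"
proof -
  let ?N = "max (degree p) (degree q)"
  show ?thesis
    using act_alt[of p ?N F n] act_alt[of q ?N F n] act_alt[of "p + q" ?N F n] degree_add_le_max[of p q]
    by (simp add: sum.distrib distrib_right)
qed

lemma act_smult: "act (smult c p) F n = c * act p F n"
  by (subst act_alt[of _ "degree p"]) (auto simp: act_def sum_distrib_left mult.assoc degree_smult_le)

lemma act_mult: "act (p * q) F n = act p (act q F) n"
  by (induction p arbitrary: n) (simp_all add: act_pCons act_add act_smult mult_pCons_left)

lemma act_zero_seq [simp]: "act p (\<lambda>n. 0) n = 0"
  by (simp add: act_def)

lemma act_linear: "act p (\<lambda>n. c * F n + G n) n = c * act p F n + act p G n"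
  unfolding act_def by (simp add: sum.distrib sum_distrib_left distrib_left mult_ac)

lemma act_diff: "act p (\<lambda>n. F n - G n) n = act p F n - act p G n" for p :: "'a :: comm_ring poly"
  unfolding act_def by (simp add: sum_subtractf right_diff_distrib)

section \<open>Power series in the shift, acting on bounded sequences\<close>

definition sbounded :: "(nat \<Rightarrow> real) \<Rightarrow> bool" where
  "sbounded F \<longleftrightarrow> (\<exists>B. \<forall>n. \<bar>F n\<bar> \<le> B)"

lemma sbounded_linear: "sbounded F \<Longrightarrow> sbounded G \<Longrightarrow> sbounded (\<lambda>n. c * F n + G n)"
proof -
  assume "sbounded F" "sbounded G"
  then obtain B C where bc: "\<And>n. \<bar>F n\<bar> \<le> B" "\<And>n. \<bar>G n\<bar> \<le> C" unfolding sbounded_def by blast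
  have "\<bar>c * F n + G n\<bar> \<le> \<bar>c\<bar> * B + C" for n
  proof -
    have "\<bar>c * F n + G n\<bar> \<le> \<bar>c\<bar> * \<bar>F n\<bar> + \<bar>G n\<bar>"
      using abs_triangle_ineq[of "c * F n" "G n"] by (simp add: abs_mult)
    also have "\<dots> \<le> \<bar>c\<bar> * B + C"
      by (intro add_mono mult_left_mono bc) auto
    finally show ?thesis .
  qed
  then show ?thesis unfolding sbounded_def by blast
qed

lemma sbounded_shift: "sbounded F \<Longrightarrow> sbounded (\<lambda>n. F (n + i))"
  unfolding sbounded_def by blast

lemma sbounded_const: "sbounded (\<lambda>n. c)"
  unfolding sbounded_def by auto

lemma sbounded_diff: "sbounded F \<Longrightarrow> sbounded G \<Longrightarrow> sbounded (\<lambda>n. F n - G n)"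
  using sbounded_linear[of G F "-1"] by (simp only: mult_minus1 uminus_add_conv_diff)

lemma sbounded_act: "sbounded F \<Longrightarrow> sbounded (act p F)"
proof (induction p)
  case 0
  have "act 0 F = (\<lambda>n. 0)" by auto
  then show ?case using sbounded_const[of 0] by simp
next
  case (pCons a p)
  have "sbounded (\<lambda>n. a * F n + act p F (n + 1))"
    by (rule sbounded_linear[OF pCons.prems sbounded_shift[OF pCons.IH[OF pCons.prems]]])
  moreover have "act (pCons a p) F = (\<lambda>n. a * F n + act p F (n + 1))"
    by (rule ext) (simp add: act_pCons)
  ultimately show ?case by simp
qed

text \<open>Multiplying \<open>D\<close> by the denominator \<open>q\<close> produces coefficients
  of both signs, which leaves the sub-distributions; absolute summability is kept.\<close>

definition abs_sum :: "real fps \<Rightarrow> bool" where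
  "abs_sum D \<longleftrightarrow> (\<lambda>j. \<bar>fps_nth D j\<bar>) summable_on UNIV"

text \<open>This is \<open>D(S) F\<close>, a weighted sum of later terms that converges for bounded
  \<open>F\<close>.\<close>

definition shift_series :: "real fps \<Rightarrow> (nat \<Rightarrow> real) \<Rightarrow> nat \<Rightarrow> real" where
  "shift_series D F n = (\<Sum>\<^sub>\<infinity>j. fps_nth D j * F (n + j))"

lemma abs_sum_subprob: "subprob D \<Longrightarrow> abs_sum D"
  by (simp add: subprob_def abs_sum_def)

lemma shift_series_summable:
  assumes "abs_sum D" "sbounded F"
  shows "(\<lambda>j. fps_nth D j * F (n + j)) summable_on UNIV"
proof -
  obtain B where B: "\<And>n. \<bar>F n\<bar> \<le> B" using assms(2) unfolding sbounded_def by blast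
  have "(\<lambda>j. \<bar>fps_nth D j\<bar> * B) summable_on UNIV"
    using assms(1) unfolding abs_sum_def by (rule summable_on_cmult_left)
  then show ?thesis
    by (rule summable_on_abs_le) (auto simp: abs_mult intro: mult_left_mono B)
qed

lemma shift_series_linear:
  assumes "abs_sum D" "sbounded F" "sbounded G"
  shows "shift_series D (\<lambda>n. c * F n + G n) n = c * shift_series D F n + shift_series D G n"
proof -
  have "shift_series D (\<lambda>n. c * F n + G n) n
      = (\<Sum>\<^sub>\<infinity>j. c * (fps_nth D j * F (n + j)) + fps_nth D j * G (n + j))"
    unfolding shift_series_def by (rule infsum_cong) (simp add: algebra_simps)
  also have "\<dots> = (\<Sum>\<^sub>\<infinity>j. c * (fps_nth D j * F (n + j))) + shift_series D G n"
    unfolding shift_series_def by (intro infsum_add summable_on_cmult_right shift_series_summable assms)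
  finally show ?thesis by (simp add: shift_series_def infsum_cmult_right')
qed

lemma shift_series_abs_le:
  assumes "subprob D" "\<And>n. \<bar>F n\<bar> \<le> B" "0 \<le> B"
  shows "\<bar>shift_series D F n\<bar> \<le> B"
proof -
  have "\<bar>shift_series D F n\<bar> \<le> (\<Sum>\<^sub>\<infinity>j. fps_nth D j * B)"
    unfolding shift_series_def
    by (rule abs_infsum_le) (use assms in \<open>auto simp: subprob_def abs_mult intro: summable_on_cmult_left mult_left_mono\<close>)
  also have "\<dots> = infsum (fps_nth D) UNIV * B"
    by (rule infsum_cmult_left) (use assms in \<open>simp add: subprob_def\<close>)
  also have "\<dots> \<le> B" using assms(1,3) by (intro mult_left_le_one_le) (auto simp: subprob_def infsum_nonneg)
  finally show ?thesis .
qed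

lemma sbounded_shift_series: "subprob D \<Longrightarrow> sbounded F \<Longrightarrow> sbounded (shift_series D F)"
  unfolding sbounded_def by (meson shift_series_abs_le abs_ge_zero order_trans)

lemma act_shift_series_commute:
  assumes "abs_sum D" "sbounded F"
  shows "act p (shift_series D F) n = shift_series D (act p F) n"
proof (induction p arbitrary: n)
  case 0
  show ?case by (simp add: shift_series_def)
next
  case (pCons a p)
  have seq: "act (pCons a p) F = (\<lambda>n. a * F n + act p F (n + 1))"
    by (rule ext) (simp add: act_pCons)
  have "shift_series D (act (pCons a p) F) n = a * shift_series D F n + shift_series D (\<lambda>n. act p F (n + 1)) n"
    unfolding seq
    using shift_series_linear[OF assms sbounded_shift[OF sbounded_act[OF assms(2)]], of a p 1 n] by simp
  also have "shift_series D (\<lambda>n. act p F (n + 1)) n = shift_series D (act p F) (Suc n)"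
    by (simp add: shift_series_def add_ac)
  finally show ?case by (simp add: act_pCons pCons)
qed

lemma shift_series_1 [simp]: "shift_series 1 F n = F n"
  using infsum_fps_one[of "\<lambda>j. F (n + j)"] by (simp add: shift_series_def del: fps_one_nth)

lemma infsum_Suc_shift: "g 0 = 0 \<Longrightarrow> (\<Sum>\<^sub>\<infinity>j. g j) = (\<Sum>\<^sub>\<infinity>j. g (Suc j))" for g :: "nat \<Rightarrow> real"
proof -
  assume "g 0 = 0"
  then have "infsum g UNIV = infsum g (range Suc)"
    by (intro infsum_cong_neutral) (auto, metis not0_implies_Suc rangeI)
  also have "\<dots> = infsum (\<lambda>j. g (Suc j)) UNIV" by (subst infsum_reindex) (auto simp: o_def)
  finally show ?thesis .
qed

lemma shift_series_X_mult: "shift_series (fps_X * D) F n = shift_series D F (Suc n)"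
proof -
  have "shift_series (fps_X * D) F n = (\<Sum>\<^sub>\<infinity>j. fps_nth (fps_X * D) (Suc j) * F (n + Suc j))"
    unfolding shift_series_def by (rule infsum_Suc_shift) simp
  then show ?thesis by (simp add: shift_series_def)
qed

lemma abs_sum_X_mult: "abs_sum D \<Longrightarrow> abs_sum (fps_X * D)"
proof -
  assume "abs_sum D"
  then have "(\<lambda>j. \<bar>fps_nth (fps_X * D) (Suc j)\<bar>) summable_on UNIV" by (simp add: abs_sum_def)
  then have "(\<lambda>j. \<bar>fps_nth (fps_X * D) j\<bar>) summable_on range Suc"
    using summable_on_reindex[of Suc UNIV "\<lambda>j. \<bar>fps_nth (fps_X * D) j\<bar>"] by (simp add: o_def)
  moreover have "(\<lambda>j. \<bar>fps_nth (fps_X * D) j\<bar>) summable_on {0}" by simp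
  ultimately have "(\<lambda>j. \<bar>fps_nth (fps_X * D) j\<bar>) summable_on (range Suc \<union> {0})"
    by (rule summable_on_Un_disjoint) auto
  moreover have "range Suc \<union> {0} = UNIV" using not0_implies_Suc by blast
  ultimately show ?thesis by (simp add: abs_sum_def)
qed

lemma shift_series_poly_mult:
  assumes "abs_sum D" "sbounded F"
  shows "abs_sum (fps_of_poly q * D) \<and> (\<forall>n. shift_series (fps_of_poly q * D) F n = act q (shift_series D F) n)"
proof (induction q)
  case 0
  show ?case by (simp add: abs_sum_def shift_series_def)
next
  case (pCons a q)
  let ?E = "fps_of_poly q * D"
  have eq: "fps_of_poly (pCons a q) * D = fps_const a * D + fps_X * ?E"
    by (simp add: fps_of_poly_pCons algebra_simps)
  have 1: "abs_sum (fps_const a * D)"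
    using summable_on_cmult_right[OF assms(1)[unfolded abs_sum_def], of "\<bar>a\<bar>"] by (simp add: abs_sum_def abs_mult)
  have 2: "abs_sum (fps_X * ?E)" using abs_sum_X_mult pCons by blast
  have "abs_sum (fps_const a * D + fps_X * ?E)"
    unfolding abs_sum_def
    by (rule summable_on_comparison_test[OF summable_on_add[OF 1[unfolded abs_sum_def] 2[unfolded abs_sum_def]]])
      (simp_all add: abs_triangle_ineq del: fps_mult_left_const_nth fps_X_mult_nth)
  moreover have "shift_series (fps_const a * D + fps_X * ?E) F n = act (pCons a q) (shift_series D F) n" for n
  proof -
    have "shift_series (fps_const a * D + fps_X * ?E) F n = shift_series (fps_const a * D) F n + shift_series (fps_X * ?E) F n"
      unfolding shift_series_def fps_add_nth distrib_right
      by (intro infsum_add shift_series_summable 1 2 assms(2))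
    also have "shift_series (fps_const a * D) F n = a * shift_series D F n"
      by (simp add: shift_series_def mult.assoc infsum_cmult_right')
    finally show ?thesis using pCons by (simp add: shift_series_X_mult act_pCons)
  qed
  ultimately show ?case unfolding eq by blast
qed

text \<open>From \<open>(q D)(S) = q(S) D(S)\<close> and \<open>q D = p\<close>: the infinite sums
  \<open>D(S) F\<close> satisfy a finite linear recurrence with right-hand side
  \<open>p(S) F\<close>.\<close>

lemma act_shift_series:
  assumes "abs_sum D" "sbounded F" "fps_of_poly q * D = fps_of_poly p"
  shows "act q (shift_series D F) n = act p F n"
proof -
  have "abs_sum 1" using abs_sum_subprob[OF subprob_1] .
  then show ?thesis
    using shift_series_poly_mult[OF assms(1,2), of q] shift_series_poly_mult[OF _ assms(2), of 1 p] assms(3)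
    by (simp add: shift_series_1[abs_def])
qed

lemma act_injective:
  assumes D: "subprob D" "fps_of_poly q * D = fps_of_poly p" and ab: "a * p + b * q = 1"
    and F: "sbounded F" and z: "\<And>n. act q F n = 0"
  shows "F n = 0"
proof -
  have z': "act q F = (\<lambda>n. 0)" using z by auto
  \<comment> \<open>\<open>p(S) F\<close> equals \<open>q(S) D(S) F\<close>; moving
    \<open>q(S)\<close> past \<open>D(S)\<close> makes it \<open>D(S)\<close> of the zero
    sequence.\<close>
  have "act p F n = 0" for n
    using act_shift_series[OF abs_sum_subprob[OF D(1)] F D(2), of n] act_shift_series_commute[OF abs_sum_subprob[OF D(1)] F, of q n]
    by (simp add: z' shift_series_def)
  then have p: "act p F = (\<lambda>n. 0)" by auto
  have "F n = act (a * p + b * q) F n" by (simp add: ab)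
  then show ?thesis by (simp add: act_add act_mult p z')
qed

text \<open>Soundness of draw certificates rests on this: a bounded sequence that satisfies the
  recurrence of \<open>D(S) F\<close> is \<open>D(S) F\<close>, however it was found.\<close>

lemma shift_series_unique:
  assumes D: "subprob D" "fps_of_poly q * D = fps_of_poly p" and ab: "a * p + b * q = 1"
    and F: "sbounded F" and H: "sbounded H" "\<And>n. act q H n = act p F n"
  shows "H n = shift_series D F n"
proof -
  have "H n - shift_series D F n = 0"
  proof (rule act_injective[OF D ab])
    show "sbounded (\<lambda>n. H n - shift_series D F n)" by (intro sbounded_diff sbounded_shift_series D F H)
    show "act q (\<lambda>n. H n - shift_series D F n) n = 0" for n
      using act_shift_series[OF abs_sum_subprob[OF D(1)] F D(2)] H(2) by (simp add: act_diff)
  qed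
  then show ?thesis by simp
qed

subsection \<open>Sequences in finite-dimensional shift-invariant spaces\<close>

text \<open>
  Members of a shift-invariant space of dimension at most \<open>d\<close> have this property, by
  linear dependence of \<open>d + 1\<close> successive shifts.
\<close>

definition determined :: "nat \<Rightarrow> (nat \<Rightarrow> real) \<Rightarrow> bool" where
  "determined d F \<longleftrightarrow> (\<forall>r. (\<forall>n<d. act r F n = 0) \<longrightarrow> (\<forall>n. act r F n = 0))"

text \<open>The shift acts on the vector \<open>G\<close> as the matrix \<open>A\<close>, so
  shifting the functional \<open>\<alpha>\<close> gives the functionals \<open>\<beta> i\<close> in
  a space of dimension at most \<open>d\<close>. Among \<open>d + 1\<close> of them there is a
  linear relation, that is, a recurrence along which \<open>d\<close> initial zeros
  propagate.\<close>

lemma shift_family_vanishes: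
  fixes G :: "'w \<Rightarrow> nat \<Rightarrow> real"
  assumes J: "finite J" "card J \<le> d"
    and G: "\<And>w n. w \<in> J \<Longrightarrow> G w (Suc n) = (\<Sum>w'\<in>J. A w w' * G w' n)"
    and z: "\<And>n. n < d \<Longrightarrow> (\<Sum>w\<in>J. \<alpha> w * G w n) = 0"
  shows "(\<Sum>w\<in>J. \<alpha> w * G w n) = 0"
proof -
  let ?H = "\<lambda>n. \<Sum>w\<in>J. \<alpha> w * G w n"
  define \<beta> where "\<beta> i = ((\<lambda>b w'. \<Sum>w\<in>J. b w * A w w') ^^ i) \<alpha>" for i
  have \<beta>: "?H (n + i) = (\<Sum>w\<in>J. \<beta> i w * G w n)" for n i
  proof (induction i arbitrary: n)
    case (Suc i)
    have "?H (n + Suc i) = (\<Sum>w\<in>J. \<beta> i w * G w (Suc n))" using Suc[of "Suc n"] by simp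
    also have "\<dots> = (\<Sum>w\<in>J. \<Sum>w'\<in>J. \<beta> i w * A w w' * G w' n)"
      by (simp add: G sum_distrib_left mult.assoc)
    also have "\<dots> = (\<Sum>w'\<in>J. (\<Sum>w\<in>J. \<beta> i w * A w w') * G w' n)"
      by (subst sum.swap) (simp add: sum_distrib_right)
    finally show ?case by (simp add: \<beta>_def)
  qed (simp add: \<beta>_def)
  obtain y where y: "\<exists>i\<in>{..d}. y i \<noteq> 0" "\<forall>w\<in>J. (\<Sum>i\<in>{..d}. y i * \<beta> i w) = 0"
    using homogeneous_system[of J "{..d}" "\<lambda>w i. \<beta> i w"] J by auto
  \<comment> \<open>With \<open>j\<close> the last index of a nonzero coefficient, the relation can
    be solved for its latest term.\<close>
  define j where "j = Max {i. i \<le> d \<and> y i \<noteq> 0}"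
  have fin: "finite {i. i \<le> d \<and> y i \<noteq> 0}" "{i. i \<le> d \<and> y i \<noteq> 0} \<noteq> {}" using y(1) by auto
  have j: "j \<le> d" "y j \<noteq> 0" using Max_in[OF fin] by (auto simp: j_def)
  have top: "y i = 0" if "i \<le> d" "j < i" for i
    using Max_ge[OF fin(1), of i] that unfolding j_def[symmetric] by auto
  have rec: "(\<Sum>i\<le>j. y i * ?H (n + i)) = 0" for n
  proof -
    have "(\<Sum>i\<le>j. y i * ?H (n + i)) = (\<Sum>i\<le>d. y i * ?H (n + i))"
      by (rule sum.mono_neutral_left) (use j top in auto)
    also have "\<dots> = (\<Sum>w\<in>J. (\<Sum>i\<in>{..d}. y i * \<beta> i w) * G w n)"
      unfolding \<beta> sum_distrib_left sum_distrib_right by (subst sum.swap) (simp add: mult.assoc)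
    also have "\<dots> = 0" using y(2) by simp
    finally show ?thesis .
  qed
  show "?H n = 0"
  proof (induction n rule: less_induct)
    case (less n)
    show ?case
    proof (cases "n < d")
      case False
      then have "y j * ?H n + (\<Sum>i<j. y i * ?H (n - j + i)) = 0"
        using rec[of "n - j"] j(1) by (simp add: lessThan_Suc_atMost[symmetric] add.commute)
      moreover have "(\<Sum>i<j. y i * ?H (n - j + i)) = 0"
        by (rule sum.neutral) (use less False j(1) in auto)
      ultimately show ?thesis using j(2) by simp
    qed (rule z)
  qed
qed

lemma determined_shift_family:
  fixes G :: "'w \<Rightarrow> nat \<Rightarrow> real"
  assumes J: "finite J" "card J \<le> d"
    and G: "\<And>w n. w \<in> J \<Longrightarrow> G w (Suc n) = (\<Sum>w'\<in>J. A w w' * G w' n)"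
    and F: "\<And>n. F n = (\<Sum>w\<in>J. \<alpha> w * G w n)"
  shows "determined d F"
  unfolding determined_def
proof (intro allI impI)
  fix r n assume z: "\<forall>n<d. act r F n = 0"
  \<comment> \<open>Applying \<open>r(S)\<close> stays within the span of the family, so the
    preceding lemma applies with other coefficients.\<close>
  have ex: "\<exists>\<beta>. \<forall>n. act r F n = (\<Sum>w\<in>J. \<beta> w * G w n)"
  proof (induction r)
    case 0
    show ?case by (intro exI[of _ "\<lambda>_. 0"]) simp
  next
    case (pCons a r)
    then obtain \<beta> where \<beta>: "\<And>n. act r F n = (\<Sum>w\<in>J. \<beta> w * G w n)" by blast
    have "act (pCons a r) F n = (\<Sum>w\<in>J. (a * \<alpha> w + (\<Sum>w'\<in>J. \<beta> w' * A w' w)) * G w n)" for n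
    proof -
      have "act r F (Suc n) = (\<Sum>w'\<in>J. \<Sum>w\<in>J. \<beta> w' * A w' w * G w n)"
        by (simp add: \<beta> G sum_distrib_left mult.assoc)
      also have "\<dots> = (\<Sum>w\<in>J. (\<Sum>w'\<in>J. \<beta> w' * A w' w) * G w n)"
        by (subst sum.swap) (simp add: sum_distrib_right)
      finally show ?thesis
        by (simp add: act_pCons F sum_distrib_left sum.distrib distrib_right mult.assoc)
    qed
    then show ?case by (intro exI[of _ "\<lambda>w. a * \<alpha> w + (\<Sum>w'\<in>J. \<beta> w' * A w' w)"] allI)
  qed
  then obtain \<beta> where \<beta>: "\<And>n. act r F n = (\<Sum>w\<in>J. \<beta> w * G w n)" by blast
  show "act r F n = 0"
    unfolding \<beta> by (rule shift_family_vanishes[where J = J and d = d and A = A and G = G, OF J G]) (use z \<beta> in auto)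
qed

lemma determined_eq:
  assumes "determined d F" "\<And>n. n < d \<Longrightarrow> act p F n = act q F n"
  shows "act p F n = act q F n"
proof -
  have diff: "act (p + smult (-1) q) F n = act p F n - act q F n" for n
    unfolding act_add act_smult by simp
  have "\<forall>n<d. act (p + smult (-1) q) F n = 0" unfolding diff using assms(2) by simp
  then have "act (p + smult (-1) q) F n = 0" using assms(1) unfolding determined_def by blast
  then show ?thesis unfolding diff by simp
qed

subsection \<open>Reduced fractions\<close>

text \<open>Fractions are reduced over the rationals, because certificates consist of rational
  numbers, and are used over the reals, where the sequences live.\<close>

abbreviation rp :: "rat poly \<Rightarrow> real poly" where "rp \<equiv> map_poly real_of_rat"

lemma coeff_rp [simp]: "coeff (rp p) i = of_rat (coeff p i)"
  by (simp add: coeff_map_poly)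

lemma rp_mult: "rp (p * q) = rp p * rp q"
  by (rule poly_eqI) (simp add: coeff_mult of_rat_sum of_rat_mult)

lemma rp_add: "rp (p + q) = rp p + rp q"
  by (rule poly_eqI) (simp add: of_rat_add)

lemma rp_1 [simp]: "rp 1 = 1"
  by (rule poly_eqI) simp

lemma rp_of_int: "rp (map_poly of_int p) = map_poly of_int p"
  by (rule poly_eqI) (simp add: coeff_map_poly)

lemma degree_rp [simp]: "degree (rp p) = degree p"
  by (rule degree_map_poly) simp

text \<open>A nonzero constant coefficient makes the given denominator a unit among power series.
  Hence \<open>Q D = P\<close>, and cancelling \<open>Q\<close> transfers this to every pair with
  the same cross product.\<close>

lemma dist_fps_fraction:
  assumes v: "valid_dist (Ratio p q)" and eq: "p' * map_poly of_int q = map_poly of_int p * q'"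
  shows "fps_of_poly q' * dist_fps (Ratio p q) = fps_of_poly p'"
proof -
  let ?P = "fps_of_poly (map_poly real_of_int p)" and ?Q = "fps_of_poly (map_poly real_of_int q)"
  have Q0: "fps_nth ?Q 0 \<noteq> 0" using v by (simp add: coeff_map_poly)
  then have "?Q dvd ?P" by (metis dvd_trans fps_is_unit_iff one_dvd unit_imp_dvd)
  then have "?Q * dist_fps (Ratio p q) = ?P" by simp
  then have "?Q * (fps_of_poly q' * dist_fps (Ratio p q)) = fps_of_poly (map_poly of_int p * q')"
    by (simp add: fps_of_poly_mult mult_ac)
  also have "\<dots> = ?Q * fps_of_poly p'" unfolding eq[symmetric] by (simp add: fps_of_poly_mult mult_ac)
  finally show ?thesis using Q0 by (metis fps_zero_nth mult_left_cancel)
qed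

lemma reduced_fraction:
  assumes v: "valid_dist (Ratio p q)"
  obtains p' q' a b :: "rat poly"
  where "p' * map_poly of_int q = map_poly of_int p * q'" "a * p' + b * q' = 1"
    "degree p' \<le> degree p" "degree q' \<le> degree q"
proof -
  define P Q :: "rat poly" where "P = map_poly of_int p" and "Q = map_poly of_int q"
  define g where "g = gcd P Q"
  have Q0: "Q \<noteq> 0" using v by (auto simp: Q_def poly_eq_iff coeff_map_poly)
  then have g0: "g \<noteq> 0" by (simp add: g_def)
  define p' q' where "p' = P div g" and "q' = Q div g"
  have P: "P = p' * g" and Q: "Q = q' * g" by (simp_all add: p'_def q'_def g_def)
  obtain a b where ab: "a * P + b * Q = g"
    using bezout_coefficients_fst_snd[of P Q] by (auto simp: g_def)
  have "(a * p' + b * q') * g = 1 * g" using ab by (simp add: P Q algebra_simps)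
  then have 1: "a * p' + b * q' = 1" using g0 by (metis mult_right_cancel)
  have dP: "degree P \<le> degree p" "degree Q \<le> degree q"
    unfolding P_def Q_def by (rule degree_le, simp add: coeff_map_poly coeff_eq_0)+
  have "degree p' \<le> degree P"
    by (cases "p' = 0") (use g0 in \<open>auto simp: P degree_mult_eq\<close>)
  moreover have "degree q' \<le> degree Q"
    by (cases "q' = 0") (use g0 in \<open>auto simp: Q degree_mult_eq\<close>)
  moreover have "p' * Q = P * q'" by (simp add: P Q mult_ac)
  ultimately show thesis using that[of p' q' a b] 1 dP unfolding P_def Q_def by auto
qed

text \<open>Completeness of draw certificates. A rational polynomial \<open>\<chi>\<close> of least
  degree that annihilates \<open>F\<close> is coprime to \<open>q\<close>, since \<open>q(S)\<close>
  is injective on bounded sequences. So \<open>q\<close> has an inverse \<open>s\<close> modulo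
  \<open>\<chi>\<close>, and \<open>c = p s\<close> solves the equation.\<close>

lemma rational_solution:
  assumes D: "subprob D" "fps_of_poly (rp q) * D = fps_of_poly (rp p)" and ab: "rp a * rp p + rp b * rp q = 1"
    and F: "sbounded F" "determined d F" "\<And>n. F n \<in> \<rat>"
  obtains c where "\<And>n. act (rp q) (act (rp c) F) n = act (rp p) F n"
proof -
  define K where "K = {\<chi> :: rat poly. \<chi> \<noteq> 0 \<and> (\<forall>n. act (rp \<chi>) F n = 0)}"
  have "\<exists>r. F n = of_rat r" for n using F(3)[of n] by (auto elim: Rats_cases)
  then obtain F' where F': "\<And>n. F n = of_rat (F' n)" by metis
  \<comment> \<open>Rational values admit a rational relation between \<open>d + 1\<close> shifts on
    the first \<open>d\<close> positions; \<open>determined\<close> then extends it to all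
    positions.\<close>
  obtain y where y: "\<exists>i\<in>{..d}. y i \<noteq> 0" "\<forall>s\<in>{..<d}. (\<Sum>i\<in>{..d}. y i * F' (s + i)) = 0"
    using homogeneous_system[of "{..<d}" "{..d}" "\<lambda>s i. F' (s + i)"] by auto
  define \<chi>0 where "\<chi>0 = (\<Sum>i\<le>d. monom (y i) i)"
  have c0: "coeff \<chi>0 i = (if i \<le> d then y i else 0)" for i
    by (auto simp: \<chi>0_def coeff_sum)
  have d0: "degree \<chi>0 \<le> d" by (rule degree_le) (simp add: c0)
  have "act (rp \<chi>0) F s = 0" if "s < d" for s
  proof -
    have "act (rp \<chi>0) F s = of_rat (\<Sum>i\<le>d. y i * F' (s + i))"
      using act_alt[of "rp \<chi>0" d F s] d0 by (simp add: c0 F' of_rat_sum of_rat_mult)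
    then show ?thesis using y(2) that by simp
  qed
  then have "\<forall>n. act (rp \<chi>0) F n = 0" using F(2) unfolding determined_def by blast
  moreover have "\<chi>0 \<noteq> 0" using y(1) c0 by (metis atMost_iff coeff_0)
  ultimately have "\<chi>0 \<in> K" by (simp add: K_def)
  then obtain \<chi> where \<chi>: "\<chi> \<in> K" and min: "\<And>\<chi>'. \<chi>' \<in> K \<Longrightarrow> degree \<chi> \<le> degree \<chi>'"
    using arg_min_natI[of "\<lambda>\<chi>. \<chi> \<in> K" \<chi>0 degree] arg_min_nat_le[of "\<lambda>\<chi>. \<chi> \<in> K" _ degree] by metis
  define g where "g = gcd q \<chi>"
  have \<chi>0: "\<chi> \<noteq> 0" "\<And>n. act (rp \<chi>) F n = 0" using \<chi> by (auto simp: K_def)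
  have g0: "g \<noteq> 0" using \<chi>0(1) by (simp add: g_def)
  obtain q1 \<chi>1 where q1: "q = q1 * g" and \<chi>1: "\<chi> = g * \<chi>1"
    unfolding g_def by (metis dvd_def gcd_dvd1 gcd_dvd2 mult.commute)
  \<comment> \<open>Otherwise the cofactor \<open>\<chi>1\<close> would be an annihilator of smaller
    degree: \<open>q(S)\<close> maps \<open>\<chi>1(S) F\<close> to
    \<open>q1(S) \<chi>(S) F = 0\<close>, and \<open>q(S)\<close> is injective.\<close>
  have "degree g = 0"
  proof (rule ccontr)
    assume dg: "degree g \<noteq> 0"
    have n1: "\<chi>1 \<noteq> 0" using \<chi>0(1) \<chi>1 by auto
    have W: "act (rp \<chi>1) F n = 0" for n
    proof (rule act_injective[OF D ab])
      show "sbounded (act (rp \<chi>1) F)" by (rule sbounded_act[OF F(1)])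
      have "act (rp q) (act (rp \<chi>1) F) n = act (rp q1) (act (rp \<chi>) F) n" for n
        unfolding q1 \<chi>1 rp_mult act_mult[symmetric] by (simp add: mult_ac)
      then show "act (rp q) (act (rp \<chi>1) F) n = 0" for n using \<chi>0(2) by (simp add: act_def)
    qed
    then have "\<chi>1 \<in> K" using n1 by (simp add: K_def)
    from min[OF this] show False using dg g0 n1 by (simp add: \<chi>1 degree_mult_eq)
  qed
  then have "is_unit g" using g0 by (simp add: is_unit_iff_degree)
  then have g1: "g = 1" unfolding g_def by (metis coprime_iff_gcd_eq_1 is_unit_gcd)
  obtain s t where st: "s * q + t * \<chi> = 1"
    using bezout_coefficients_fst_snd[of q \<chi>] g1 by (auto simp: g_def)
  show thesis
  proof (rule that[of "p * s"])
    fix n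
    have "act (rp p) F n = act (rp p) (act (rp (s * q) + rp (t * \<chi>)) F) n"
      by (simp add: rp_add[symmetric] st act_1[abs_def])
    also have "\<dots> = act (rp p) (\<lambda>n. act (rp (s * q)) F n) n"
    proof -
      have "act (rp (s * q) + rp (t * \<chi>)) F n = act (rp (s * q)) F n" for n
        unfolding act_add rp_mult act_mult using \<chi>0(2) by (simp add: act_def)
      then show ?thesis by (simp add: act_def)
    qed
    also have "\<dots> = act (rp q) (act (rp (p * s)) F) n"
      by (simp add: rp_mult act_mult[symmetric] mult_ac)
    finally show "act (rp q) (act (rp (p * s)) F) n = act (rp p) F n" by simp
  qed
qed

subsection \<open>Matrices\<close>

text \<open>The adjugate inverts a matrix up to its determinant without leaving polynomials, which
  keeps degrees explicit. The last clause turns a zero of the determinant into a kernel vector, the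
  form in which such zeros are excluded later.\<close>

lemma adjugate_family:
  fixes Q :: "'a \<Rightarrow> 'a \<Rightarrow> real poly"
  assumes J: "finite J" and Q: "\<And>v w. v \<in> J \<Longrightarrow> w \<in> J \<Longrightarrow> degree (Q v w) \<le> m"
  shows "\<exists>R \<Delta>. degree \<Delta> \<le> m * card J \<and>
    (\<forall>v\<in>J. \<forall>w\<in>J. degree (R v w) \<le> m * (card J - 1)) \<and>
    (\<forall>v\<in>J. \<forall>w\<in>J. (\<Sum>u\<in>J. R v u * Q u w) = (if v = w then \<Delta> else 0)) \<and>
    (\<forall>t. poly \<Delta> t = 0 \<longrightarrow> (\<exists>\<xi>. (\<exists>w\<in>J. \<xi> w \<noteq> 0) \<and> (\<forall>v\<in>J. (\<Sum>w\<in>J. poly (Q v w) t * \<xi> w) = 0)))"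
proof -
  let ?n = "card J"
  obtain f where f: "bij_betw f {0..<?n} J" using ex_bij_betw_nat_finite[OF J] by blast
  define g where "g = the_inv_into {0..<?n} f"
  have g: "g v < ?n" "f (g v) = v" if "v \<in> J" for v
    using that f the_inv_into_into[of f "{0..<?n}" v "{0..<?n}"] f_the_inv_into_f[of f "{0..<?n}" v]
    by (auto simp: g_def bij_betw_def)
  have fJ: "f i \<in> J" and gf: "g (f i) = i" if "i < ?n" for i
    using that f the_inv_into_f_f[of f "{0..<?n}" i] by (auto simp: g_def bij_betw_def)
  have sumJ: "(\<Sum>w\<in>J. h w) = (\<Sum>i = 0..<?n. h (f i))" for h :: "'a \<Rightarrow> 'b :: comm_monoid_add"
    using sum.reindex_bij_betw[OF f, of h] by simp
  define A where "A = mat ?n ?n (\<lambda>(i, j). Q (f i) (f j))"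
  have A: "A \<in> carrier_mat ?n ?n" by (simp add: A_def)
  define \<Delta> where "\<Delta> = det A"
  define R where "R v w = adj_mat A $$ (g v, g w)" for v w
  have "degree \<Delta> \<le> m * ?n"
    unfolding \<Delta>_def by (rule degree_det_le[OF _ A]) (simp add: A_def Q fJ)
  moreover have "degree (R v w) \<le> m * (?n - 1)" if "v \<in> J" "w \<in> J" for v w
  proof -
    have "R v w = cofactor A (g w) (g v)" using g that A by (simp add: R_def adj_mat_def)
    also have "\<dots> = (-1) ^ (g w + g v) * det (mat_delete A (g w) (g v))" by (simp add: cofactor_def)
    finally have eq: "R v w = (-1) ^ (g w + g v) * det (mat_delete A (g w) (g v))" .
    have "degree (det (mat_delete A (g w) (g v))) \<le> m * (?n - 1)"
    proof (rule degree_det_le)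
      show "mat_delete A (g w) (g v) \<in> carrier_mat (?n - 1) (?n - 1)" using A by (rule mat_delete_carrier)
      show "degree (mat_delete A (g w) (g v) $$ (i, j)) \<le> m" if "i < ?n - 1" "j < ?n - 1" for i j
        using that A by (simp add: mat_delete_def A_def Q fJ)
    qed
    moreover have "degree ((-1 :: real poly) ^ n * p) = degree p" for n p
      by (cases "even n") auto
    ultimately show ?thesis unfolding eq by simp
  qed
  moreover have "(\<Sum>u\<in>J. R v u * Q u w) = (if v = w then \<Delta> else 0)" if "v \<in> J" "w \<in> J" for v w
  proof -
    have "(\<Sum>u\<in>J. R v u * Q u w) = (\<Sum>i = 0..<?n. adj_mat A $$ (g v, i) * A $$ (i, g w))"
      unfolding sumJ by (rule sum.cong) (auto simp: R_def A_def gf g that)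
    also have "\<dots> = (adj_mat A * A) $$ (g v, g w)"
      using adj_mat(1)[OF A] A g that by (simp add: times_mat_def scalar_prod_def)
    also have "\<dots> = (det A \<cdot>\<^sub>m 1\<^sub>m ?n) $$ (g v, g w)" by (simp add: adj_mat(3)[OF A])
    also have "\<dots> = (if g v = g w then \<Delta> else 0)" using g that by (simp add: \<Delta>_def)
    finally show ?thesis using g that by metis
  qed
  moreover have "\<exists>\<xi>. (\<exists>w\<in>J. \<xi> w \<noteq> 0) \<and> (\<forall>v\<in>J. (\<Sum>w\<in>J. poly (Q v w) t * \<xi> w) = 0)" if "poly \<Delta> t = 0" for t
  proof -
    interpret h: comm_ring_hom "\<lambda>p. poly p t" by unfold_locales auto
    let ?B = "map_mat (\<lambda>p. poly p t) A"
    have B: "?B \<in> carrier_mat ?n ?n" using A by simp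
    have "det ?B = 0" using that by (simp add: \<Delta>_def h.hom_det)
    then obtain x where x: "x \<in> carrier_vec ?n" "x \<noteq> 0\<^sub>v ?n" "?B *\<^sub>v x = 0\<^sub>v ?n"
      using det_0_iff_vec_prod_zero[OF B] by auto
    define \<xi> where "\<xi> v = x $ g v" for v
    obtain i where i: "i < ?n" "x $ i \<noteq> 0" using x(1,2) by (metis carrier_vecD eq_vecI index_zero_vec)
    have "\<exists>w\<in>J. \<xi> w \<noteq> 0" using i fJ gf by (auto simp: \<xi>_def intro!: bexI[of _ "f i"])
    moreover have "(\<Sum>w\<in>J. poly (Q v w) t * \<xi> w) = 0" if "v \<in> J" for v
    proof -
      have "0 = (?B *\<^sub>v x) $ g v" using x(3) g[OF that] by simp
      also have "\<dots> = (\<Sum>i = 0..<?n. poly (Q v (f i)) t * x $ i)"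
        using g[OF that] x(1) A by (simp add: scalar_prod_def A_def)
      also have "\<dots> = (\<Sum>w\<in>J. poly (Q v w) t * \<xi> w)"
        unfolding sumJ by (rule sum.cong) (auto simp: \<xi>_def gf)
      finally show ?thesis by simp
    qed
    ultimately show ?thesis by blast
  qed
  ultimately show ?thesis by (intro exI[of _ R] exI[of _ \<Delta>]) blast
qed

text \<open>\<open>A^n \<xi>\<close> for a real matrix, at one value of the parameter. Its
  polynomial counterpart \<open>matpow\<close> carries the degree bounds.\<close>

primrec matvec :: "('a \<Rightarrow> 'a \<Rightarrow> real) \<Rightarrow> 'a set \<Rightarrow> ('a \<Rightarrow> real) \<Rightarrow> nat \<Rightarrow> 'a \<Rightarrow> real" where
  "matvec A J \<xi> 0 v = \<xi> v"
| "matvec A J \<xi> (Suc n) v = (\<Sum>u\<in>J. A v u * matvec A J \<xi> n u)"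

primrec matpow :: "('a \<Rightarrow> 'a \<Rightarrow> real poly) \<Rightarrow> 'a set \<Rightarrow> nat \<Rightarrow> 'a \<Rightarrow> 'a \<Rightarrow> real poly" where
  "matpow N J 0 v w = (if v = w then 1 else 0)"
| "matpow N J (Suc l) v w = (\<Sum>u\<in>J. N v u * matpow N J l u w)"

lemma degree_matpow:
  assumes "\<And>v w. v \<in> J \<Longrightarrow> w \<in> J \<Longrightarrow> degree (N v w) \<le> m" "v \<in> J" "w \<in> J"
  shows "degree (matpow N J l v w) \<le> l * m"
  using assms(2)
proof (induction l arbitrary: v)
  case (Suc l)
  show ?case unfolding matpow.simps
  proof (cases "finite J")
    case True
    show "degree (\<Sum>u\<in>J. N v u * matpow N J l u w) \<le> Suc l * m"
    proof (rule degree_sum_le[OF True])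
      fix u assume u: "u \<in> J"
      have "degree (N v u * matpow N J l u w) \<le> degree (N v u) + degree (matpow N J l u w)" by (rule degree_mult_le)
      also have "\<dots> \<le> m + l * m" by (intro add_mono assms(1) Suc u)
      finally show "degree (N v u * matpow N J l u w) \<le> Suc l * m" by simp
    qed
  qed simp
qed simp

lemma matpow_matvec:
  assumes "finite J" "poly \<delta> t \<noteq> 0" "v \<in> J"
  shows "(\<Sum>w\<in>J. poly (matpow N J l v w) t * \<xi> w)
    = poly \<delta> t ^ l * matvec (\<lambda>v w. poly (N v w) t / poly \<delta> t) J \<xi> l v"
  using assms(3)
proof (induction l arbitrary: v)
  case 0
  have "(\<Sum>w\<in>J. poly (matpow N J 0 v w) t * \<xi> w) = (\<Sum>w\<in>J. if v = w then \<xi> w else 0)"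
    by (rule sum.cong) auto
  then show ?case using assms(1) 0 by simp
next
  case (Suc l)
  have "(\<Sum>w\<in>J. poly (matpow N J (Suc l) v w) t * \<xi> w) =
      (\<Sum>w\<in>J. \<Sum>u\<in>J. poly (N v u) t * (poly (matpow N J l u w) t * \<xi> w))"
    by (simp add: poly_sum sum_distrib_right mult.assoc)
  also have "\<dots> = (\<Sum>u\<in>J. poly (N v u) t * (\<Sum>w\<in>J. poly (matpow N J l u w) t * \<xi> w))"
    by (subst sum.swap) (simp add: sum_distrib_left)
  also have "\<dots> = (\<Sum>u\<in>J. poly \<delta> t ^ Suc l * (poly (N v u) t / poly \<delta> t * matvec (\<lambda>v w. poly (N v w) t / poly \<delta> t) J \<xi> l u))"
    by (rule sum.cong) (use Suc.IH assms(2) in auto)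
  finally show ?case by (simp add: sum_distrib_left)
qed

text \<open>
  The matrices below have rows of \<open>l\<^sub>1\<close>-norm at most \<open>1\<close>, which makes \<open>D(A)\<close> converge and, for the
  reduced form \<open>p / q\<close> of \<open>D\<close>, makes \<open>q(A)\<close> invertible.
\<close>

definition row_norm_le :: "'a set \<Rightarrow> ('a \<Rightarrow> real) \<Rightarrow> real \<Rightarrow> bool" where
  "row_norm_le J a c \<longleftrightarrow> (\<forall>\<xi>. (\<forall>w\<in>J. \<bar>\<xi> w\<bar> \<le> 1) \<longrightarrow> \<bar>\<Sum>w\<in>J. a w * \<xi> w\<bar> \<le> c)"

lemma row_norm_le_scale:
  assumes "row_norm_le J a c" "\<And>w. w \<in> J \<Longrightarrow> \<bar>\<xi> w\<bar> \<le> B" "0 < B"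
  shows "\<bar>\<Sum>w\<in>J. a w * \<xi> w\<bar> \<le> c * B"
proof -
  have "\<forall>w\<in>J. \<bar>\<xi> w / B\<bar> \<le> 1" using assms(2,3) by simp
  then have "\<bar>\<Sum>w\<in>J. a w * (\<xi> w / B)\<bar> \<le> c"
    using assms(1)[unfolded row_norm_le_def, rule_format, of "\<lambda>w. \<xi> w / B"] by blast
  moreover have "(\<Sum>w\<in>J. a w * (\<xi> w / B)) = (\<Sum>w\<in>J. a w * \<xi> w) / B"
    by (simp add: sum_divide_distrib)
  ultimately have "\<bar>\<Sum>w\<in>J. a w * \<xi> w\<bar> / B \<le> c" using assms(3) by simp
  then show ?thesis using assms(3) by (simp add: pos_divide_le_eq)
qed

lemma matvec_bounded:
  assumes "\<And>v. v \<in> J \<Longrightarrow> row_norm_le J (A v) 1" "\<And>w. w \<in> J \<Longrightarrow> \<bar>\<xi> w\<bar> \<le> B" "0 < B" "v \<in> J"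
  shows "\<bar>matvec A J \<xi> n v\<bar> \<le> B"
  using assms(4)
proof (induction n arbitrary: v)
  case (Suc n)
  then show ?case using row_norm_le_scale[OF assms(1) _ assms(3), of v "matvec A J \<xi> n"] by simp
qed (simp add: assms(2))

lemma shift_series_sum:
  assumes "finite J" "abs_sum D" "\<And>u. u \<in> J \<Longrightarrow> sbounded (F u)"
  shows "shift_series D (\<lambda>n. \<Sum>u\<in>J. a u * F u n) n = (\<Sum>u\<in>J. a u * shift_series D (F u) n)
    \<and> sbounded (\<lambda>n. \<Sum>u\<in>J. a u * F u n)"
  using assms(1,3)
proof (induction J rule: finite_induct)
  case empty
  show ?case using sbounded_const[of 0] by (simp add: shift_series_def)
next
  case (insert u J)
  then show ?case using shift_series_linear[OF assms(2), of "F u" "\<lambda>n. \<Sum>u\<in>J. a u * F u n" "a u" n]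
      sbounded_linear[of "F u" "\<lambda>n. \<Sum>u\<in>J. a u * F u n" "a u"] by simp
qed

lemma act_sum: "finite J \<Longrightarrow> act p (\<lambda>n. \<Sum>u\<in>J. a u * F u n) n = (\<Sum>u\<in>J. a u * act p (F u) n)"
  for p :: "real poly"
  by (induction J rule: finite_induct) (simp_all add: act_linear)

text \<open>The operator \<open>D(A) = q(A)\<^sup>-\<^sup>1 p(A)\<close> for a matrix \<open>A = N(t) / \<delta>(t)\<close> depending on a parameter \<open>t\<close>.\<close>

lemma matrix_fraction:
  fixes N :: "'a \<Rightarrow> 'a \<Rightarrow> real poly"
  assumes J: "finite J" "card J \<le> d" and N: "\<And>v w. v \<in> J \<Longrightarrow> w \<in> J \<Longrightarrow> degree (N v w) \<le> m"
    and \<delta>: "degree \<delta> \<le> m" "\<And>t. t \<in> I \<Longrightarrow> poly \<delta> t \<noteq> 0"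
    and row_norm_le: "\<And>v t. v \<in> J \<Longrightarrow> t \<in> I \<Longrightarrow> row_norm_le J (\<lambda>w. poly (N v w) t) \<bar>poly \<delta> t\<bar>"
    and D: "subprob D" "fps_of_poly q * D = fps_of_poly p" and ab: "a * p + b * q = 1"
    and deg: "degree p \<le> e" "degree q \<le> e"
  shows "\<exists>Z \<Delta>. degree \<Delta> \<le> d * e * m \<and> (\<forall>t\<in>I. poly \<Delta> t \<noteq> 0) \<and>
    (\<forall>v\<in>J. \<forall>w\<in>J. degree (Z v w) \<le> d * e * m) \<and>
    (\<forall>t\<in>I. \<forall>v\<in>J. \<forall>\<xi>. (\<Sum>w\<in>J. poly (Z v w) t * \<xi> w) =
       poly \<Delta> t * shift_series D (\<lambda>n. matvec (\<lambda>v w. poly (N v w) t / poly \<delta> t) J \<xi> n v) 0)"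
proof -
  \<comment> \<open>\<open>\<delta>^e r(N / \<delta>)\<close> with denominators cleared;
    homogenising to exponent \<open>e\<close> gives every entry degree at most
    \<open>e * m\<close>.\<close>
  define PM where "PM r v w = (\<Sum>l\<le>e. Polynomial.smult (Polynomial.coeff r l) (\<delta> ^ (e - l) * matpow N J l v w))" for r v w
  have dPM: "degree (PM r v w) \<le> e * m" if "v \<in> J" "w \<in> J" for r v w
    unfolding PM_def
  proof (rule degree_sum_le)
    fix l assume "l \<in> {..e}"
    then have l: "l \<le> e" by simp
    have "degree (\<delta> ^ (e - l)) \<le> (e - l) * m"
      using degree_power_le[of \<delta> "e - l"] \<delta>(1) by (metis mult.commute mult_le_mono2 order_trans)
    then have "degree (\<delta> ^ (e - l) * matpow N J l v w) \<le> (e - l) * m + l * m"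
      by (intro order_trans[OF degree_mult_le] add_mono degree_matpow N that)
    also have "\<dots> = e * m" using l by (simp flip: add_mult_distrib)
    finally show "degree (Polynomial.smult (Polynomial.coeff r l) (\<delta> ^ (e - l) * matpow N J l v w)) \<le> e * m"
      using degree_smult_le order_trans by blast
  qed simp
  have PM: "(\<Sum>w\<in>J. poly (PM r v w) t * \<xi> w) =
      poly \<delta> t ^ e * act r (\<lambda>n. matvec (\<lambda>v w. poly (N v w) t / poly \<delta> t) J \<xi> n v) 0"
    if "degree r \<le> e" "t \<in> I" "v \<in> J" for r t v \<xi>
  proof -
    let ?V = "matvec (\<lambda>v w. poly (N v w) t / poly \<delta> t) J \<xi>"
    have "(\<Sum>w\<in>J. poly (PM r v w) t * \<xi> w) =
        (\<Sum>w\<in>J. \<Sum>l\<le>e. Polynomial.coeff r l * poly \<delta> t ^ (e - l) * (poly (matpow N J l v w) t * \<xi> w))"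
      by (simp add: PM_def poly_sum sum_distrib_right mult.assoc)
    also have "\<dots> = (\<Sum>l\<le>e. Polynomial.coeff r l * poly \<delta> t ^ (e - l) * (\<Sum>w\<in>J. poly (matpow N J l v w) t * \<xi> w))"
      by (subst sum.swap) (simp add: sum_distrib_left)
    also have "\<dots> = (\<Sum>l\<le>e. poly \<delta> t ^ e * (Polynomial.coeff r l * ?V l v))"
    proof (rule sum.cong[OF refl])
      fix l assume "l \<in> {..e}"
      then have "poly \<delta> t ^ e = poly \<delta> t ^ (e - l) * poly \<delta> t ^ l" by (simp flip: power_add)
      then show "Polynomial.coeff r l * poly \<delta> t ^ (e - l) * (\<Sum>w\<in>J. poly (matpow N J l v w) t * \<xi> w)
          = poly \<delta> t ^ e * (Polynomial.coeff r l * ?V l v)"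
        using matpow_matvec[OF J(1) \<delta>(2)[OF that(2)] that(3)] by simp
    qed
    also have "\<dots> = poly \<delta> t ^ e * act r (\<lambda>n. ?V n v) 0"
      using act_alt[OF that(1), of "\<lambda>n. ?V n v" 0] by (simp add: sum_distrib_left)
    finally show ?thesis .
  qed
  have "\<exists>R \<Delta>. degree \<Delta> \<le> e * m * card J \<and>
    (\<forall>v\<in>J. \<forall>w\<in>J. degree (R v w) \<le> e * m * (card J - 1)) \<and>
    (\<forall>v\<in>J. \<forall>w\<in>J. (\<Sum>u\<in>J. R v u * PM q u w) = (if v = w then \<Delta> else 0)) \<and>
    (\<forall>t. poly \<Delta> t = 0 \<longrightarrow> (\<exists>\<xi>. (\<exists>w\<in>J. \<xi> w \<noteq> 0) \<and> (\<forall>v\<in>J. (\<Sum>w\<in>J. poly (PM q v w) t * \<xi> w) = 0)))"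
    by (rule adjugate_family[OF J(1) dPM])
  then obtain R \<Delta> where R0: "degree \<Delta> \<le> e * m * card J \<and>
    (\<forall>v\<in>J. \<forall>w\<in>J. degree (R v w) \<le> e * m * (card J - 1)) \<and>
    (\<forall>v\<in>J. \<forall>w\<in>J. (\<Sum>u\<in>J. R v u * PM q u w) = (if v = w then \<Delta> else 0)) \<and>
    (\<forall>t. poly \<Delta> t = 0 \<longrightarrow> (\<exists>\<xi>. (\<exists>w\<in>J. \<xi> w \<noteq> 0) \<and> (\<forall>v\<in>J. (\<Sum>w\<in>J. poly (PM q v w) t * \<xi> w) = 0)))"
    by (elim exE)
  note R = R0[THEN conjunct1] R0[THEN conjunct2, THEN conjunct1, rule_format]
    R0[THEN conjunct2, THEN conjunct2, THEN conjunct1, rule_format]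
    R0[THEN conjunct2, THEN conjunct2, THEN conjunct2, rule_format]
  define Z where "Z v w = (\<Sum>u\<in>J. R v u * PM p u w)" for v w
  have contr1: "row_norm_le J (\<lambda>w. poly (N v w) t / poly \<delta> t) 1" if "v \<in> J" "t \<in> I" for v t
    unfolding row_norm_le_def
  proof (intro allI impI)
    fix \<xi> assume "\<forall>w\<in>J. \<bar>\<xi> w\<bar> \<le> (1::real)"
    then have "\<bar>\<Sum>w\<in>J. poly (N v w) t * \<xi> w\<bar> \<le> \<bar>poly \<delta> t\<bar>"
      using row_norm_le[OF that] unfolding row_norm_le_def by blast
    moreover have "(\<Sum>w\<in>J. poly (N v w) t / poly \<delta> t * \<xi> w) = (\<Sum>w\<in>J. poly (N v w) t * \<xi> w) / poly \<delta> t"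
      by (simp add: sum_divide_distrib)
    ultimately show "\<bar>\<Sum>w\<in>J. poly (N v w) t / poly \<delta> t * \<xi> w\<bar> \<le> 1"
      using \<delta>(2)[OF that(2)] by (simp add: divide_le_eq_1)
  qed
  have bdd: "sbounded (\<lambda>n. matvec (\<lambda>v w. poly (N v w) t / poly \<delta> t) J \<xi> n v)" if "v \<in> J" "t \<in> I" for v t \<xi>
  proof -
    define B where "B = 1 + (\<Sum>w\<in>J. \<bar>\<xi> w\<bar>)"
    have "\<bar>\<xi> w\<bar> \<le> B" if "w \<in> J" for w
      using member_le_sum[OF that, of "\<lambda>w. \<bar>\<xi> w\<bar>"] J(1) by (simp add: B_def)
    moreover have "0 < B" unfolding B_def by (simp add: add_pos_nonneg sum_nonneg)
    ultimately show ?thesis unfolding sbounded_def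
      using matvec_bounded[of J "\<lambda>v w. poly (N v w) t / poly \<delta> t" \<xi> B] contr1 that by blast
  qed
  \<comment> \<open>A zero of \<open>\<Delta>\<close> at \<open>t\<close> gives a nonzero kernel
    vector \<open>\<xi>\<close> of \<open>q(A)\<close>. Then \<open>q(S)\<close> kills the bounded
    sequences of components of \<open>A^n \<xi>\<close>, which forces
    \<open>\<xi> = 0\<close>.\<close>
  have nz: "poly \<Delta> t \<noteq> 0" if t: "t \<in> I" for t
  proof
    assume "poly \<Delta> t = 0"
    then obtain \<xi> where \<xi>: "\<exists>w\<in>J. \<xi> w \<noteq> 0" "\<And>v. v \<in> J \<Longrightarrow> (\<Sum>w\<in>J. poly (PM q v w) t * \<xi> w) = 0"
      using R(4) by blast
    let ?A = "\<lambda>v w. poly (N v w) t / poly \<delta> t"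
    let ?F = "\<lambda>v n. matvec ?A J \<xi> n v"
    have "act q (?F v) n = 0" if "v \<in> J" for v n
      using that
    proof (induction n arbitrary: v)
      case 0
      then show ?case using PM[OF deg(2) t, of v \<xi>] \<xi>(2) \<delta>(2)[OF t] by simp
    next
      case (Suc n)
      have "act q (?F v) (Suc n) = act q (\<lambda>n. \<Sum>u\<in>J. ?A v u * ?F u n) n"
        by (simp add: act_def)
      also have "\<dots> = (\<Sum>u\<in>J. ?A v u * act q (?F u) n)" by (rule act_sum[OF J(1)])
      finally show ?case using Suc.IH by simp
    qed
    then have "?F v 0 = 0" if "v \<in> J" for v
      using act_injective[OF D ab, of "?F v" 0] bdd[OF that t] that by blast
    then show False using \<xi>(1) by auto
  qed
  have main: "(\<Sum>w\<in>J. poly (Z v w) t * \<xi> w) =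
       poly \<Delta> t * shift_series D (\<lambda>n. matvec (\<lambda>v w. poly (N v w) t / poly \<delta> t) J \<xi> n v) 0"
    if t: "t \<in> I" and v: "v \<in> J" for t v \<xi>
  proof -
    let ?A = "\<lambda>v w. poly (N v w) t / poly \<delta> t"
    let ?F = "\<lambda>v n. matvec ?A J \<xi> n v"
    define G where "G v = shift_series D (?F v) 0" for v
    have GF: "matvec ?A J G l v = shift_series D (?F v) l" if "v \<in> J" for l v
      using that
    proof (induction l arbitrary: v)
      case (Suc l)
      have "shift_series D (?F v) (Suc l) = shift_series D (\<lambda>n. \<Sum>u\<in>J. ?A v u * ?F u n) l"
        by (simp add: shift_series_def)
      also have "\<dots> = (\<Sum>u\<in>J. ?A v u * shift_series D (?F u) l)"
        by (rule shift_series_sum[THEN conjunct1, OF J(1) abs_sum_subprob[OF D(1)]]) (rule bdd[OF _ t])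
      finally show ?case using Suc.IH by simp
    qed (simp add: G_def)
    \<comment> \<open>For \<open>G = D(A) \<xi>\<close> this is \<open>q(A) G = p(A) \<xi>\<close>,
      up to the common factor \<open>\<delta>^e\<close>. The adjugate then isolates
      \<open>G\<close>.\<close>
    have QG: "(\<Sum>w\<in>J. poly (PM q u w) t * G w) = (\<Sum>w\<in>J. poly (PM p u w) t * \<xi> w)" if u: "u \<in> J" for u
    proof -
      have "act q (\<lambda>n. matvec ?A J G n u) 0 = act q (shift_series D (?F u)) 0" by (simp add: GF[OF u])
      also have "\<dots> = act p (?F u) 0" by (rule act_shift_series[OF abs_sum_subprob[OF D(1)] bdd[OF u t] D(2)])
      finally show ?thesis by (simp add: PM[OF deg(1) t u] PM[OF deg(2) t u])
    qed
    have "(\<Sum>w\<in>J. poly (Z v w) t * \<xi> w) = (\<Sum>w\<in>J. \<Sum>u\<in>J. poly (R v u) t * (poly (PM p u w) t * \<xi> w))"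
      by (simp add: Z_def poly_sum sum_distrib_right mult.assoc)
    also have "\<dots> = (\<Sum>u\<in>J. poly (R v u) t * (\<Sum>w\<in>J. poly (PM q u w) t * G w))"
      by (subst sum.swap) (simp add: sum_distrib_left QG)
    also have "\<dots> = (\<Sum>w\<in>J. poly (\<Sum>u\<in>J. R v u * PM q u w) t * G w)"
      unfolding sum_distrib_left by (subst sum.swap) (simp add: poly_sum sum_distrib_right mult.assoc)
    also have "\<dots> = (\<Sum>w\<in>J. if v = w then poly \<Delta> t * G w else 0)"
      by (rule sum.cong) (auto simp: R(3)[OF v])
    also have "\<dots> = poly \<Delta> t * G v" using J(1) v by simp
    finally show ?thesis by (simp add: G_def)
  qed
  have dZ: "degree (Z v w) \<le> d * e * m" if vw: "v \<in> J" "w \<in> J" for v w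
    unfolding Z_def
  proof (rule degree_sum_le[OF J(1)])
    fix u assume u: "u \<in> J"
    have c: "0 < card J" using u J(1) card_gt_0_iff by blast
    have "degree (R v u * PM p u w) \<le> e * m * (card J - 1) + e * m"
      by (intro order_trans[OF degree_mult_le] add_mono R(2) dPM vw u)
    also have "\<dots> = e * m * card J" using c by (cases "card J") auto
    also have "\<dots> \<le> d * e * m" using J(2) by (simp add: mult_ac)
    finally show "degree (R v u * PM p u w) \<le> d * e * m" .
  qed
  have "e * m * card J \<le> d * e * m" using J(2) by (simp add: mult_ac)
  then have "degree \<Delta> \<le> d * e * m" by (rule order_trans[OF R(1)])
  then show ?thesis using nz dZ main by (intro exI[of _ Z] exI[of _ \<Delta>]) blast
qed

subsection \<open>Linear operators on bounded functions\<close>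

definition bounded_fun :: "('a \<Rightarrow> real) \<Rightarrow> bool" where
  "bounded_fun f \<longleftrightarrow> (\<exists>B. \<forall>s. \<bar>f s\<bar> \<le> B)"

lemma unit_bounded_bounded_fun: "unit_bounded f \<Longrightarrow> bounded_fun f" unfolding unit_bounded_def bounded_fun_def by blast

lemma bounded_fun_const: "bounded_fun (\<lambda>s. c)" unfolding bounded_fun_def by blast

lemma bounded_fun_linear: "bounded_fun f \<Longrightarrow> bounded_fun g \<Longrightarrow> bounded_fun (\<lambda>s. c * f s + g s)"
proof -
  assume "bounded_fun f" "bounded_fun g"
  then obtain B C where bc: "\<And>s. \<bar>f s\<bar> \<le> B" "\<And>s. \<bar>g s\<bar> \<le> C" unfolding bounded_fun_def by blast
  have "\<bar>c * f s + g s\<bar> \<le> \<bar>c\<bar> * B + C" for s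
  proof -
    have "\<bar>c * f s + g s\<bar> \<le> \<bar>c\<bar> * \<bar>f s\<bar> + \<bar>g s\<bar>"
      using abs_triangle_ineq[of "c * f s" "g s"] by (simp add: abs_mult)
    also have "\<dots> \<le> \<bar>c\<bar> * B + C"
      by (intro add_mono mult_left_mono bc) auto
    finally show ?thesis .
  qed
  then show ?thesis unfolding bounded_fun_def by blast
qed

type_synonym obs = "(nat \<Rightarrow> nat) \<Rightarrow> real"

text \<open>Linearity is asked on bounded functions, where the sums of a draw converge; the second
  clause keeps the members of a family bounded by 1.\<close>

definition linop :: "(obs \<Rightarrow> obs) \<Rightarrow> bool" where
  "linop L \<longleftrightarrow> (\<forall>f g c. bounded_fun f \<longrightarrow> bounded_fun g \<longrightarrow> L (\<lambda>s. c * f s + g s) = (\<lambda>s. c * L f s + L g s)) \<and>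
     (\<forall>f. unit_bounded f \<longrightarrow> unit_bounded (L f))"

lemma linop_linear: "linop L \<Longrightarrow> bounded_fun f \<Longrightarrow> bounded_fun g \<Longrightarrow> L (\<lambda>s. c * f s + g s) = (\<lambda>s. c * L f s + L g s)"
  unfolding linop_def by blast

lemma linop_0: "linop L \<Longrightarrow> L (\<lambda>s. 0) = (\<lambda>s. 0)"
proof -
  assume "linop L"
  from linop_linear[OF this bounded_fun_const bounded_fun_const, of 1 0 0] show ?thesis by (simp add: fun_eq_iff)
qed

lemma linop_bounded_fun: assumes "linop L" "bounded_fun f" shows "bounded_fun (L f)"
proof -
  obtain B where B: "\<And>s. \<bar>f s\<bar> \<le> B" using assms(2) unfolding bounded_fun_def by blast
  define C where "C = \<bar>B\<bar> + 1"
  have C: "\<bar>f s\<bar> \<le> C" "0 < C" for s using B[of s] by (auto simp: C_def)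
  have b: "unit_bounded (\<lambda>s. f s / C)" unfolding unit_bounded_def using C by (simp add: abs_divide)
  have "f = (\<lambda>s. C * (f s / C) + 0)" using C(2) by auto
  then have "L f = L (\<lambda>s. C * (f s / C) + 0)" by (rule arg_cong)
  also have "\<dots> = (\<lambda>s. C * L (\<lambda>s. f s / C) s + L (\<lambda>s. 0) s)"
    by (rule linop_linear[OF assms(1) unit_bounded_bounded_fun[OF b] bounded_fun_const])
  finally have eq: "L f = (\<lambda>s. C * L (\<lambda>s. f s / C) s + L (\<lambda>s. 0) s)" .
  have "unit_bounded (L (\<lambda>s. f s / C))" using assms(1) b unfolding linop_def by blast
  then show ?thesis unfolding eq linop_0[OF assms(1)] by (intro bounded_fun_linear unit_bounded_bounded_fun bounded_fun_const)
qed

lemma linop_sum: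
  assumes L: "linop L" and "finite J" "\<And>w. w \<in> J \<Longrightarrow> bounded_fun (h w)"
  shows "L (\<lambda>s. \<Sum>w\<in>J. a w * h w s) = (\<lambda>s. \<Sum>w\<in>J. a w * L (h w) s) \<and> bounded_fun (\<lambda>s. \<Sum>w\<in>J. a w * h w s)"
  using assms(2,3)
proof (induction J rule: finite_induct)
  case empty
  show ?case using linop_0[OF L] bounded_fun_const by simp
next
  case (insert u J)
  then show ?case
    using linop_linear[OF L, of "h u" "\<lambda>s. \<Sum>w\<in>J. a w * h w s" "a u"]
      bounded_fun_linear[of "h u" "\<lambda>s. \<Sum>w\<in>J. a w * h w s" "a u"] by simp
qed

lemma linop_subst: "linop (\<lambda>f s. f (\<phi> s))"
  by (simp add: linop_def unit_bounded_def)

lemma linop_mask: "linop (\<lambda>f s. if P s then f s else 0)"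
  by (auto simp: linop_def unit_bounded_def)

lemma linop_comp: "linop L \<Longrightarrow> linop M \<Longrightarrow> linop (\<lambda>f. M (L f))"
  unfolding linop_def[of "\<lambda>f. M (L f)"]
  by (auto simp: linop_linear linop_bounded_fun) (simp add: linop_def)

lemma linop_funpow: "linop M \<Longrightarrow> linop (M ^^ n)"
proof (induction n)
  case 0
  then show ?case using linop_subst[of "\<lambda>s. s"] by (simp add: id_def)
next
  case (Suc n)
  then show ?case using linop_comp[of "M ^^ n" M] by (simp add: o_def)
qed

lemma linop_funpow_at: assumes "linop M" shows "linop (\<lambda>f s. (M ^^ s y) f s)"
  using linop_funpow[OF assms] unfolding linop_def unit_bounded_def by fastforce

lemma drawop_shift_series: "drawop x D f s = shift_series D (\<lambda>j. f (s(x := s x + j))) 0"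
  by (simp add: drawop_def shift_series_def)

lemma linop_drawop: assumes "subprob D" shows "linop (drawop x D)"
  unfolding linop_def
proof (intro conjI allI impI)
  fix f g :: obs and c assume "bounded_fun f" "bounded_fun g"
  then have sb: "sbounded (\<lambda>j. f (s(x := s x + j)))" "sbounded (\<lambda>j. g (s(x := s x + j)))" for s
    unfolding bounded_fun_def sbounded_def by blast+
  show "drawop x D (\<lambda>s. c * f s + g s) = (\<lambda>s. c * drawop x D f s + drawop x D g s)"
    unfolding drawop_shift_series using shift_series_linear[OF abs_sum_subprob[OF assms] sb] by (intro ext)
qed (rule drawop_unit_bounded[OF assms])

definition incr :: "nat \<Rightarrow> (nat \<Rightarrow> nat) \<Rightarrow> nat \<Rightarrow> nat" where
  "incr i s = s(i := Suc (s i))"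

text \<open>Both operations add to the state, so they commute, also when
  \<open>i = x\<close>.\<close>

lemma drawop_incr: "drawop x D (\<lambda>s. f (incr i s)) s = drawop x D f (incr i s)"
proof -
  have "incr i (s(x := s x + j)) = (incr i s)(x := incr i s x + j)" for j
    by (auto simp: incr_def)
  then show ?thesis by (simp add: drawop_def)
qed

lemma drawop_funpow_incr: "(drawop x D ^^ n) (\<lambda>s. f (incr i s)) = (\<lambda>s. (drawop x D ^^ n) f (incr i s))"
proof (induction n)
  case (Suc n)
  have "drawop x D (\<lambda>s. g (incr i s)) = (\<lambda>s. drawop x D g (incr i s))" for g
    by (rule ext) (rule drawop_incr)
  then show ?case by (simp add: Suc)
qed simp

subsection \<open>Families of functions closed under shifts\<close>

type_synonym fam = "real \<Rightarrow> obs"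

abbreviation iv :: "real set" where "iv \<equiv> {0<..<1}"

text \<open>
  The parameter \<open>t\<close> stands for one of the coordinates of \<open>u\<close>; \<open>\<delta>\<close> is a common denominator of the
  coefficients, which are rational functions of \<open>t\<close>.
\<close>

definition combination :: "fam set \<Rightarrow> nat \<Rightarrow> real poly \<Rightarrow> fam \<Rightarrow> bool" where
  "combination J m \<delta> g \<longleftrightarrow> (\<exists>N. (\<forall>w. degree (N w) \<le> m) \<and>
     (\<forall>t\<in>iv. row_norm_le J (\<lambda>w. poly (N w) t) \<bar>poly \<delta> t\<bar> \<and>
       (\<forall>s. poly \<delta> t * g t s = (\<Sum>w\<in>J. poly (N w) t * w t s))))"

text \<open>Increments reach every state in \<open>states k\<close> from the zero state, so the last
  two clauses determine the values of the members there, with powers of \<open>\<delta>\<close> as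
  denominators.\<close>

definition basis :: "nat \<Rightarrow> fam set \<Rightarrow> real poly \<Rightarrow> nat \<Rightarrow> bool" where
  "basis k J \<delta> m \<longleftrightarrow> finite J \<and> degree \<delta> \<le> m \<and> (\<forall>t\<in>iv. poly \<delta> t \<noteq> 0) \<and>
     (\<forall>v\<in>J. (\<forall>t\<in>iv. unit_bounded (v t)) \<and> (\<forall>i<k. combination J m \<delta> (\<lambda>t s. v t (incr i s))) \<and>
       (\<exists>c. degree c \<le> m \<and> (\<forall>t\<in>iv. poly \<delta> t * v t (\<lambda>_. 0) = poly c t)))"

lemma combination_elem:
  assumes "finite J" "v \<in> J" "degree \<delta> \<le> m"
  shows "combination J m \<delta> v"
proof -
  let ?N = "\<lambda>w. if w = v then \<delta> else 0"
  have sum: "(\<Sum>w\<in>J. poly (?N w) t * f w) = poly \<delta> t * f v" for t and f :: "fam \<Rightarrow> real"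
  proof -
    have "(\<Sum>w\<in>J. poly (?N w) t * f w) = (\<Sum>w\<in>J. if w = v then poly \<delta> t * f w else 0)"
      by (rule sum.cong) auto
    then show ?thesis using assms by simp
  qed
  show ?thesis unfolding combination_def row_norm_le_def sum
    by (intro exI[of _ ?N]) (use assms in \<open>auto simp: sum abs_mult intro: mult_left_le\<close>)
qed

lemma combination_scale:
  assumes "combination J m \<delta> g" "degree \<epsilon> \<le> e"
  shows "combination J (m + e) (\<delta> * \<epsilon>) g"
proof -
  obtain N where N: "\<And>w. degree (N w) \<le> m" "\<And>t. t \<in> iv \<Longrightarrow> row_norm_le J (\<lambda>w. poly (N w) t) \<bar>poly \<delta> t\<bar>"
    "\<And>t s. t \<in> iv \<Longrightarrow> poly \<delta> t * g t s = (\<Sum>w\<in>J. poly (N w) t * w t s)"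
    using assms(1) unfolding combination_def by blast
  let ?N = "\<lambda>w. \<epsilon> * N w"
  have sum: "(\<Sum>w\<in>J. poly (?N w) t * f w) = poly \<epsilon> t * (\<Sum>w\<in>J. poly (N w) t * f w)" for t and f :: "fam \<Rightarrow> real"
    by (simp add: sum_distrib_left mult.assoc)
  have "degree (?N w) \<le> m + e" for w
    using degree_mult_le[of \<epsilon> "N w"] N(1)[of w] assms(2) by linarith
  moreover have "row_norm_le J (\<lambda>w. poly (?N w) t) \<bar>poly (\<delta> * \<epsilon>) t\<bar>" if "t \<in> iv" for t
    unfolding row_norm_le_def sum
  proof (intro allI impI)
    fix \<xi> assume "\<forall>w\<in>J. \<bar>\<xi> w\<bar> \<le> (1::real)"
    then have "\<bar>\<Sum>w\<in>J. poly (N w) t * \<xi> w\<bar> \<le> \<bar>poly \<delta> t\<bar>"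
      using N(2)[OF that] unfolding row_norm_le_def by blast
    then have "\<bar>poly \<epsilon> t\<bar> * \<bar>\<Sum>w\<in>J. poly (N w) t * \<xi> w\<bar> \<le> \<bar>poly \<epsilon> t\<bar> * \<bar>poly \<delta> t\<bar>"
      by (rule mult_left_mono) simp
    then show "\<bar>poly \<epsilon> t * (\<Sum>w\<in>J. poly (N w) t * \<xi> w)\<bar> \<le> \<bar>poly (\<delta> * \<epsilon>) t\<bar>"
      by (simp only: abs_mult poly_mult mult.commute)
  qed
  moreover have "poly (\<delta> * \<epsilon>) t * g t s = (\<Sum>w\<in>J. poly (?N w) t * w t s)" if "t \<in> iv" for t s
    unfolding sum N(3)[OF that, symmetric] by simp
  ultimately show ?thesis unfolding combination_def by (intro exI[of _ ?N]) blast
qed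

text \<open>Substituting combinations into a combination multiplies coefficient matrices: degrees
  add, denominators multiply, and the row norms, being operator norms for the maximum norm, are
  submultiplicative.\<close>

lemma combination_trans:
  assumes g: "combination J m \<delta> g" and J: "finite J" "\<And>w t. w \<in> J \<Longrightarrow> t \<in> iv \<Longrightarrow> unit_bounded (w t)"
    and nz: "\<And>t. t \<in> iv \<Longrightarrow> poly \<delta> t \<noteq> 0" "\<And>t. t \<in> iv \<Longrightarrow> poly \<delta>' t \<noteq> 0"
    and L: "linop L" and w: "\<And>w. w \<in> J \<Longrightarrow> combination J' m' \<delta>' (\<lambda>t. L (w t))"
  shows "combination J' (m + m') (\<delta> * \<delta>') (\<lambda>t. L (g t))"
proof -
  obtain N where N: "\<And>w. degree (N w) \<le> m" "\<And>t. t \<in> iv \<Longrightarrow> row_norm_le J (\<lambda>w. poly (N w) t) \<bar>poly \<delta> t\<bar>"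
    "\<And>t s. t \<in> iv \<Longrightarrow> poly \<delta> t * g t s = (\<Sum>w\<in>J. poly (N w) t * w t s)"
    using g unfolding combination_def by blast
  have "\<forall>w\<in>J. \<exists>R. (\<forall>w'. degree (R w') \<le> m') \<and>
     (\<forall>t\<in>iv. row_norm_le J' (\<lambda>w'. poly (R w') t) \<bar>poly \<delta>' t\<bar> \<and>
       (\<forall>s. poly \<delta>' t * L (w t) s = (\<Sum>w'\<in>J'. poly (R w') t * w' t s)))"
    using w unfolding combination_def by blast
  from bchoice[OF this] obtain R where
    R: "\<And>w w'. w \<in> J \<Longrightarrow> degree (R w w') \<le> m'"
      "\<And>w t. w \<in> J \<Longrightarrow> t \<in> iv \<Longrightarrow> row_norm_le J' (\<lambda>w'. poly (R w w') t) \<bar>poly \<delta>' t\<bar>"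
      "\<And>w t s. w \<in> J \<Longrightarrow> t \<in> iv \<Longrightarrow> poly \<delta>' t * L (w t) s = (\<Sum>w'\<in>J'. poly (R w w') t * w' t s)"
    by blast
  define M where "M w' = (\<Sum>w\<in>J. N w * R w w')" for w'
  have sum: "(\<Sum>w'\<in>J'. poly (M w') t * f w') = (\<Sum>w\<in>J. poly (N w) t * (\<Sum>w'\<in>J'. poly (R w w') t * f w'))"
    for t and f :: "fam \<Rightarrow> real"
  proof -
    have "(\<Sum>w'\<in>J'. poly (M w') t * f w') = (\<Sum>w'\<in>J'. \<Sum>w\<in>J. poly (N w) t * (poly (R w w') t * f w'))"
      by (simp add: M_def poly_sum sum_distrib_right mult.assoc)
    then show ?thesis by (subst (asm) sum.swap) (simp add: sum_distrib_left)
  qed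
  have "degree (M w') \<le> m + m'" for w'
    unfolding M_def
  proof (rule degree_sum_le[OF J(1)])
    fix w assume w: "w \<in> J"
    show "degree (N w * R w w') \<le> m + m'"
      using degree_mult_le[of "N w" "R w w'"] N(1)[of w] R(1)[OF w, of w'] by linarith
  qed
  moreover have "row_norm_le J' (\<lambda>w. poly (M w) t) \<bar>poly (\<delta> * \<delta>') t\<bar>" if t: "t \<in> iv" for t
    unfolding row_norm_le_def sum
  proof (intro allI impI)
    fix \<xi> assume \<xi>: "\<forall>w\<in>J'. \<bar>\<xi> w\<bar> \<le> (1::real)"
    have "\<bar>\<Sum>w'\<in>J'. poly (R w w') t * \<xi> w'\<bar> \<le> \<bar>poly \<delta>' t\<bar>" if "w \<in> J" for w
      using R(2)[OF that t] \<xi> unfolding row_norm_le_def by blast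
    from row_norm_le_scale[OF N(2)[OF t] this] nz(2)[OF t]
    show "\<bar>\<Sum>w\<in>J. poly (N w) t * (\<Sum>w'\<in>J'. poly (R w w') t * \<xi> w')\<bar> \<le> \<bar>poly (\<delta> * \<delta>') t\<bar>"
      by (simp add: abs_mult)
  qed
  moreover have "poly (\<delta> * \<delta>') t * L (g t) s = (\<Sum>w'\<in>J'. poly (M w') t * w' t s)" if t: "t \<in> iv" for t s
  proof -
    have "g t = (\<lambda>s. \<Sum>w\<in>J. poly (N w) t / poly \<delta> t * w t s)"
    proof
      fix s
      show "g t s = (\<Sum>w\<in>J. poly (N w) t / poly \<delta> t * w t s)"
        using N(3)[OF t, of s] nz(1)[OF t] by (simp add: sum_divide_distrib[symmetric] eq_divide_eq mult.commute)
    qed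
    then have "L (g t) = (\<lambda>s. \<Sum>w\<in>J. poly (N w) t / poly \<delta> t * L (w t) s)"
      using linop_sum[OF L J(1), of "\<lambda>w. w t" "\<lambda>w. poly (N w) t / poly \<delta> t"] unit_bounded_bounded_fun[OF J(2)[OF _ t]] by simp
    then have "poly (\<delta> * \<delta>') t * L (g t) s = (\<Sum>w\<in>J. poly (\<delta> * \<delta>') t * (poly (N w) t / poly \<delta> t * L (w t) s))"
      by (simp only: sum_distrib_left)
    also have "\<dots> = (\<Sum>w\<in>J. poly (N w) t * (poly \<delta>' t * L (w t) s))"
      by (rule sum.cong) (use nz(1)[OF t] in \<open>auto simp: field_simps\<close>)
    also have "\<dots> = (\<Sum>w\<in>J. poly (N w) t * (\<Sum>w'\<in>J'. poly (R w w') t * w' t s))"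
      by (rule sum.cong) (use R(3)[OF _ t] in auto)
    finally show ?thesis unfolding sum .
  qed
  ultimately show ?thesis unfolding combination_def by (intro exI[of _ M]) blast
qed

text \<open>When the image of each member is a member of the new family, the inner combination is
  trivial and the denominator does not grow.\<close>

lemma combination_map:
  assumes g: "combination J m \<delta> g" and J: "finite J" "\<And>w t. w \<in> J \<Longrightarrow> t \<in> iv \<Longrightarrow> unit_bounded (w t)"
    and nz: "\<And>t. t \<in> iv \<Longrightarrow> poly \<delta> t \<noteq> 0"
    and L: "linop L" and J': "finite J'" "\<And>w. w \<in> J \<Longrightarrow> (\<lambda>t. L (w t)) \<in> J'"
  shows "combination J' m \<delta> (\<lambda>t. L (g t))"
proof -
  have "combination J' (m + 0) (\<delta> * 1) (\<lambda>t. L (g t))"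
    by (rule combination_trans[where J = J and L = L and g = g and \<delta> = \<delta> and m = m])
      (use g J nz L combination_elem[OF J'(1) J'(2), of _ 1 0] in simp_all)
  then show ?thesis by simp
qed

lemma basisD:
  assumes "basis k J \<delta> m"
  shows "finite J" "degree \<delta> \<le> m" "\<And>t. t \<in> iv \<Longrightarrow> poly \<delta> t \<noteq> 0"
    "\<And>v t. v \<in> J \<Longrightarrow> t \<in> iv \<Longrightarrow> unit_bounded (v t)"
    "\<And>v i. v \<in> J \<Longrightarrow> i < k \<Longrightarrow> combination J m \<delta> (\<lambda>t s. v t (incr i s))"
    "\<And>v. v \<in> J \<Longrightarrow> \<exists>c. degree c \<le> m \<and> (\<forall>t\<in>iv. poly \<delta> t * v t (\<lambda>_. 0) = poly c t)"
  using assms unfolding basis_def by blast+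

lemma basis_scale:
  assumes "basis k J \<delta> m" "degree \<epsilon> \<le> e" "\<And>t. t \<in> iv \<Longrightarrow> poly \<epsilon> t \<noteq> 0"
  shows "basis k J (\<delta> * \<epsilon>) (m + e)"
proof -
  note b = basisD[OF assms(1)]
  have "degree (p * \<epsilon>) \<le> m + e" if "degree p \<le> m" for p
    using degree_mult_le[of p \<epsilon>] assms(2) that by linarith
  moreover have "\<exists>c. degree c \<le> m + e \<and> (\<forall>t\<in>iv. poly (\<delta> * \<epsilon>) t * v t (\<lambda>_. 0) = poly c t)" if "v \<in> J" for v
  proof -
    obtain c where c: "degree c \<le> m" "\<forall>t\<in>iv. poly \<delta> t * v t (\<lambda>_. 0) = poly c t" using b(6)[OF \<open>v \<in> J\<close>] by blast
    then have "\<forall>t\<in>iv. poly (\<delta> * \<epsilon>) t * v t (\<lambda>_. 0) = poly (c * \<epsilon>) t"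
      by (auto simp: mult_ac)
    then show ?thesis using calculation c(1) by blast
  qed
  ultimately show ?thesis unfolding basis_def
    using b assms(3) combination_scale[OF b(5) assms(2)] by simp
qed

lemma basis_mono: "basis k J \<delta> m \<Longrightarrow> m \<le> m' \<Longrightarrow> basis k J \<delta> m'"
  using basis_scale[of k J \<delta> m 1 "m' - m"] by simp

text \<open>The coefficients do not depend on \<open>t\<close>: rational dependence on
  \<open>t\<close> is confined to the shift matrices and to the values at the zero state.\<close>

definition in_span :: "fam set \<Rightarrow> fam \<Rightarrow> bool" where
  "in_span J h \<longleftrightarrow> (\<exists>\<alpha>. \<forall>t\<in>iv. \<forall>s. h t s = (\<Sum>w\<in>J. \<alpha> w * w t s))"

lemma in_span_map:
  assumes h: "in_span J h" and J: "finite J" "\<And>w t. w \<in> J \<Longrightarrow> t \<in> iv \<Longrightarrow> unit_bounded (w t)"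
    and L: "linop L" and J': "finite J'" "\<And>w. w \<in> J \<Longrightarrow> (\<lambda>t. L (w t)) \<in> J'"
  shows "in_span J' (\<lambda>t. L (h t))"
proof -
  obtain \<alpha> where \<alpha>: "\<And>t s. t \<in> iv \<Longrightarrow> h t s = (\<Sum>w\<in>J. \<alpha> w * w t s)" using h unfolding in_span_def by blast
  \<comment> \<open>Distinct members may have the same image under \<open>L\<close>, so coefficients
    are collected over the fibres.\<close>
  define \<beta> where "\<beta> w' = (\<Sum>w\<in>{w\<in>J. (\<lambda>t. L (w t)) = w'}. \<alpha> w)" for w'
  have "L (h t) s = (\<Sum>w'\<in>J'. \<beta> w' * w' t s)" if t: "t \<in> iv" for t s
  proof -
    have "h t = (\<lambda>s. \<Sum>w\<in>J. \<alpha> w * w t s)" using \<alpha>[OF t] by auto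
    then have "L (h t) s = (\<Sum>w\<in>J. \<alpha> w * L (w t) s)"
      using linop_sum[OF L J(1), of "\<lambda>w. w t" \<alpha>] unit_bounded_bounded_fun[OF J(2)[OF _ t]] by simp
    also have "\<dots> = (\<Sum>w'\<in>J'. \<Sum>w\<in>{w\<in>J. (\<lambda>t. L (w t)) = w'}. \<alpha> w * L (w t) s)"
      by (rule sum.group[symmetric]) (use J J' in auto)
    also have "\<dots> = (\<Sum>w'\<in>J'. \<beta> w' * w' t s)"
      unfolding \<beta>_def sum_distrib_right by (intro sum.cong refl) auto
    finally show ?thesis .
  qed
  then show ?thesis unfolding in_span_def by blast
qed

lemma in_span_add:
  assumes "in_span J h" "in_span J h'"
  shows "in_span J (\<lambda>t s. h t s + h' t s)"
proof -
  obtain \<alpha> \<beta> where "\<And>t s. t \<in> iv \<Longrightarrow> h t s = (\<Sum>w\<in>J. \<alpha> w * w t s)" "\<And>t s. t \<in> iv \<Longrightarrow> h' t s = (\<Sum>w\<in>J. \<beta> w * w t s)"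
    using assms unfolding in_span_def by blast
  then show ?thesis unfolding in_span_def
    by (intro exI[of _ "\<lambda>w. \<alpha> w + \<beta> w"]) (simp add: distrib_right sum.distrib)
qed

lemma linop_id: "linop (\<lambda>f. f)" using linop_subst[of "\<lambda>s. s"] .

lemma in_span_uminus: "in_span J h \<Longrightarrow> in_span J (\<lambda>t s. - h t s)"
proof -
  assume "in_span J h"
  then obtain \<alpha> where "\<And>t s. t \<in> iv \<Longrightarrow> h t s = (\<Sum>w\<in>J. \<alpha> w * w t s)" unfolding in_span_def by blast
  then show ?thesis unfolding in_span_def by (intro exI[of _ "\<lambda>w. - \<alpha> w"]) (simp add: sum_negf)
qed

lemma basis_Un:
  assumes A: "basis k J \<delta> m" and B: "basis k J' \<delta>' m'"
  shows "basis k (J \<union> J') (\<delta> * \<delta>') (m + m')"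
proof -
  have "basis k J (\<delta> * \<delta>') (m + m')"
    by (rule basis_scale[OF A basisD(2)[OF B]]) (rule basisD(3)[OF B])
  note a = basisD[OF this]
  have "basis k J' (\<delta>' * \<delta>) (m' + m)"
    by (rule basis_scale[OF B basisD(2)[OF A]]) (rule basisD(3)[OF A])
  then have "basis k J' (\<delta> * \<delta>') (m + m')" by (simp add: mult.commute add.commute)
  note b = basisD[OF this]
  have "combination (J \<union> J') (m + m') (\<delta> * \<delta>') g" if "combination J (m + m') (\<delta> * \<delta>') g" for g
    by (rule combination_map[where L = "\<lambda>f. f" and g = g and J = J]) (use that a b linop_id in simp_all)
  moreover have "combination (J \<union> J') (m + m') (\<delta> * \<delta>') g" if "combination J' (m + m') (\<delta> * \<delta>') g" for g
    by (rule combination_map[where L = "\<lambda>f. f" and g = g and J = J']) (use that a b linop_id in simp_all)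
  ultimately show ?thesis unfolding basis_def[of k "J \<union> J'"]
    using a b by blast
qed

definition finite_rep :: "nat \<Rightarrow> nat \<Rightarrow> nat \<Rightarrow> fam \<Rightarrow> bool" where
  "finite_rep k d m h \<longleftrightarrow> (\<exists>J \<delta>. basis k J \<delta> m \<and> card J \<le> d \<and> in_span J h)"

lemma finite_rep_image:
  assumes J: "basis k J \<delta> m" "card J \<le> d" and h: "in_span J h" and L: "linop L"
    and shift: "\<And>v i. v \<in> J \<Longrightarrow> i < k \<Longrightarrow>
        combination ((\<lambda>v t. L (v t)) ` J) m \<delta> (\<lambda>t s. L (v t) (incr i s))"
    and zero: "\<And>v. v \<in> J \<Longrightarrow> \<exists>c. degree c \<le> m \<and> (\<forall>t\<in>iv. poly \<delta> t * L (v t) (\<lambda>_. 0) = poly c t)"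
  shows "finite_rep k d m (\<lambda>t. L (h t))"
proof -
  note b = basisD[OF J(1)]
  let ?J = "(\<lambda>v t. L (v t)) ` J"
  have "basis k ?J \<delta> m"
    unfolding basis_def using b shift zero L unfolding linop_def by auto
  moreover have "card ?J \<le> d" using card_image_le[OF b(1)] J(2) order_trans by blast
  moreover have "in_span ?J (\<lambda>t. L (h t))"
    by (rule in_span_map[where J = J and L = L and h = h]) (use h b L in simp_all)
  ultimately show ?thesis unfolding finite_rep_def by blast
qed

text \<open>One factor \<open>\<delta>\<close> is spent on each increment between the zero state and
  \<open>s\<close>, and one on the value at the zero state; hence the exponent
  \<open>n + 1\<close>.\<close>

lemma basis_eval:
  assumes J: "basis k J \<delta> m" and v: "v \<in> J" and s: "s \<in> states k" "(\<Sum>i<k. s i) = n"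
  shows "\<exists>c. degree c \<le> m * (n + 1) \<and> (\<forall>t\<in>iv. poly \<delta> t ^ (n + 1) * v t s = poly c t)"
  using v s
proof (induction n arbitrary: v s)
  case 0
  then have "s = (\<lambda>_. 0)" by (auto simp: states_def fun_eq_iff not_less[symmetric])
  then show ?case using basisD(6)[OF J 0(1)] by simp
next
  case (Suc n)
  note b = basisD[OF J]
  have "\<exists>i<k. 0 < s i"
  proof (rule ccontr)
    assume "\<not> (\<exists>i<k. 0 < s i)"
    then show False using Suc(4) by simp
  qed
  then obtain i where i: "i < k" "0 < s i" by blast
  define s' where "s' = s(i := s i - 1)"
  have s: "s = incr i s'" using i(2) by (auto simp: s'_def incr_def)
  have "(\<Sum>j<k. s j) = s i + (\<Sum>j\<in>{..<k} - {i}. s j)" using i(1) by (intro sum.remove) auto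
  moreover have "(\<Sum>j<k. s' j) = s' i + (\<Sum>j\<in>{..<k} - {i}. s' j)" using i(1) by (intro sum.remove) auto
  moreover have "(\<Sum>j\<in>{..<k} - {i}. s' j) = (\<Sum>j\<in>{..<k} - {i}. s j)" by (rule sum.cong) (auto simp: s'_def)
  ultimately have n: "(\<Sum>j<k. s' j) = n" using Suc(4) i(2) by (simp add: s'_def)
  have s': "s' \<in> states k" using Suc(3) i(1) by (auto simp: states_def s'_def)
  obtain N where N: "\<And>w. degree (N w) \<le> m"
    "\<And>t s. t \<in> iv \<Longrightarrow> poly \<delta> t * v t (incr i s) = (\<Sum>w\<in>J. poly (N w) t * w t s)"
    using b(5)[OF Suc(2) i(1)] unfolding combination_def by blast
  have "\<forall>w\<in>J. \<exists>c. degree c \<le> m * (n + 1) \<and> (\<forall>t\<in>iv. poly \<delta> t ^ (n + 1) * w t s' = poly c t)"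
    using Suc.IH[OF _ s' n] by blast
  from bchoice[OF this] obtain c where c: "\<And>w. w \<in> J \<Longrightarrow> degree (c w) \<le> m * (n + 1)"
    "\<And>w t. w \<in> J \<Longrightarrow> t \<in> iv \<Longrightarrow> poly \<delta> t ^ (n + 1) * w t s' = poly (c w) t" by blast
  have "degree (\<Sum>w\<in>J. N w * c w) \<le> m * (Suc n + 1)"
  proof (rule degree_sum_le[OF b(1)])
    fix w assume "w \<in> J"
    then show "degree (N w * c w) \<le> m * (Suc n + 1)"
      using degree_mult_le[of "N w" "c w"] N(1)[of w] c(1)[of w] by simp
  qed
  moreover have "poly \<delta> t ^ (Suc n + 1) * v t s = poly (\<Sum>w\<in>J. N w * c w) t" if t: "t \<in> iv" for t
  proof -
    have "poly \<delta> t ^ (Suc n + 1) * v t s = poly \<delta> t ^ (n + 1) * (poly \<delta> t * v t (incr i s'))"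
      by (simp add: s)
    also have "\<dots> = (\<Sum>w\<in>J. poly (N w) t * (poly \<delta> t ^ (n + 1) * w t s'))"
      unfolding N(2)[OF t] sum_distrib_left by (simp add: mult_ac)
    also have "\<dots> = (\<Sum>w\<in>J. poly (N w) t * poly (c w) t)"
      by (rule sum.cong) (simp_all only: c(2)[OF _ t])
    finally show ?thesis by (simp add: poly_sum)
  qed
  ultimately show ?case by blast
qed

section \<open>Effect of the single statements on dimension and degree\<close>

primrec dist_deg :: "dist \<Rightarrow> nat" where
  "dist_deg (Ratio p q) = max (degree p) (degree q)"

lemma dist_reduced:
  assumes "valid_dist D"
  obtains p q a b :: "rat poly"
  where "fps_of_poly (rp q) * dist_fps D = fps_of_poly (rp p)" "rp a * rp p + rp b * rp q = 1"
    "degree p \<le> dist_deg D" "degree q \<le> dist_deg D"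
proof (cases D)
  case (Ratio P Q)
  from assms[unfolded Ratio] obtain p q a b :: "rat poly"
    where *: "p * map_poly of_int Q = map_poly of_int P * q" "a * p + b * q = 1"
      "degree p \<le> degree P" "degree q \<le> degree Q"
    by (rule reduced_fraction)
  have "rp p * map_poly of_int Q = map_poly of_int P * rp q"
    using arg_cong[OF *(1), of rp] by (simp add: rp_mult rp_of_int)
  from dist_fps_fraction[OF assms[unfolded Ratio] this]
  have "fps_of_poly (rp q) * dist_fps D = fps_of_poly (rp p)" unfolding Ratio .
  moreover have "rp a * rp p + rp b * rp q = 1"
    using arg_cong[OF *(2), of rp] by (simp add: rp_mult rp_add)
  ultimately show thesis using that *(3,4) by (simp add: Ratio)
qed

text \<open>With \<open>A\<close> the matrix of the increment of \<open>x\<close>, a draw is the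
  matrix \<open>D(A)\<close>, which \<open>matrix_fraction\<close> presents with polynomial
  numerators over \<open>\<Delta>\<close>. The row norm bound survives because \<open>D\<close> has
  total weight at most 1.\<close>

lemma draw_combination:
  assumes J: "basis k J \<delta> m" "card J \<le> d" and x: "x < k" and D: "valid_dist D"
  shows "\<exists>\<Delta>. degree \<Delta> \<le> d * dist_deg D * m \<and> (\<forall>t\<in>iv. poly \<Delta> t \<noteq> 0) \<and>
    (\<forall>v\<in>J. combination J (d * dist_deg D * m) \<Delta> (\<lambda>t. drawop x (dist_fps D) (v t)))"
proof -
  note b = basisD[OF J(1)]
  obtain p q a c where pq: "fps_of_poly (rp q) * dist_fps D = fps_of_poly (rp p)" "rp a * rp p + rp c * rp q = 1"
    "degree p \<le> dist_deg D" "degree q \<le> dist_deg D" using dist_reduced[OF D] by metis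
  have "\<forall>v\<in>J. \<exists>N. (\<forall>w. degree (N w) \<le> m) \<and>
     (\<forall>t\<in>iv. row_norm_le J (\<lambda>w. poly (N w) t) \<bar>poly \<delta> t\<bar> \<and>
       (\<forall>s. poly \<delta> t * v t (incr x s) = (\<Sum>w\<in>J. poly (N w) t * w t s)))"
    using b(5)[OF _ x] unfolding combination_def by blast
  from bchoice[OF this] obtain N where N: "\<And>v w. v \<in> J \<Longrightarrow> degree (N v w) \<le> m"
    "\<And>v t. v \<in> J \<Longrightarrow> t \<in> iv \<Longrightarrow> row_norm_le J (\<lambda>w. poly (N v w) t) \<bar>poly \<delta> t\<bar>"
    "\<And>v t s. v \<in> J \<Longrightarrow> t \<in> iv \<Longrightarrow> poly \<delta> t * v t (incr x s) = (\<Sum>w\<in>J. poly (N v w) t * w t s)" by blast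
  let ?m = "d * dist_deg D * m"
  let ?V = "\<lambda>t. matvec (\<lambda>v w. poly (N v w) t / poly \<delta> t) J"
  have "\<exists>Z \<Delta>. degree \<Delta> \<le> ?m \<and> (\<forall>t\<in>iv. poly \<Delta> t \<noteq> 0) \<and>
    (\<forall>v\<in>J. \<forall>w\<in>J. degree (Z v w) \<le> ?m) \<and>
    (\<forall>t\<in>iv. \<forall>v\<in>J. \<forall>\<xi>. (\<Sum>w\<in>J. poly (Z v w) t * \<xi> w) =
       poly \<Delta> t * shift_series (dist_fps D) (\<lambda>n. ?V t \<xi> n v) 0)"
    by (rule matrix_fraction[OF b(1) J(2) N(1) b(2,3) N(2) subprob_dist[OF D] pq(1,2)]) (use pq(3,4) in simp_all)
  then obtain Z \<Delta> where Z: "degree \<Delta> \<le> ?m" "\<And>t. t \<in> iv \<Longrightarrow> poly \<Delta> t \<noteq> 0"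
    "\<And>v w. v \<in> J \<Longrightarrow> w \<in> J \<Longrightarrow> degree (Z v w) \<le> ?m"
    "\<And>t v \<xi>. t \<in> iv \<Longrightarrow> v \<in> J \<Longrightarrow> (\<Sum>w\<in>J. poly (Z v w) t * \<xi> w) =
       poly \<Delta> t * shift_series (dist_fps D) (\<lambda>n. ?V t \<xi> n v) 0" by blast
  have contr1: "row_norm_le J (\<lambda>w. poly (N v w) t / poly \<delta> t) 1" if "v \<in> J" "t \<in> iv" for v t
    unfolding row_norm_le_def
  proof (intro allI impI)
    fix \<xi> assume "\<forall>w\<in>J. \<bar>\<xi> w\<bar> \<le> (1::real)"
    then have "\<bar>\<Sum>w\<in>J. poly (N v w) t * \<xi> w\<bar> \<le> \<bar>poly \<delta> t\<bar>"
      using N(2)[OF that] unfolding row_norm_le_def by blast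
    moreover have "(\<Sum>w\<in>J. poly (N v w) t / poly \<delta> t * \<xi> w) = (\<Sum>w\<in>J. poly (N v w) t * \<xi> w) / poly \<delta> t"
      by (simp add: sum_divide_distrib)
    ultimately show "\<bar>\<Sum>w\<in>J. poly (N v w) t / poly \<delta> t * \<xi> w\<bar> \<le> 1"
      using b(3)[OF that(2)] by (simp add: divide_le_eq_1)
  qed
  have combination: "combination J ?m \<Delta> (\<lambda>t. drawop x (dist_fps D) (v t))" if v: "v \<in> J" for v
  proof -
    let ?Z = "\<lambda>w. if w \<in> J then Z v w else 0"
    have eq: "(\<Sum>w\<in>J. poly (?Z w) t * \<xi> w) = poly \<Delta> t * shift_series (dist_fps D) (\<lambda>n. ?V t \<xi> n v) 0"
      if "t \<in> iv" for t \<xi>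
      using Z(4)[OF that v] by simp
    have "row_norm_le J (\<lambda>w. poly (?Z w) t) \<bar>poly \<Delta> t\<bar>" if t: "t \<in> iv" for t
      unfolding row_norm_le_def eq[OF t]
    proof (intro allI impI)
      fix \<xi> assume "\<forall>w\<in>J. \<bar>\<xi> w\<bar> \<le> (1::real)"
      then have "\<bar>?V t \<xi> n v\<bar> \<le> 1" for n
        using matvec_bounded[where J = J and \<xi> = \<xi> and B = 1, OF contr1[OF _ t] _ _ v] by simp
      then have "\<bar>shift_series (dist_fps D) (\<lambda>n. ?V t \<xi> n v) 0\<bar> \<le> 1"
        by (intro shift_series_abs_le subprob_dist D) auto
      then show "\<bar>poly \<Delta> t * shift_series (dist_fps D) (\<lambda>n. ?V t \<xi> n v) 0\<bar> \<le> \<bar>poly \<Delta> t\<bar>"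
        unfolding abs_mult by (intro mult_left_le) auto
    qed
    moreover have "poly \<Delta> t * drawop x (dist_fps D) (v t) s = (\<Sum>w\<in>J. poly (?Z w) t * w t s)" if t: "t \<in> iv" for t s
    proof -
      \<comment> \<open>\<open>A^n\<close> maps the vector of values at \<open>s\<close> to the
        vector of values after \<open>n\<close> increments of \<open>x\<close>.\<close>
      have "?V t (\<lambda>w. w t s) n w = w t (s(x := s x + n))" if "w \<in> J" for n w
        using that
      proof (induction n arbitrary: w)
        case (Suc n)
        have "s(x := s x + Suc n) = incr x (s(x := s x + n))" by (simp add: incr_def)
        then have "w t (s(x := s x + Suc n)) = (\<Sum>u\<in>J. poly (N w u) t * u t (s(x := s x + n))) / poly \<delta> t"
          using N(3)[OF Suc(2) t, of "s(x := s x + n)"] b(3)[OF t] by (simp add: eq_divide_eq mult.commute)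
        also have "\<dots> = (\<Sum>u\<in>J. poly (N w u) t / poly \<delta> t * ?V t (\<lambda>w. w t s) n u)"
          unfolding sum_divide_distrib by (rule sum.cong) (simp_all only: Suc.IH times_divide_eq_left)
        finally show ?case by (simp only: matvec.simps)
      qed simp
      then show ?thesis unfolding eq[OF t] by (simp add: drawop_shift_series v)
    qed
    ultimately show ?thesis unfolding combination_def by (intro exI[of _ ?Z]) (use Z(3)[OF v] in auto)
  qed
  then show ?thesis using Z(1,2) by blast
qed

text \<open>Draws commute with increments, so the drawn family keeps its shift matrices; the values
  at the zero state are what brings in the new denominator \<open>\<Delta>\<close>.\<close>

lemma finite_rep_draw:
  assumes h: "finite_rep k d m h" and x: "x < k" and D: "valid_dist D"
  shows "finite_rep k d (m + d * dist_deg D * m) (\<lambda>t. drawop x (dist_fps D) (h t))"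
proof -
  obtain J \<delta> where J: "basis k J \<delta> m" "card J \<le> d" and s: "in_span J h" using h unfolding finite_rep_def by blast
  note b = basisD[OF J(1)]
  let ?m = "d * dist_deg D * m"
  let ?L = "drawop x (dist_fps D)"
  have L: "linop ?L" by (rule linop_drawop[OF subprob_dist[OF D]])
  obtain \<Delta> where \<Delta>: "degree \<Delta> \<le> ?m" "\<And>t. t \<in> iv \<Longrightarrow> poly \<Delta> t \<noteq> 0"
    "\<And>v. v \<in> J \<Longrightarrow> combination J ?m \<Delta> (\<lambda>t. ?L (v t))" using draw_combination[OF J x D] by blast
  note B = basis_scale[OF J(1) \<Delta>(1,2)]
  show ?thesis
  proof (rule finite_rep_image[OF B J(2) s L])
    fix v i assume v: "v \<in> J" and i: "i < k"
    have "combination (((\<lambda>v t. ?L (v t)) ` J)) (m + ?m) (\<delta> * \<Delta>) (\<lambda>t. ?L (\<lambda>s. v t (incr i s)))"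
      by (rule combination_map[where L = ?L and J = J]) (use basisD[OF B] L v i in simp_all)
    moreover have "(\<lambda>t. ?L (\<lambda>s. v t (incr i s))) = (\<lambda>t s. ?L (v t) (incr i s))"
      by (intro ext) (rule drawop_incr)
    ultimately show "combination (((\<lambda>v t. ?L (v t)) ` J)) (m + ?m) (\<delta> * \<Delta>) (\<lambda>t s. ?L (v t) (incr i s))" by simp
  next
    fix v assume v: "v \<in> J"
    obtain N where N: "\<And>w. degree (N w) \<le> ?m"
      "\<And>t s. t \<in> iv \<Longrightarrow> poly \<Delta> t * ?L (v t) s = (\<Sum>w\<in>J. poly (N w) t * w t s)"
      using \<Delta>(3)[OF v] unfolding combination_def by blast
    have "\<forall>w\<in>J. \<exists>c. degree c \<le> m \<and> (\<forall>t\<in>iv. poly \<delta> t * w t (\<lambda>_. 0) = poly c t)" using b(6) by blast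
    from bchoice[OF this] obtain c where c: "\<And>w. w \<in> J \<Longrightarrow> degree (c w) \<le> m"
      "\<And>w t. w \<in> J \<Longrightarrow> t \<in> iv \<Longrightarrow> poly \<delta> t * w t (\<lambda>_. 0) = poly (c w) t" by blast
    have "degree (\<Sum>w\<in>J. N w * c w) \<le> m + ?m"
    proof (rule degree_sum_le[OF b(1)])
      fix w assume "w \<in> J"
      then show "degree (N w * c w) \<le> m + ?m"
        using degree_mult_le[of "N w" "c w"] N(1)[of w] c(1)[of w] by linarith
    qed
    moreover have "poly (\<delta> * \<Delta>) t * ?L (v t) (\<lambda>_. 0) = poly (\<Sum>w\<in>J. N w * c w) t" if t: "t \<in> iv" for t
    proof -
      have "poly (\<delta> * \<Delta>) t * ?L (v t) (\<lambda>_. 0) = poly \<delta> t * (\<Sum>w\<in>J. poly (N w) t * w t (\<lambda>_. 0))"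
        unfolding N(2)[OF t, symmetric] by simp
      also have "\<dots> = (\<Sum>w\<in>J. poly (N w) t * (poly \<delta> t * w t (\<lambda>_. 0)))"
        by (simp add: sum_distrib_left mult_ac)
      also have "\<dots> = (\<Sum>w\<in>J. poly (N w) t * poly (c w) t)"
        by (rule sum.cong) (simp_all only: c(2)[OF _ t])
      finally show ?thesis by (simp add: poly_sum)
    qed
    ultimately show "\<exists>c. degree c \<le> m + ?m \<and> (\<forall>t\<in>iv. poly (\<delta> * \<Delta>) t * ?L (v t) (\<lambda>_. 0) = poly c t)" by blast
  qed
qed

lemma finite_rep_mono: "finite_rep k d m h \<Longrightarrow> d \<le> d' \<Longrightarrow> m \<le> m' \<Longrightarrow> finite_rep k d' m' h"
  unfolding finite_rep_def using basis_mono by (meson order_trans)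

text \<open>At the zero state no sample is drawn, and an increment of \<open>y\<close> adds exactly
  one draw. So a single application of \<open>D(A)\<close> enters the shift matrices although the
  number of draws is unbounded.\<close>

lemma finite_rep_Incr:
  assumes h: "finite_rep k d m h" and x: "x < k" "y < k" and D: "valid_dist D"
  shows "finite_rep k d (m + d * dist_deg D * m) (\<lambda>t. wp (IncrIid x D y) (h t))"
proof -
  obtain J \<delta> where J: "basis k J \<delta> m" "card J \<le> d" and s: "in_span J h" using h unfolding finite_rep_def by blast
  note b = basisD[OF J(1)]
  let ?m = "d * dist_deg D * m"
  let ?D = "drawop x (dist_fps D)"
  let ?L = "\<lambda>f s. (?D ^^ s y) f s"
  have D: "linop ?D" by (rule linop_drawop[OF subprob_dist[OF D]])
  have L: "linop ?L" by (rule linop_funpow_at[OF D])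
  obtain \<Delta> where \<Delta>: "degree \<Delta> \<le> ?m" "\<And>t. t \<in> iv \<Longrightarrow> poly \<Delta> t \<noteq> 0"
    "\<And>v. v \<in> J \<Longrightarrow> combination J ?m \<Delta> (\<lambda>t. ?D (v t))" using draw_combination[OF J x(1) assms(4)] by blast
  note B = basis_scale[OF J(1) \<Delta>(1,2)]
  have "finite_rep k d (m + ?m) (\<lambda>t. ?L (h t))"
  proof (rule finite_rep_image[OF B J(2) s L])
    fix v i assume v: "v \<in> J" and i: "i < k"
    let ?g = "\<lambda>t s. v t (incr i s)"
    \<comment> \<open>For \<open>i = y\<close> the incremented state carries one more draw, which is
      absorbed into the function before \<open>?L\<close> is applied.\<close>
    let ?g' = "if i = y then (\<lambda>t. ?D (?g t)) else ?g"
    have "combination J (m + ?m) (\<delta> * \<Delta>) ?g'"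
    proof (cases "i = y")
      case True
      have "combination J (m + ?m) (\<delta> * \<Delta>) (\<lambda>t. ?D (?g t))"
        by (rule combination_trans[where L = ?D and J = J]) (use b D \<Delta> v i in simp_all)
      then show ?thesis using True by simp
    next
      case False
      then show ?thesis using basisD(5)[OF B v i] by simp
    qed
    then have "combination ((\<lambda>v t. ?L (v t)) ` J) (m + ?m) (\<delta> * \<Delta>) (\<lambda>t. ?L (?g' t))"
      by (rule combination_map[where L = ?L and J = J and g = ?g']) (use basisD[OF B] L in simp_all)
    moreover have "(\<lambda>t. ?L (?g' t)) = (\<lambda>t s. ?L (v t) (incr i s))"
    proof (intro ext)
      fix t s
      have 1: "(?D ^^ n) (\<lambda>s. f (incr i s)) s = (?D ^^ n) f (incr i s)" for n f
        using drawop_funpow_incr[of n x _ f i] by (simp add: fun_eq_iff)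
      show "?L (?g' t) s = ?L (v t) (incr i s)"
      proof (cases "i = y")
        case True
        have "?D (?g t) = (\<lambda>s. ?D (v t) (incr i s))" by (rule ext) (rule drawop_incr)
        then have "?L (?g' t) s = (?D ^^ s y) (?D (v t)) (incr i s)" using True 1[of "s y" "?D (v t)"] by simp
        also have "\<dots> = (?D ^^ Suc (s y)) (v t) (incr i s)" by (simp only: funpow_Suc_right o_def)
        finally show ?thesis using True by (simp add: incr_def)
      next
        case False
        then show ?thesis using 1 by (simp add: incr_def)
      qed
    qed
    ultimately show "combination ((\<lambda>v t. ?L (v t)) ` J) (m + ?m) (\<delta> * \<Delta>) (\<lambda>t s. ?L (v t) (incr i s))"
      by (simp only:)
  next
    fix v assume v: "v \<in> J"
    show "\<exists>c. degree c \<le> m + ?m \<and> (\<forall>t\<in>iv. poly (\<delta> * \<Delta>) t * ?L (v t) (\<lambda>_. 0) = poly c t)"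
      using basisD(6)[OF B v] by simp
  qed
  then show ?thesis by simp
qed

text \<open>After the assignment, increments of \<open>x\<close> have no effect, while the zero
  state is replaced by a state \<open>n\<close> increments away from it; this costs the power
  \<open>\<delta>^(n+1)\<close>.\<close>

lemma finite_rep_Assign:
  assumes h: "finite_rep k d m h" and x: "x < k"
  shows "finite_rep k d (m * (n + 1)) (\<lambda>t. wp (Assign x n) (h t))"
proof -
  obtain J \<delta> where J: "basis k J \<delta> m" "card J \<le> d" and s: "in_span J h" using h unfolding finite_rep_def by blast
  note b = basisD[OF J(1)]
  let ?L = "\<lambda>(f::obs) s. f (s(x := n))"
  have L: "linop ?L" by (rule linop_subst)
  have "degree (\<delta> ^ n) \<le> m * n"
    using degree_power_le[of \<delta> n] b(2) by (meson mult_le_mono1 order_trans)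
  note B = basis_scale[OF J(1) this]
  have B: "basis k J (\<delta> ^ (n + 1)) (m * (n + 1))" using B b(3) by (simp add: algebra_simps)
  have "finite_rep k d (m * (n + 1)) (\<lambda>t. ?L (h t))"
  proof (rule finite_rep_image[OF B J(2) s L])
    fix v i assume v: "v \<in> J" and i: "i < k"
    show "combination ((\<lambda>v t. ?L (v t)) ` J) (m * (n + 1)) (\<delta> ^ (n + 1)) (\<lambda>t s. ?L (v t) (incr i s))"
    proof (cases "i = x")
      case True
      have "(\<lambda>t s. ?L (v t) (incr i s)) = (\<lambda>t. ?L (v t))" using True by (simp add: incr_def)
      then show ?thesis using v basisD(1,2)[OF B] by (simp only:) (rule combination_elem, auto)
    next
      case False
      have "combination ((\<lambda>v t. ?L (v t)) ` J) (m * (n + 1)) (\<delta> ^ (n + 1)) (\<lambda>t. ?L (\<lambda>s. v t (incr i s)))"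
        by (rule combination_map[where L = ?L and J = J]) (use basisD[OF B] L v i in simp_all)
      moreover have "(incr i s)(x := n) = incr i (s(x := n))" for s using False by (auto simp: incr_def)
      ultimately show ?thesis by simp
    qed
  next
    fix v assume v: "v \<in> J"
    have "(\<lambda>_. 0)(x := n) \<in> states k" using x by (auto simp: states_def)
    moreover have "(\<Sum>i<k. ((\<lambda>_. 0)(x := n)) i) = n" using x by (simp add: sum.remove[of _ x])
    ultimately show "\<exists>c. degree c \<le> m * (n + 1) \<and> (\<forall>t\<in>iv. poly (\<delta> ^ (n + 1)) t * ?L (v t) (\<lambda>_. 0) = poly c t)"
      using basis_eval[OF J(1) v, of "(\<lambda>_. 0)(x := n)" n] by simp
  qed
  then show ?thesis by simp
qed

text \<open>Since \<open>(s x + 1) - 1 = s x\<close>, an increment of \<open>x\<close> leads from a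
  decremented function back to the original one. Both copies are kept, hence the factor 2.\<close>

lemma finite_rep_Decr:
  assumes h: "finite_rep k d m h" and x: "x < k"
  shows "finite_rep k (d * 2) m (\<lambda>t. wp (Decr x) (h t))"
proof -
  obtain J \<delta> where J: "basis k J \<delta> m" "card J \<le> d" and s: "in_span J h" using h unfolding finite_rep_def by blast
  note b = basisD[OF J(1)]
  let ?L = "\<lambda>(f::obs) s. f (s(x := s x - 1))"
  let ?J = "J \<union> (\<lambda>v t. ?L (v t)) ` J"
  have L: "linop ?L" by (rule linop_subst)
  have fin: "finite ?J" using b(1) by simp
  have up: "combination ?J m \<delta> g" if "combination J m \<delta> g" for g
    by (rule combination_map[where L = "\<lambda>f. f" and g = g and J = J]) (use that b linop_id in simp_all)
  have "combination ?J m \<delta> (\<lambda>t s. ?L (v t) (incr i s))" if v: "v \<in> J" and i: "i < k" for v i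
  proof (cases "i = x")
    case True
    have "(\<lambda>t s. ?L (v t) (incr i s)) = v" using True by (simp add: incr_def)
    then show ?thesis using combination_elem[OF fin _ b(2), of v] v by simp
  next
    case False
    have "combination ?J m \<delta> (\<lambda>t. ?L (\<lambda>s. v t (incr i s)))"
      by (rule combination_map[where L = ?L and J = J]) (use b L v i in simp_all)
    moreover have "(incr i s)(x := incr i s x - 1) = incr i (s(x := s x - 1))" for s using False by (auto simp: incr_def)
    ultimately show ?thesis by simp
  qed
  moreover have "(\<lambda>_. 0)(x := (0::nat) - 1) = (\<lambda>_. 0)" by auto
  ultimately have "basis k ?J \<delta> m"
    unfolding basis_def using b up fin L unfolding linop_def by auto
  moreover have "card ?J \<le> d * 2"
    using card_Un_le[of J "(\<lambda>v t. ?L (v t)) ` J"] card_image_le[OF b(1), of "\<lambda>v t. ?L (v t)"] J(2) by linarith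
  moreover have "in_span ?J (\<lambda>t. ?L (h t))"
    by (rule in_span_map[where J = J and L = ?L and h = h]) (use s b L in simp_all)
  ultimately show ?thesis unfolding finite_rep_def by auto
qed

text \<open>An increment of \<open>x\<close> turns the guard \<open>s x + i < n\<close> into the one
  with offset \<open>i + 1\<close>. Offsets stop at \<open>n\<close>, where the guard is false in
  every state, so \<open>n + 1\<close> masked copies are closed under increments.\<close>

lemma mask_basis:
  assumes J: "basis k J \<delta> m" "card J \<le> d" and s: "in_span J h" and x: "x < k"
  shows "\<exists>J'. basis k J' \<delta> m \<and> card J' \<le> (n + 1) * d \<and> in_span J' (\<lambda>t s. if (s x < n) = b then h t s else 0)"
proof -
  note B = basisD[OF J(1)]
  let ?L = "\<lambda>i (f::obs) s. if (s x + i < n) = b then f s else 0"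
  let ?\<phi> = "\<lambda>p t. ?L (fst p) (snd p t)"
  let ?J = "?\<phi> ` ({..n} \<times> J)"
  have L: "linop (?L i)" for i by (rule linop_mask)
  have fin: "finite ?J" using B(1) by simp
  have combination: "combination ?J m \<delta> (\<lambda>t s. ?L i (v t) (incr j s))" if v: "v \<in> J" and i: "i \<le> n" and j: "j < k" for v i j
  proof -
    let ?i = "if j = x then min (Suc i) n else i"
    have "combination ?J m \<delta> (\<lambda>t. ?L ?i (\<lambda>s. v t (incr j s)))"
    proof (rule combination_map[where L = "?L ?i" and J = J])
      show "(\<lambda>t. ?L ?i (w t)) \<in> ?J" if "w \<in> J" for w
        by (rule image_eqI[of _ _ "(?i, w)"], simp only: fst_conv snd_conv) (use i that in auto)
    qed (use B L v j fin in simp_all)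
    moreover have "(\<lambda>t. ?L ?i (\<lambda>s. v t (incr j s))) = (\<lambda>t s. ?L i (v t) (incr j s))"
      using i by (intro ext) (auto simp: incr_def min_def)
    ultimately show ?thesis by (simp only:)
  qed
  have zero: "\<exists>c. degree c \<le> m \<and> (\<forall>t\<in>iv. poly \<delta> t * ?L i (v t) (\<lambda>_. 0) = poly c t)" if "v \<in> J" for v i
  proof (cases "(i < n) = b")
    case True
    then show ?thesis using B(6)[OF that] by simp
  next
    case False
    then show ?thesis by (intro exI[of _ 0]) auto
  qed
  have "basis k ?J \<delta> m"
    unfolding basis_def
  proof (intro conjI ballI allI impI)
    fix v assume "v \<in> ?J"
    then obtain i w where v: "v = (\<lambda>t. ?L i (w t))" "i \<le> n" "w \<in> J" by auto
    show "unit_bounded (v t)" if "t \<in> iv" for t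
      using B(4)[OF v(3) that] unfolding v(1) unit_bounded_def by auto
    show "combination ?J m \<delta> (\<lambda>t s. v t (incr j s))" if "j < k" for j
      unfolding v(1) by (rule combination[OF v(3,2) that])
    show "\<exists>c. degree c \<le> m \<and> (\<forall>t\<in>iv. poly \<delta> t * v t (\<lambda>_. 0) = poly c t)"
      unfolding v(1) by (rule zero[OF v(3)])
  qed (use B fin in simp_all)
  moreover have "card ?J \<le> (n + 1) * d"
  proof -
    have "card ?J \<le> card ({..n} \<times> J)" by (rule card_image_le) (use B(1) in simp)
    also have "\<dots> = (n + 1) * card J" by (simp add: card_cartesian_product)
    also have "\<dots> \<le> (n + 1) * d" using J(2) by (rule mult_le_mono2)
    finally show ?thesis .
  qed
  moreover have "in_span ?J (\<lambda>t. ?L 0 (h t))"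
  proof (rule in_span_map[where J = J and L = "?L 0" and h = h])
    show "(\<lambda>t. ?L 0 (w t)) \<in> ?J" if "w \<in> J" for w
      by (rule image_eqI[of _ _ "(0, w)"], simp only: fst_conv snd_conv) (use that in auto)
    show "linop (?L 0)" by (rule L)
  qed (use s B fin in blast)+
  ultimately show ?thesis by (intro exI[of _ ?J]) simp
qed

text \<open>The conditional is the sum of its branches under complementary masks; uniting their
  families takes a common denominator, so the degrees add.\<close>

lemma finite_rep_If:
  assumes h: "finite_rep k d m h" "finite_rep k d' m' h'" and x: "x < k"
  shows "finite_rep k ((n + 1) * (d + d')) (m + m') (\<lambda>t s. if s x < n then h t s else h' t s)"
proof -
  obtain J \<delta> where J: "basis k J \<delta> m" "card J \<le> d" "in_span J h" using h(1) unfolding finite_rep_def by blast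
  obtain J' \<delta>' where J': "basis k J' \<delta>' m'" "card J' \<le> d'" "in_span J' h'" using h(2) unfolding finite_rep_def by blast
  obtain K where K: "basis k K \<delta> m" "card K \<le> (n + 1) * d" "in_span K (\<lambda>t s. if (s x < n) = True then h t s else 0)"
    using mask_basis[OF J x] by blast
  obtain K' where K': "basis k K' \<delta>' m'" "card K' \<le> (n + 1) * d'" "in_span K' (\<lambda>t s. if (s x < n) = False then h' t s else 0)"
    using mask_basis[OF J' x] by blast
  note B = basis_Un[OF K(1) K'(1)]
  have up: "in_span (K \<union> K') g" if "in_span K g \<or> in_span K' g" for g
    using that
  proof
    assume "in_span K g"
    then show ?thesis
      by (rule in_span_map[where L = "\<lambda>f. f" and h = g]) (use basisD[OF K(1)] basisD(1)[OF B] linop_id in simp_all)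
  next
    assume "in_span K' g"
    then show ?thesis
      by (rule in_span_map[where L = "\<lambda>f. f" and h = g]) (use basisD[OF K'(1)] basisD(1)[OF B] linop_id in simp_all)
  qed
  have "in_span (K \<union> K') (\<lambda>t s. (if (s x < n) = True then h t s else 0) + (if (s x < n) = False then h' t s else 0))"
    by (rule in_span_add; rule up) (use K(3) K'(3) in auto)
  moreover have "(\<lambda>t s. (if (s x < n) = True then h t s else 0) + (if (s x < n) = False then h' t s else 0))
      = (\<lambda>t s. if s x < n then h t s else h' t s)" by (intro ext) simp
  moreover have "card (K \<union> K') \<le> (n + 1) * (d + d')"
    using card_Un_le[of K K'] K(2) K'(2) by (simp add: algebra_simps)
  ultimately show ?thesis unfolding finite_rep_def using B by auto
qed

subsection \<open>Dimension and degree bounds\<close>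

primrec wp_dim :: "prog \<Rightarrow> nat" where
  "wp_dim (Assign x n) = 1"
| "wp_dim (Decr x) = 2"
| "wp_dim (IncrIid x D y) = 1"
| "wp_dim (IfLess x n P Q) = (n + 1) * (wp_dim P + wp_dim Q)"
| "wp_dim (Seq P Q) = wp_dim P * wp_dim Q"
| "wp_dim (WhileLess x n P) = 1"

text \<open>Dimension and degree bounds are factors, so sequencing multiplies them. The degree
  factor of a sampling statement depends on the current dimension; \<open>d\<close> stands for a
  bound on all dimensions that occur, which makes the factor independent of the context.\<close>

primrec wp_deg :: "nat \<Rightarrow> prog \<Rightarrow> nat" where
  "wp_deg d (Assign x n) = n + 1"
| "wp_deg d (Decr x) = 1"
| "wp_deg d (IncrIid x D y) = 1 + d * dist_deg D"
| "wp_deg d (IfLess x n P Q) = wp_deg d P + wp_deg d Q"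
| "wp_deg d (Seq P Q) = wp_deg d P * wp_deg d Q"
| "wp_deg d (WhileLess x n P) = 1"

lemma wp_dim_pos: "0 < wp_dim P" by (induction P) auto

lemma finite_rep_wp:
  assumes "loop_free P" "redip k P" "finite_rep k d m h" "d * wp_dim P \<le> D"
  shows "finite_rep k (d * wp_dim P) (m * wp_deg D P) (\<lambda>t. wp P (h t))"
  using assms
proof (induction P arbitrary: d m h)
  case (Assign x n)
  then show ?case using finite_rep_Assign[of k d m h x n] by simp
next
  case (Decr x)
  then show ?case using finite_rep_Decr[of k d m h x] by simp
next
  case (IncrIid x E y)
  have "finite_rep k d (m + d * dist_deg E * m) (\<lambda>t. wp (IncrIid x E y) (h t))"
    using IncrIid by (intro finite_rep_Incr) auto
  moreover have "m + d * dist_deg E * m \<le> m * wp_deg D (IncrIid x E y)"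
    using IncrIid(4) by (simp add: algebra_simps)
  ultimately show ?case using finite_rep_mono by simp
next
  case (IfLess x n P Q)
  have "d * (wp_dim P + wp_dim Q) \<le> d * wp_dim (IfLess x n P Q)" by simp
  then have "d * (wp_dim P + wp_dim Q) \<le> D" using IfLess(6) by linarith
  then have le: "d * wp_dim P \<le> D" "d * wp_dim Q \<le> D" by (simp_all add: algebra_simps)
  from IfLess have "finite_rep k (d * wp_dim P) (m * wp_deg D P) (\<lambda>t. wp P (h t))"
    "finite_rep k (d * wp_dim Q) (m * wp_deg D Q) (\<lambda>t. wp Q (h t))" and x: "x < k"
    using le by auto
  from finite_rep_If[OF this(1,2) x, of n]
  show ?case by (simp add: algebra_simps)
next
  case (Seq P Q)
  have "d * wp_dim Q \<le> d * wp_dim (Seq P Q)" using wp_dim_pos[of P] by simp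
  then have le: "d * wp_dim Q \<le> D" using Seq(6) by linarith
  have "finite_rep k (d * wp_dim Q) (m * wp_deg D Q) (\<lambda>t. wp Q (h t))"
    using Seq le by auto
  from Seq.IH(1)[OF _ _ this] Seq.prems
  show ?case by (simp add: mult_ac)
qed simp

lemma finite_rep_determined:
  assumes h: "finite_rep k d m h" and t: "t \<in> iv" and x: "x < k"
  shows "determined d (\<lambda>n. h t (s(x := s x + n)))"
proof -
  obtain J \<delta> where J: "basis k J \<delta> m" "card J \<le> d" "in_span J h" using h unfolding finite_rep_def by blast
  note b = basisD[OF J(1)]
  obtain \<alpha> where \<alpha>: "\<And>s. h t s = (\<Sum>w\<in>J. \<alpha> w * w t s)" using J(3) t unfolding in_span_def by blast
  have "\<forall>v\<in>J. \<exists>N. \<forall>s. poly \<delta> t * v t (incr x s) = (\<Sum>w\<in>J. poly (N w) t * w t s)"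
    using b(5)[OF _ x] t unfolding combination_def by blast
  from bchoice[OF this] obtain N where
    N: "\<And>v s. v \<in> J \<Longrightarrow> poly \<delta> t * v t (incr x s) = (\<Sum>w\<in>J. poly (N v w) t * w t s)" by blast
  show ?thesis
  proof (rule determined_shift_family[OF b(1) J(2), where G = "\<lambda>w n. w t (s(x := s x + n))" and
        A = "\<lambda>v w. poly (N v w) t / poly \<delta> t" and \<alpha> = \<alpha>])
    fix w n assume w: "w \<in> J"
    have "s(x := s x + Suc n) = incr x (s(x := s x + n))" by (simp add: incr_def)
    then have "w t (s(x := s x + Suc n)) = (\<Sum>u\<in>J. poly (N w u) t * u t (s(x := s x + n))) / poly \<delta> t"
      using N[OF w, of "s(x := s x + n)"] b(3)[OF t] by (simp add: eq_divide_eq mult.commute)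
    then show "w t (s(x := s x + Suc n)) = (\<Sum>u\<in>J. poly (N w u) t / poly \<delta> t * u t (s(x := s x + n)))"
      by (simp only: sum_divide_distrib times_divide_eq_left)
  qed (rule \<alpha>)
qed

text \<open>Along each coordinate the values form a sequence determined by its first
  \<open>d\<close> terms, so zeros on the cube of side \<open>d\<close> spread one coordinate after
  another.\<close>

lemma finite_rep_vanish:
  assumes h: "finite_rep k d m h" and t: "t \<in> iv"
    and z: "\<And>s. s \<in> states k \<Longrightarrow> (\<And>i. i < k \<Longrightarrow> s i < d) \<Longrightarrow> h t s = 0"
  shows "s \<in> states k \<Longrightarrow> h t s = 0"
proof -
  have "\<forall>s\<in>states k. (\<forall>i. j \<le> i \<longrightarrow> i < k \<longrightarrow> s i < d) \<longrightarrow> h t s = 0" if "j \<le> k" for j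
    using that
  proof (induction j)
    case 0
    then show ?case using z by simp
  next
    case (Suc j)
    show ?case
    proof (intro ballI impI)
      fix s assume s: "s \<in> states k" "\<forall>i. Suc j \<le> i \<longrightarrow> i < k \<longrightarrow> s i < d"
      \<comment> \<open>The line through \<open>s\<close> in direction \<open>j\<close>, started at
        0. Its terms are read through \<open>act 1\<close>, the form in which
        \<open>determined\<close> speaks about zeros.\<close>
      let ?F = "\<lambda>n. h t ((s(j := 0))(j := (s(j := 0)) j + n))"
      have c: "determined d ?F" by (rule finite_rep_determined[OF h t]) (use Suc.prems in simp)
      have "act 1 ?F n = 0" if "n < d" for n
      proof -
        let ?s = "s(j := n)"
        have "?s \<in> states k" using s(1) Suc.prems by (auto simp: states_def)
        moreover have "\<forall>i. j \<le> i \<longrightarrow> i < k \<longrightarrow> ?s i < d" using s(2) that by auto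
        ultimately show ?thesis using Suc by simp
      qed
      then have "act 1 ?F (s j) = 0" using c unfolding determined_def by blast
      then show "h t s = 0" by simp
    qed
  qed
  from this[of k] show "s \<in> states k \<Longrightarrow> h t s = 0" by auto
qed

text \<open>Once the power of \<open>\<delta>\<close> is cleared, the value at \<open>s\<close> is a
  polynomial in \<open>t\<close> whose degree is smaller than the number of its zeros in
  \<open>A\<close>.\<close>

lemma finite_rep_degree:
  assumes h: "finite_rep k d m h" and s: "s \<in> states k" "(\<Sum>i<k. s i) \<le> n"
    and A: "finite A" "A \<subseteq> iv" "m * (n + 1) < card A" "\<And>t. t \<in> A \<Longrightarrow> h t s = 0" and t: "t \<in> iv"
  shows "h t s = 0"
proof -
  define l where "l = (\<Sum>i<k. s i)"
  obtain J \<delta> where J: "basis k J \<delta> m" "card J \<le> d" "in_span J h" using h unfolding finite_rep_def by blast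
  note b = basisD[OF J(1)]
  obtain \<alpha> where \<alpha>: "\<And>t s. t \<in> iv \<Longrightarrow> h t s = (\<Sum>w\<in>J. \<alpha> w * w t s)" using J(3) unfolding in_span_def by blast
  have "\<forall>w\<in>J. \<exists>c. degree c \<le> m * (l + 1) \<and> (\<forall>t\<in>iv. poly \<delta> t ^ (l + 1) * w t s = poly c t)"
    using basis_eval[OF J(1) _ s(1)] by (simp add: l_def)
  from bchoice[OF this] obtain c where c: "\<And>w. w \<in> J \<Longrightarrow> degree (c w) \<le> m * (l + 1)"
    "\<And>w t. w \<in> J \<Longrightarrow> t \<in> iv \<Longrightarrow> poly \<delta> t ^ (l + 1) * w t s = poly (c w) t" by blast
  define p where "p = (\<Sum>w\<in>J. [:\<alpha> w:] * c w)"
  have p: "poly \<delta> t ^ (l + 1) * h t s = poly p t" if "t \<in> iv" for t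
  proof -
    have "poly \<delta> t ^ (l + 1) * h t s = (\<Sum>w\<in>J. \<alpha> w * (poly \<delta> t ^ (l + 1) * w t s))"
      unfolding \<alpha>[OF that] sum_distrib_left by (rule sum.cong) (simp_all only: mult.left_commute)
    also have "\<dots> = (\<Sum>w\<in>J. \<alpha> w * poly (c w) t)"
      by (rule sum.cong) (simp_all only: c(2)[OF _ that])
    finally show ?thesis by (simp add: p_def poly_sum)
  qed
  have "p = 0"
  proof (rule ccontr)
    assume nz: "p \<noteq> 0"
    have "degree p \<le> m * (l + 1)"
      unfolding p_def
    proof (rule degree_sum_le[OF b(1)])
      fix w assume "w \<in> J"
      then show "degree ([:\<alpha> w:] * c w) \<le> m * (l + 1)"
        using degree_mult_le[of "[:\<alpha> w:]" "c w"] c(1)[of w] by simp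
    qed
    also have "\<dots> \<le> m * (n + 1)" using s(2) by (simp add: l_def)
    also have "\<dots> < card A" by (rule A(3))
    also have "card A \<le> card {t. poly p t = 0}"
    proof (rule card_mono)
      show "finite {t. poly p t = 0}" by (rule poly_roots_finite[OF nz])
      show "A \<subseteq> {t. poly p t = 0}" using p A(2,4) by force
    qed
    also have "\<dots> \<le> degree p" by (rule card_poly_roots_bound[OF nz])
    finally show False by simp
  qed
  then show ?thesis using p[OF t] b(3)[OF t] by simp
qed

lemma finite_rep_diff:
  assumes "finite_rep k d m h" "finite_rep k d' m' h'"
  shows "finite_rep k (d + d') (m + m') (\<lambda>t s. h t s - h' t s)"
proof -
  obtain J \<delta> where J: "basis k J \<delta> m" "card J \<le> d" "in_span J h" using assms(1) unfolding finite_rep_def by blast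
  obtain J' \<delta>' where J': "basis k J' \<delta>' m'" "card J' \<le> d'" "in_span J' h'" using assms(2) unfolding finite_rep_def by blast
  note B = basis_Un[OF J(1) J'(1)]
  have 1: "in_span (J \<union> J') h"
    by (rule in_span_map[where L = "\<lambda>f. f" and h = h and J = J]) (use J(3) basisD[OF J(1)] basisD(1)[OF B] linop_id in simp_all)
  have "in_span (J \<union> J') h'"
    by (rule in_span_map[where L = "\<lambda>f. f" and h = h' and J = J']) (use J'(3) basisD[OF J'(1)] basisD(1)[OF B] linop_id in simp_all)
  from in_span_add[OF 1 in_span_uminus[OF this]] have "in_span (J \<union> J') (\<lambda>t s. h t s - h' t s)" by simp
  moreover have "card (J \<union> J') \<le> d + d'" using card_Un_le[of J J'] J(2) J'(2) by linarith
  ultimately show ?thesis unfolding finite_rep_def using B by blast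
qed

text \<open>An increment of coordinate \<open>i\<close> multiplies the product by
  \<open>u i\<close>, or by \<open>t\<close> when \<open>i = j\<close>. One function therefore
  suffices, \<open>t\<close> enters linearly, and the factors are at most 1, as the row norm
  requires.\<close>

lemma finite_rep_pvals:
  assumes u: "\<And>i. 0 < u i \<and> u i < 1"
  shows "finite_rep k 1 1 (\<lambda>t. pvals k (u(j := t)))"
proof -
  let ?f = "\<lambda>t. pvals k (u(j := t))"
  have b: "unit_bounded (?f t)" if "t \<in> iv" for t
    by (rule unit_bounded_pvals) (use u that in auto)
  have shift: "?f t (incr i s) = (u(j := t)) i * ?f t s" if "i < k" for i t s
  proof -
    let ?u = "u(j := t)"
    have "?f t (incr i s) = ?u i ^ Suc (s i) * (\<Prod>l\<in>{..<k} - {i}. ?u l ^ incr i s l)"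
      unfolding pvals_def using that by (subst prod.remove[of _ i]) (auto simp: incr_def)
    also have "(\<Prod>l\<in>{..<k} - {i}. ?u l ^ incr i s l) = (\<Prod>l\<in>{..<k} - {i}. ?u l ^ s l)"
      by (rule prod.cong) (auto simp: incr_def)
    also have "?u i ^ Suc (s i) * \<dots> = ?u i * ?f t s"
      unfolding pvals_def using that by (subst prod.remove[of "{..<k}" i]) auto
    finally show ?thesis .
  qed
  have "basis k {?f} 1 1"
    unfolding basis_def
  proof (intro conjI ballI allI impI; (simp; fail)?)
    fix v t assume "v \<in> {?f}" and "t \<in> iv"
    then show "unit_bounded (v t)" using b by simp
  next
    fix v i assume v: "v \<in> {?f}" and i: "i < k"
    let ?p = "if i = j then [:0, 1:] else [:u i:]"
    have p: "poly ?p t = (u(j := t)) i" for t by simp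
    show "combination {?f} 1 1 (\<lambda>t s. v t (incr i s))"
      unfolding combination_def
    proof (intro exI[of _ "\<lambda>_. ?p"] conjI ballI allI)
      fix t assume "t \<in> iv"
      then have "\<bar>poly ?p t\<bar> \<le> 1" unfolding p using u[of i] by auto
      then show "row_norm_le {?f} (\<lambda>w. poly ?p t) \<bar>poly 1 t\<bar>"
        unfolding row_norm_le_def by (auto simp del: fun_upd_apply simp: abs_mult intro!: mult_le_one)
      show "poly 1 t * v t (incr i s) = (\<Sum>w\<in>{?f}. poly ?p t * w t s)" for s
        unfolding p using v shift[OF i] by simp
    qed simp
  next
    fix v assume "v \<in> {?f}"
    then show "\<exists>c. degree c \<le> 1 \<and> (\<forall>t\<in>iv. poly 1 t * v t (\<lambda>_. 0) = poly c t)"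
      by (intro exI[of _ 1]) (simp add: pvals_def)
  qed
  moreover have "in_span {?f} ?f" unfolding in_span_def by (intro exI[of _ "\<lambda>_. 1"]) simp
  ultimately show ?thesis unfolding finite_rep_def by (intro exI[of _ "{?f}"]) auto
qed

subsection \<open>The grid\<close>

text \<open>The offset 2 puts all points strictly inside the unit interval; distinct indices give
  distinct points.\<close>

definition gridpt :: "(nat \<Rightarrow> nat) \<Rightarrow> nat \<Rightarrow> real" where
  "gridpt \<gamma> i = 1 / (real (\<gamma> i) + 2)"

lemma gridpt_iv: "0 < gridpt \<gamma> i \<and> gridpt \<gamma> i < 1"
  by (simp add: gridpt_def field_simps)

lemma pvals_cong: "(\<And>i. i < k \<Longrightarrow> u i = u' i) \<Longrightarrow> pvals k u = pvals k u'"
  unfolding pvals_def by (intro ext prod.cong) auto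

theorem wp_eq_grid:
  assumes P: "loop_free P" "redip k P" and Q: "loop_free Q" "redip k Q"
    and d: "wp_dim P + wp_dim Q \<le> d" and M: "(wp_deg d P + wp_deg d Q) * (k * d + 1) < M"
    and grid: "\<And>\<gamma> s. (\<And>i. i < k \<Longrightarrow> \<gamma> i < M) \<Longrightarrow> s \<in> states k \<Longrightarrow> (\<And>i. i < k \<Longrightarrow> s i < d) \<Longrightarrow>
        wp P (pvals k (gridpt \<gamma>)) s = wp Q (pvals k (gridpt \<gamma>)) s"
    and u: "\<And>i. 0 < u i \<and> u i < 1" and s: "s \<in> states k"
  shows "wp P (pvals k u) s = wp Q (pvals k u) s"
proof -
  let ?h = "\<lambda>u s. wp P (pvals k u) s - wp Q (pvals k u) s"
  have R: "finite_rep k (wp_dim P + wp_dim Q) (wp_deg d P + wp_deg d Q) (\<lambda>t. ?h (u(j := t)))"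
    if u: "\<And>i. 0 < u i \<and> u i < 1" for u j
  proof -
    have "finite_rep k (1 * wp_dim P) (1 * wp_deg d P) (\<lambda>t. wp P (pvals k (u(j := t))))"
      by (rule finite_rep_wp[OF P finite_rep_pvals[OF u]]) (use d in simp)
    moreover have "finite_rep k (1 * wp_dim Q) (1 * wp_deg d Q) (\<lambda>t. wp Q (pvals k (u(j := t))))"
      by (rule finite_rep_wp[OF Q finite_rep_pvals[OF u]]) (use d in simp)
    ultimately show ?thesis using finite_rep_diff by fastforce
  qed
  \<comment> \<open>Coordinates below \<open>j\<close> are already arbitrary, the others are grid
    points. The number of grid points exceeds the degree available for states of total at most
    \<open>k * d\<close>, which covers the whole cube of side \<open>d\<close>.\<close>
  have claim: "\<forall>u. (\<forall>i. 0 < u i \<and> u i < 1) \<longrightarrow> (\<forall>i. j \<le> i \<longrightarrow> i < k \<longrightarrow> (\<exists>g<M. u i = 1 / (real g + 2))) \<longrightarrow>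
      (\<forall>s\<in>states k. (\<forall>i<k. s i < d) \<longrightarrow> ?h u s = 0)" if "j \<le> k" for j
    using that
  proof (induction j)
    case 0
    show ?case
    proof (intro allI impI ballI)
      fix u s assume u: "\<forall>i. 0 \<le> i \<longrightarrow> i < k \<longrightarrow> (\<exists>g<M. u i = 1 / (real g + 2))"
        and s: "s \<in> states k" "\<forall>i<k. s i < d"
      from u have "\<forall>i. \<exists>g. i < k \<longrightarrow> g < M \<and> u i = 1 / (real g + 2)" by auto
      then obtain \<gamma> where \<gamma>: "\<And>i. i < k \<Longrightarrow> \<gamma> i < M \<and> u i = 1 / (real (\<gamma> i) + 2)" by metis
      have "pvals k u = pvals k (gridpt \<gamma>)" by (rule pvals_cong) (use \<gamma> in \<open>auto simp: gridpt_def\<close>)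
      then show "?h u s = 0" using grid[of \<gamma> s] \<gamma> s by simp
    qed
  next
    case (Suc j)
    show ?case
    proof (intro allI impI ballI)
      fix u s assume u: "\<forall>i. 0 < u i \<and> u i < 1" "\<forall>i. Suc j \<le> i \<longrightarrow> i < k \<longrightarrow> (\<exists>g<M. u i = 1 / (real g + 2))"
        and s: "s \<in> states k" "\<forall>i<k. s i < d"
      let ?T = "(\<lambda>g. 1 / (real g + 2)) ` {..<M}"
      have inj: "inj_on (\<lambda>g. 1 / (real g + 2)) {..<M}"
        by (rule inj_onI) (simp add: field_simps)
      have "?h (u(j := u j)) s = 0"
      proof (rule finite_rep_degree[OF R[of u j] s(1), where A = ?T and n = "k * d"])
        have "(\<Sum>i<k. s i) \<le> (\<Sum>i<k. d)" by (rule sum_mono) (use s(2) in \<open>auto simp: less_imp_le\<close>)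
        then show "(\<Sum>i<k. s i) \<le> k * d" by simp
        show "(wp_deg d P + wp_deg d Q) * (k * d + 1) < card ?T" using M by (simp add: card_image[OF inj])
        show "?T \<subseteq> iv" by (auto simp: field_simps)
        show "?h (u(j := t)) s = 0" if t: "t \<in> ?T" for t
        proof -
          let ?u = "u(j := t)"
          have "\<forall>i. 0 < ?u i \<and> ?u i < 1" using u(1) t by (auto simp: field_simps)
          moreover have "\<forall>i. j \<le> i \<longrightarrow> i < k \<longrightarrow> (\<exists>g<M. ?u i = 1 / (real g + 2))"
          proof (intro allI impI)
            fix i assume i: "j \<le> i" "i < k"
            show "\<exists>g<M. ?u i = 1 / (real g + 2)"
            proof (cases "i = j")
              case True
              then show ?thesis using t by auto
            next
              case False
              then show ?thesis using u(2) i by simp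
            qed
          qed
          ultimately show ?thesis using Suc s by auto
        qed
      qed (use u in auto)
      then show "?h u s = 0" by simp
    qed
  qed
  \<comment> \<open>Only now is the restriction to small states dropped. Here \<open>u\<close> stays
    fixed, so the parameter coordinate is set to its own value.\<close>
  have "?h (u(0 := u 0)) s = 0"
  proof (rule finite_rep_vanish[OF R[where j = 0, OF u] _ _ s])
    show "u 0 \<in> iv" using u by simp
    fix s assume s: "s \<in> states k" "\<And>i. i < k \<Longrightarrow> s i < wp_dim P + wp_dim Q"
    then have "\<forall>i<k. s i < d" using d by (auto intro: less_le_trans)
    then show "?h (u(0 := u 0)) s = 0" using claim[of k] u s(1) by auto
  qed
  then show ?thesis by simp
qed

subsection \<open>Bounds in terms of codes\<close>

lemma prod_encode_ge: "a + b \<le> prod_encode (a, b)"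
proof -
  have "n \<le> triangle n" for n by (induction n) auto
  from this[of "a + b"] show ?thesis by (simp add: prod_encode_def)
qed

lemma length_list_encode: "length xs \<le> list_encode xs"
proof (induction xs)
  case (Cons x xs)
  then show ?case using prod_encode_ge[of x "list_encode xs"] by simp
qed simp

lemma degree_poly_encode: "degree p \<le> poly_encode p"
proof -
  have "degree p \<le> length (coeffs p)" by (cases "p = 0") (auto simp: length_coeffs_degree)
  then show ?thesis using length_list_encode[of "map int_encode (coeffs p)"] by (simp add: poly_encode_def)
qed

lemma dist_deg_encode: "dist_deg D \<le> dist_encode D"
proof (cases D)
  case (Ratio p q)
  then show ?thesis
    using degree_poly_encode[of p] degree_poly_encode[of q] prod_encode_ge[of "poly_encode p" "poly_encode q"]
    by simp
qed

lemma prog_encode_bounds: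
  "n \<le> prog_encode (Assign x n)" "1 \<le> prog_encode (Decr x)"
  "dist_deg D \<le> prog_encode (IncrIid x D y)"
  "1 + n + prog_encode P + prog_encode Q \<le> prog_encode (IfLess x n P Q)"
  "prog_encode P + prog_encode Q \<le> prog_encode (Seq P Q)"
proof -
  show "n \<le> prog_encode (Assign x n)"
    using prod_encode_ge[of 0 "prod_encode (x, n)"] prod_encode_ge[of x n] by simp
  show "1 \<le> prog_encode (Decr x)" using prod_encode_ge[of 1 x] by simp
  show "dist_deg D \<le> prog_encode (IncrIid x D y)"
    using prod_encode_ge[of 2 "prod_encode (x, prod_encode (dist_encode D, y))"]
      prod_encode_ge[of x "prod_encode (dist_encode D, y)"] prod_encode_ge[of "dist_encode D" y]
      dist_deg_encode[of D] by simp
  show "1 + n + prog_encode P + prog_encode Q \<le> prog_encode (IfLess x n P Q)"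
    using prod_encode_ge[of 3 "prod_encode (prod_encode (x, n), prod_encode (prog_encode P, prog_encode Q))"]
      prod_encode_ge[of "prod_encode (x, n)" "prod_encode (prog_encode P, prog_encode Q)"]
      prod_encode_ge[of x n] prod_encode_ge[of "prog_encode P" "prog_encode Q"] by simp
  show "prog_encode P + prog_encode Q \<le> prog_encode (Seq P Q)"
    using prod_encode_ge[of 4 "prod_encode (prog_encode P, prog_encode Q)"]
      prod_encode_ge[of "prog_encode P" "prog_encode Q"] by simp
qed

lemma Suc_le_two_power: "n + 1 \<le> (2 :: nat) ^ n"
  using Suc_leI[OF less_exp[of n]] by (simp only: Suc_eq_plus1)

text \<open>Bounds by powers of the code of the program make the size of the grid an arithmetic
  function of the input, so that no recursion over coded programs has to be computed for it.\<close>

lemma wp_dim_wp_deg_bound: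
  "wp_dim P \<le> 2 ^ prog_encode P \<and> 1 \<le> wp_deg d P \<and> wp_deg d P \<le> (d + 2) ^ prog_encode P"
proof (induction P)
  case (Assign x n)
  have "n + 1 \<le> 2 ^ n" by (rule Suc_le_two_power)
  also have "(2 :: nat) ^ n \<le> (d + 2) ^ n" by (rule power_mono) auto
  also have "\<dots> \<le> (d + 2) ^ prog_encode (Assign x n)"
    by (rule power_increasing[OF prog_encode_bounds(1)]) simp
  finally show ?case by (simp del: prog_encode.simps)
next
  case (Decr x)
  have "(2::nat) ^ 1 \<le> 2 ^ prog_encode (Decr x)"
    by (rule power_increasing[OF prog_encode_bounds(2)]) simp
  then show ?case by (simp del: prog_encode.simps)
next
  case (IncrIid x D y)
  \<comment> \<open>Bernoulli's inequality, which turns the linear factor of a sampling statement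
    into a power.\<close>
  have "1 + d * e \<le> (1 + d) ^ e" for e
  proof (induction e)
    case (Suc e)
    have "1 + d * Suc e \<le> (1 + d) * (1 + d * e)" by (simp add: algebra_simps)
    also have "\<dots> \<le> (1 + d) ^ Suc e" using mult_le_mono2[OF Suc, of "1 + d"] by simp
    finally show ?case .
  qed simp
  then have "1 + d * dist_deg D \<le> (1 + d) ^ dist_deg D" .
  also have "\<dots> \<le> (d + 2) ^ dist_deg D" by (rule power_mono) auto
  also have "\<dots> \<le> (d + 2) ^ prog_encode (IncrIid x D y)"
    by (rule power_increasing[OF prog_encode_bounds(3)]) simp
  finally show ?case by (simp del: prog_encode.simps)
next
  case (IfLess x n P Q)
  let ?p = "prog_encode P" and ?q = "prog_encode Q" and ?c = "prog_encode (IfLess x n P Q)"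
  have sum: "a + b \<le> 2 * (a * b)" if "1 \<le> a" "1 \<le> b" for a b :: nat
  proof -
    have "a * 1 \<le> a * b" "1 * b \<le> a * b" using that by (intro mult_le_mono; simp)+
    then show ?thesis by (simp only: mult_1 mult_1_right)
  qed
  have "(n + 1) * (wp_dim P + wp_dim Q) \<le> 2 ^ n * (2 ^ ?p + 2 ^ ?q)"
    using IfLess by (intro mult_le_mono add_mono Suc_le_two_power) auto
  also have "\<dots> \<le> 2 ^ n * (2 * (2 ^ ?p * 2 ^ ?q))" by (intro mult_le_mono2 sum) auto
  also have "\<dots> = 2 ^ (1 + n + ?p + ?q)" by (simp add: power_add)
  also have "\<dots> \<le> 2 ^ ?c" by (rule power_increasing[OF prog_encode_bounds(4)]) simp
  finally have 1: "wp_dim (IfLess x n P Q) \<le> 2 ^ ?c" by simp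
  have "wp_deg d P + wp_deg d Q \<le> (d + 2) ^ ?p + (d + 2) ^ ?q" using IfLess by simp
  also have "\<dots> \<le> 2 * ((d + 2) ^ ?p * (d + 2) ^ ?q)" by (rule sum) simp_all
  also have "\<dots> \<le> (d + 2) * ((d + 2) ^ ?p * (d + 2) ^ ?q)" by (rule mult_le_mono1) simp
  also have "\<dots> = (d + 2) ^ (1 + ?p + ?q)" by (simp add: power_add)
  also have "\<dots> \<le> (d + 2) ^ ?c"
    by (rule power_increasing) (use prog_encode_bounds(4)[of n P Q x] in linarith, simp)
  finally show ?case using 1 IfLess by (simp del: prog_encode.simps)
next
  case (Seq P Q)
  let ?p = "prog_encode P" and ?q = "prog_encode Q" and ?c = "prog_encode (Seq P Q)"
  have "wp_dim P * wp_dim Q \<le> 2 ^ (?p + ?q)" unfolding power_add using Seq by (intro mult_le_mono) auto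
  also have "\<dots> \<le> 2 ^ ?c" by (rule power_increasing[OF prog_encode_bounds(5)]) simp
  finally have 1: "wp_dim (Seq P Q) \<le> 2 ^ ?c" by simp
  have "wp_deg d P * wp_deg d Q \<le> (d + 2) ^ (?p + ?q)" unfolding power_add using Seq by (intro mult_le_mono) auto
  also have "\<dots> \<le> (d + 2) ^ ?c" by (rule power_increasing[OF prog_encode_bounds(5)]) simp
  finally have 2: "wp_deg d (Seq P Q) \<le> (d + 2) ^ ?c" by simp
  have "1 * 1 \<le> wp_deg d P * wp_deg d Q" using Seq by (intro mult_le_mono) auto
  then show ?case using 1 2 by simp
qed simp

subsection \<open>Continuations\<close>

text \<open>\<open>Draw x D m\<close> adds \<open>m\<close> samples of \<open>D\<close> to \<open>x\<close>.\<close>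

datatype instr = Run prog | Draw nat dist nat

primrec wpi :: "instr \<Rightarrow> obs \<Rightarrow> obs" where
  "wpi (Run P) = wp P"
| "wpi (Draw x D m) = drawop x (dist_fps D) ^^ m"

primrec wps :: "instr list \<Rightarrow> obs \<Rightarrow> obs" where
  "wps [] f = f"
| "wps (i # is) f = wpi i (wps is f)"

primrec instr_ok :: "nat \<Rightarrow> instr \<Rightarrow> bool" where
  "instr_ok k (Run P) \<longleftrightarrow> loop_free P \<and> redip k P"
| "instr_ok k (Draw x D m) \<longleftrightarrow> x < k \<and> valid_dist D"

primrec instr_dim :: "instr \<Rightarrow> nat" where
  "instr_dim (Run P) = wp_dim P"
| "instr_dim (Draw x D m) = 1"

definition cont_dim :: "instr list \<Rightarrow> nat" where
  "cont_dim is = prod_list (map instr_dim is)"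

lemma cont_dim_Cons [simp]: "cont_dim [] = 1" "cont_dim (i # is) = instr_dim i * cont_dim is"
  by (simp_all add: cont_dim_def)

text \<open>Programs use the tags 0 to 5, so tag 6 marks a pending draw and \<open>Run\<close> needs
  no tag of its own.\<close>

primrec instr_code :: "instr \<Rightarrow> nat" where
  "instr_code (Run P) = prog_encode P"
| "instr_code (Draw x D m) = prod_encode (6, prod_encode (x, prod_encode (dist_encode D, m)))"

definition cont_code :: "instr list \<Rightarrow> nat" where
  "cont_code is = list_encode (map instr_code is)"

lemma cont_code_Cons: "cont_code [] = 0" "cont_code (i # is) = seq_cons (instr_code i) (cont_code is)"
  by (simp_all add: cont_code_def seq_cons_def)

lemma wps_unit_bounded: "list_all (instr_ok k) is \<Longrightarrow> unit_bounded f \<Longrightarrow> unit_bounded (wps is f)"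
proof (induction "is")
  case (Cons i "is")
  then show ?case
    by (cases i) (auto simp: drawop_funpow_unit_bounded subprob_dist intro: wp_unit_bounded)
qed simp

text \<open>The tables depend on the dimension, which tells how many terms of a sequence must be
  inspected; the degree is left existential.\<close>

lemma finite_rep_wps:
  assumes "list_all (instr_ok k) is" and f: "finite_rep k 1 m0 f"
  shows "\<exists>m. finite_rep k (cont_dim is) m (\<lambda>t. wps is (f t))"
  using assms(1)
proof (induction "is")
  case Nil
  show ?case using f by auto
next
  case (Cons i "is")
  then obtain m where m: "finite_rep k (cont_dim is) m (\<lambda>t. wps is (f t))" by auto
  show ?case
  proof (cases i)
    case (Run P)
    then show ?thesis
      using finite_rep_wp[OF _ _ m order_refl, of P] Cons(2) by (auto simp: mult.commute)
  next
    case (Draw x D n)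
    have "\<exists>m. finite_rep k (cont_dim is) m (\<lambda>t. (drawop x (dist_fps D) ^^ n) (wps is (f t)))" for n
    proof (induction n)
      case 0
      then show ?case using m by auto
    next
      case (Suc n)
      then show ?case using finite_rep_draw[of k "cont_dim is" _ _ x D] Cons(2) Draw by fastforce
    qed
    then show ?thesis using Draw by simp
  qed
qed

lemma wps_determined:
  assumes "list_all (instr_ok k) is" "\<And>i. 0 < u i \<and> u i < 1" "x < k" "cont_dim is \<le> d"
  shows "determined d (\<lambda>n. wps is (pvals k u) (s(x := s x + n)))"
proof -
  obtain m where m: "finite_rep k (cont_dim is) m (\<lambda>t. wps is (pvals k (u(0 := t))))"
    using finite_rep_wps[OF assms(1) finite_rep_pvals[where j = 0 and u = u, OF assms(2)]] by blast
  have "finite_rep k d m (\<lambda>t. wps is (pvals k (u(0 := t))))" by (rule finite_rep_mono[OF m assms(4) order_refl])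
  from finite_rep_determined[OF this, of "u 0" x s] show ?thesis using assms(2,3) by simp
qed

subsection \<open>Evaluation tables\<close>

text \<open>
  An entry \<open>(c, (s, (v, w)))\<close> claims that the continuation \<open>c\<close> has value \<open>v\<close> in the state \<open>s\<close>;
  \<open>w\<close> is a witness for the claim.  Draws have infinitely many outcomes: their value
  \<open>D(S) F\<close>, with \<open>F\<close> the sequence of values after a draw and \<open>S\<close> the shift, is obtained from a
  polynomial \<open>c\<close> such that \<open>q(S) c(S) F = p(S) F\<close>, where \<open>p / q\<close> is the reduced form of \<open>D\<close>.
  As \<open>F\<close> lies in a shift-invariant space of dimension at most \<open>d\<close>, the equation needs to be
  checked on the first \<open>d\<close> terms only.  The witness consists of \<open>p\<close>, \<open>q\<close>, Bezout coefficients \<open>a\<close>,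
  \<open>b\<close>, \<open>c\<close> and the first terms of \<open>F\<close>; \<open>l\<close> bounds the lengths of the polynomials.
\<close>

abbreviation ec :: "nat \<Rightarrow> nat" where "ec e \<equiv> pfst e"
abbreviation es :: "nat \<Rightarrow> nat" where "es e \<equiv> pfst (psnd e)"
abbreviation ev :: "nat \<Rightarrow> nat" where "ev e \<equiv> pfst (psnd (psnd e))"
abbreviation ew :: "nat \<Rightarrow> nat" where "ew e \<equiv> psnd (psnd (psnd e))"

abbreviation itag :: "nat \<Rightarrow> nat" where "itag c \<equiv> pfst (el c 0)"
abbreviation iarg :: "nat \<Rightarrow> nat" where "iarg c \<equiv> psnd (el c 0)"

text \<open>\<open>step\<close> on codes, as \<open>next_cont_step\<close> shows. A sampling
  statement becomes a draw whose count is read from the state; a draw with count 0 falls into the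
  last branch and is removed like an assignment.\<close>

definition next_cont :: "nat \<Rightarrow> nat \<Rightarrow> nat" where
  "next_cont c s = (let a = iarg c; r = seq_tl c in
     if itag c = 2 then
       seq_cons (prod_encode (6, prod_encode (pfst a, prod_encode (pfst (psnd a), el s (psnd (psnd a)))))) r
     else if itag c = 3 then
       seq_cons (if el s (pfst (pfst a)) < psnd (pfst a) then pfst (psnd a) else psnd (psnd a)) r
     else if itag c = 4 then seq_cons (pfst a) (seq_cons (psnd a) r)
     else if itag c = 6 \<and> 0 < psnd (psnd a) then
       seq_cons (prod_encode (6, prod_encode (pfst a, prod_encode (pfst (psnd a), psnd (psnd a) - 1)))) r
     else r)"

definition next_state :: "nat \<Rightarrow> nat \<Rightarrow> nat \<Rightarrow> nat" where
  "next_state c s i =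
     (if itag c = 0 \<and> i = pfst (iarg c) then psnd (iarg c)
      else if itag c = 1 \<and> i = iarg c then el s i - 1
      else el s i)"

text \<open>Digits let a single number run through all grid points, and a single number through all
  start states.\<close>

definition digit :: "nat \<Rightarrow> nat \<Rightarrow> nat \<Rightarrow> nat" where
  "digit M g i = (g div M ^ i) mod M"

definition tcoeff :: "nat \<Rightarrow> nat \<Rightarrow> nat \<Rightarrow> real" where
  "tcoeff l p i = (if i < l then rat_val (el p i) else 0)"

text \<open>The conjuncts express \<open>p Q = P q\<close>, \<open>a p + b q = 1\<close>,
  \<open>q(S) c(S) F = p(S) F\<close> on the first \<open>d\<close> terms, and
  \<open>v = (c(S) F)(0)\<close>. Polynomial identities are compared up to degree bounds, for which
  the codes \<open>P\<close> and \<open>Q\<close> themselves are large enough.\<close>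

definition draw_ok :: "nat \<Rightarrow> nat \<Rightarrow> nat \<Rightarrow> nat \<Rightarrow> nat \<Rightarrow> bool" where
  "draw_ok d P Q v w \<longleftrightarrow>
     (let l = el w 0; p = el w 1; q = el w 2; a = el w 3; b = el w 4; c = el w 5; F = el w 6 in
       (\<forall>n<Suc (l + P + Q). (\<Sum>i<Suc n. tcoeff l p i * int_code_val (el Q (n - i)))
           = (\<Sum>i<Suc n. int_code_val (el P i) * tcoeff l q (n - i))) \<and>
       (\<forall>n<Suc (l + l). (\<Sum>i<Suc n. tcoeff l a i * tcoeff l p (n - i) + tcoeff l b i * tcoeff l q (n - i))
           = (if n = 0 then 1 else 0)) \<and>
       (\<forall>s<d. (\<Sum>j<l. rat_val (el q j) * (\<Sum>i<l. rat_val (el c i) * rat_val (el F (s + j + i))))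
           = (\<Sum>j<l. rat_val (el p j) * rat_val (el F (s + j)))) \<and>
       rat_val v = (\<Sum>i<l. rat_val (el c i) * rat_val (el F i)))"

text \<open>Other entries are consulted only for the next continuation. For a draw the indices
  \<open>s + j + i\<close> with \<open>s < d\<close> and \<open>i, j < l\<close> occur, so
  \<open>d + l + l\<close> outcomes must be present.\<close>

definition entry_ok :: "nat \<Rightarrow> nat \<Rightarrow> nat \<Rightarrow> nat \<Rightarrow> nat set \<Rightarrow> nat \<Rightarrow> bool" where
  "entry_ok k d M g S e \<longleftrightarrow>
     (let c = ec e; s = es e; v = ev e; w = ew e; a = iarg c in
       if c = 0 then rat_val v = (\<Prod>i<k. (1 / real (Suc (Suc (digit M g i)))) ^ el s i)
       else if itag c = 6 \<and> 0 < psnd (psnd a) then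
         draw_ok d (pfst (pfst (psnd a))) (psnd (pfst (psnd a))) v w \<and>
         (\<forall>n<d + el w 0 + el w 0. \<exists>e'\<in>S. ec e' = next_cont c s \<and> ev e' = el (el w 6) n \<and>
           (\<forall>i<k. el (es e') i = el s i + (if i = pfst a then n else 0)))
       else \<exists>e'\<in>S. ec e' = next_cont c s \<and> ev e' = v \<and> (\<forall>i<k. el (es e') i = next_state c s i))"

definition st :: "nat \<Rightarrow> nat \<Rightarrow> nat \<Rightarrow> nat" where
  "st k s i = (if i < k then el s i else 0)"

section \<open>Certificates for a single draw\<close>

lemma seq_code: "\<exists>c. \<forall>i. el c i = (if i < n then f i else 0)"
  by (rule exI[of _ "list_encode (map f [0..<n])"]) (simp add: el_list_encode)

definition cpoly :: "nat \<Rightarrow> nat \<Rightarrow> real poly" where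
  "cpoly l p = (\<Sum>i<l. Polynomial.monom (rat_val (el p i)) i)"

lemma coeff_cpoly: "Polynomial.coeff (cpoly l p) i = tcoeff l p i"
  by (auto simp: cpoly_def tcoeff_def coeff_sum)

lemma act_cpoly: "act (cpoly l p) F n = (\<Sum>i<l. rat_val (el p i) * F (n + i))"
proof (cases "l = 0")
  case False
  have "degree (cpoly l p) \<le> l - 1" by (rule degree_le) (auto simp: coeff_cpoly tcoeff_def)
  then have "degree (cpoly l p) < l" using False by simp
  from act_alt_less[OF this, of F n] show ?thesis by (simp add: coeff_cpoly tcoeff_def)
qed (simp add: cpoly_def)

lemma int_code_poly: "int_code_val (el (poly_encode p) i) = Polynomial.coeff (map_poly real_of_int p) i"
proof -
  have "int_decode (el (poly_encode p) i) = Polynomial.coeff p i"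
  proof (cases "i < length (coeffs p)")
    case True
    then show ?thesis using nth_default_coeffs_eq[of p]
      by (simp add: poly_encode_def el_list_encode) (metis nth_default_nth)
  next
    case False
    then have "Polynomial.coeff p i = 0"
      by (cases "p = 0") (auto simp: length_coeffs_degree intro: coeff_eq_0)
    moreover have "int_decode 0 = 0" by (simp add: int_decode_def sum_decode_def)
    ultimately show ?thesis using False by (simp add: poly_encode_def el_list_encode)
  qed
  then show ?thesis by (simp add: int_code_val_def coeff_map_poly)
qed

lemma poly_eq_upto:
  assumes "degree p \<le> N" "degree q \<le> N" "\<And>n. n < Suc N \<Longrightarrow> Polynomial.coeff p n = Polynomial.coeff q n"
  shows "p = q"
proof (rule poly_eqI)
  fix n
  show "Polynomial.coeff p n = Polynomial.coeff q n"
    using assms by (cases "n < Suc N") (auto simp: coeff_eq_0)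
qed

lemma degree_cpoly: "degree (cpoly l p) \<le> l"
  by (rule degree_le) (simp add: coeff_cpoly tcoeff_def)

text \<open>Verified on \<open>d\<close> terms, the equation holds everywhere because
  \<open>F\<close> is determined by \<open>d\<close> terms. So \<open>c(S) F\<close> is a bounded
  solution of the recurrence of \<open>D(S) F\<close> and coincides with it.\<close>

lemma draw_sound:
  assumes D: "valid_dist (Ratio P Q)" and ok: "draw_ok d (poly_encode P) (poly_encode Q) v w"
    and F: "sbounded F" "determined d F" and Fw: "\<And>n. n < d + el w 0 + el w 0 \<Longrightarrow> rat_val (el (el w 6) n) = F n"
  shows "rat_val v = shift_series (dist_fps (Ratio P Q)) F 0"
proof -
  define l p q a b c where "l = el w 0" and "p = cpoly l (el w 1)" and "q = cpoly l (el w 2)"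
    and "a = cpoly l (el w 3)" and "b = cpoly l (el w 4)" and "c = cpoly l (el w 5)"
  let ?P = "map_poly real_of_int P" and ?Q = "map_poly real_of_int Q"
  note o = ok[unfolded draw_ok_def Let_def, folded l_def]
  have dP: "degree ?P \<le> poly_encode P" "degree ?Q \<le> poly_encode Q"
    by (rule order_trans[OF _ degree_poly_encode], rule degree_le, simp add: coeff_map_poly coeff_eq_0)+
  have 1: "p * ?Q = ?P * q"
  proof (rule poly_eq_upto[where N = "l + poly_encode P + poly_encode Q"])
    show "degree (p * ?Q) \<le> l + poly_encode P + poly_encode Q"
      using degree_mult_le[of p ?Q] degree_cpoly[of l "el w 1"] dP by (simp add: p_def)
    show "degree (?P * q) \<le> l + poly_encode P + poly_encode Q"
      using degree_mult_le[of ?P q] degree_cpoly[of l "el w 2"] dP by (simp add: q_def)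
    fix n assume "n < Suc (l + poly_encode P + poly_encode Q)"
    then show "Polynomial.coeff (p * ?Q) n = Polynomial.coeff (?P * q) n"
      using o unfolding coeff_mult p_def q_def coeff_cpoly int_code_poly[symmetric]
      by (simp only: lessThan_Suc_atMost)
  qed
  have 2: "a * p + b * q = 1"
  proof (rule poly_eq_upto[where N = "l + l"])
    have "degree (a * p) \<le> l + l" "degree (b * q) \<le> l + l"
      by (rule order_trans[OF degree_mult_le], simp add: a_def b_def p_def q_def add_mono degree_cpoly)+
    then show "degree (a * p + b * q) \<le> l + l" by (rule degree_add_le)
    fix n assume "n < Suc (l + l)"
    then have "(\<Sum>i<Suc n. tcoeff l (el w 3) i * tcoeff l (el w 1) (n - i) + tcoeff l (el w 4) i * tcoeff l (el w 2) (n - i))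
           = (if n = 0 then 1 else 0)" using o by blast
    then show "Polynomial.coeff (a * p + b * q) n = Polynomial.coeff 1 n"
      unfolding coeff_add coeff_mult a_def b_def p_def q_def coeff_cpoly
      by (simp add: lessThan_Suc_atMost sum.distrib)
  qed simp
  have q: "fps_of_poly q * dist_fps (Ratio P Q) = fps_of_poly p"
    by (rule dist_fps_fraction[OF D 1])
  have "act (q * c) F n = act p F n" for n
  proof (rule determined_eq[OF F(2)])
    fix s assume s: "s < d"
    have "act (q * c) F s = (\<Sum>j<l. rat_val (el (el w 2) j) * (\<Sum>i<l. rat_val (el (el w 5) i) * F (s + j + i)))"
      by (simp add: act_mult q_def c_def act_cpoly)
    also have "\<dots> = (\<Sum>j<l. rat_val (el (el w 2) j) * (\<Sum>i<l. rat_val (el (el w 5) i) * rat_val (el (el w 6) (s + j + i))))"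
      by (intro sum.cong refl arg_cong2[of _ _ _ _ "(*)"] Fw[symmetric]) (use s in \<open>auto simp: l_def\<close>)
    also have "\<dots> = (\<Sum>j<l. rat_val (el (el w 1) j) * rat_val (el (el w 6) (s + j)))"
      using o s by blast
    also have "\<dots> = act p F s"
      unfolding p_def act_cpoly
      by (intro sum.cong refl arg_cong2[of _ _ _ _ "(*)"] Fw) (use s in \<open>auto simp: l_def\<close>)
    finally show "act (q * c) F s = act p F s" .
  qed
  then have "act c F 0 = shift_series (dist_fps (Ratio P Q)) F 0"
    by (intro shift_series_unique[OF subprob_dist[OF D] q 2 F(1) sbounded_act[OF F(1)]]) (simp add: act_mult)
  moreover have "rat_val v = act c F 0"
  proof -
    have "rat_val v = (\<Sum>i<l. rat_val (el (el w 5) i) * rat_val (el (el w 6) i))" using o by blast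
    also have "\<dots> = act c F 0"
      unfolding c_def act_cpoly
      by (intro sum.cong refl arg_cong2[of _ _ _ _ "(*)"]) (simp add: Fw l_def)
    finally show ?thesis .
  qed
  ultimately show ?thesis by simp
qed

lemma rat_poly_code: "degree p < l \<Longrightarrow> \<exists>c. cpoly l c = rp p"
proof -
  assume l: "degree p < l"
  have "\<forall>i. \<exists>c. rat_val c = of_rat (Polynomial.coeff p i)" using rat_val_surj by auto
  then obtain f where f: "\<And>i. rat_val (f i) = of_rat (Polynomial.coeff p i)" by metis
  obtain c where c: "\<And>i. el c i = (if i < l then f i else 0)" using seq_code[of l f] by blast
  have "cpoly l c = rp p"
  proof (rule poly_eqI)
    fix i
    show "Polynomial.coeff (cpoly l c) i = Polynomial.coeff (rp p) i"
      using l by (auto simp: coeff_cpoly tcoeff_def c f coeff_eq_0)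
  qed
  then show ?thesis by blast
qed

lemma draw_complete:
  assumes D: "valid_dist (Ratio P Q)" and F: "sbounded F" "determined d F" "\<And>n. F n = rat_val (\<phi> n)"
  shows "\<exists>v w. draw_ok d (poly_encode P) (poly_encode Q) v w \<and>
    (\<forall>n<d + el w 0 + el w 0. el (el w 6) n = \<phi> n)"
proof -
  obtain p q a b :: "rat poly"
    where *: "p * map_poly of_int Q = map_poly of_int P * q" "a * p + b * q = 1"
    using reduced_fraction[OF D] by metis
  have 1: "rp p * map_poly of_int Q = map_poly of_int P * rp q"
    using arg_cong[OF *(1), of rp] by (simp add: rp_mult rp_of_int)
  have 2: "rp a * rp p + rp b * rp q = 1"
    using arg_cong[OF *(2), of rp] by (simp add: rp_mult rp_add)
  have Frat: "F n \<in> \<rat>" for n unfolding F(3) by (rule rat_val_Rats)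
  obtain c where c: "\<And>n. act (rp q) (act (rp c) F) n = act (rp p) F n"
    using rational_solution[OF subprob_dist[OF D] dist_fps_fraction[OF D 1] 2 F(1,2) Frat] by blast
  \<comment> \<open>Larger than all the degrees, so that no polynomial is truncated.\<close>
  define l where "l = Suc (degree p + degree q + degree a + degree b + degree c)"
  obtain cp where cp: "cpoly l cp = rp p" using rat_poly_code[of p l] by (auto simp: l_def)
  obtain cq where cq: "cpoly l cq = rp q" using rat_poly_code[of q l] by (auto simp: l_def)
  obtain ca where ca: "cpoly l ca = rp a" using rat_poly_code[of a l] by (auto simp: l_def)
  obtain cb where cb: "cpoly l cb = rp b" using rat_poly_code[of b l] by (auto simp: l_def)
  obtain cc where cc: "cpoly l cc = rp c" using rat_poly_code[of c l] by (auto simp: l_def)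
  note codes = cp cq ca cb cc
  obtain cF where cF: "\<And>i. el cF i = (if i < d + l + l then \<phi> i else 0)" using seq_code by blast
  define w where "w = list_encode [l, cp, cq, ca, cb, cc, cF]"
  have w: "el w 0 = l" "el w 1 = cp" "el w 2 = cq" "el w 3 = ca" "el w 4 = cb" "el w 5 = cc" "el w 6 = cF"
    by (simp_all add: w_def el_list_encode del: list_encode.simps)
  have "(\<Sum>i<l. rat_val (el cc i) * rat_val (el cF i)) \<in> \<rat>"
    by (intro Rats_sum Rats_mult rat_val_Rats)
  then obtain v where v: "rat_val v = (\<Sum>i<l. rat_val (el cc i) * rat_val (el cF i))"
    using rat_val_surj by blast
  have "(\<Sum>i<Suc n. tcoeff l cp i * int_code_val (el (poly_encode Q) (n - i)))
           = (\<Sum>i<Suc n. int_code_val (el (poly_encode P) i) * tcoeff l cq (n - i))" for n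
    using arg_cong[OF 1, of "\<lambda>r. Polynomial.coeff r n"]
    unfolding coeff_mult codes[symmetric] coeff_cpoly int_code_poly[symmetric] by (simp only: lessThan_Suc_atMost)
  moreover have "(\<Sum>i<Suc n. tcoeff l ca i * tcoeff l cp (n - i) + tcoeff l cb i * tcoeff l cq (n - i))
           = (if n = 0 then 1 else 0)" for n
    using arg_cong[OF 2, of "\<lambda>r. Polynomial.coeff r n"]
    unfolding coeff_add coeff_mult codes[symmetric] coeff_cpoly by (simp add: lessThan_Suc_atMost sum.distrib)
  moreover have "(\<Sum>j<l. rat_val (el cq j) * (\<Sum>i<l. rat_val (el cc i) * rat_val (el cF (s + j + i))))
           = (\<Sum>j<l. rat_val (el cp j) * rat_val (el cF (s + j)))" if "s < d" for s
  proof -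
    have "(\<Sum>j<l. rat_val (el cq j) * (\<Sum>i<l. rat_val (el cc i) * rat_val (el cF (s + j + i))))
        = (\<Sum>j<l. rat_val (el cq j) * (\<Sum>i<l. rat_val (el cc i) * F (s + j + i)))"
      by (intro sum.cong refl arg_cong2[of _ _ _ _ "(*)"]) (use that in \<open>auto simp: cF F(3)\<close>)
    also have "\<dots> = act (rp q) (act (rp c) F) s" by (simp add: codes[symmetric] act_cpoly)
    also have "\<dots> = (\<Sum>j<l. rat_val (el cp j) * F (s + j))" unfolding c by (simp add: codes[symmetric] act_cpoly)
    also have "\<dots> = (\<Sum>j<l. rat_val (el cp j) * rat_val (el cF (s + j)))"
      by (intro sum.cong refl arg_cong2[of _ _ _ _ "(*)"]) (use that in \<open>auto simp: cF F(3)\<close>)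
    finally show ?thesis .
  qed
  ultimately have "draw_ok d (poly_encode P) (poly_encode Q) v w"
    unfolding draw_ok_def Let_def w using v by blast
  moreover have "\<forall>n<d + el w 0 + el w 0. el (el w 6) n = \<phi> n" unfolding w by (simp add: cF)
  ultimately show ?thesis by blast
qed

section \<open>Small steps of continuations; soundness and completeness of tables\<close>

definition tab_ents :: "nat \<Rightarrow> nat set" where
  "tab_ents T = (\<lambda>j. el (psnd T) j) ` {..<pfst T}"

definition closed_entries :: "nat \<Rightarrow> nat \<Rightarrow> nat \<Rightarrow> nat \<Rightarrow> nat set \<Rightarrow> bool" where
  "closed_entries k d M g S \<longleftrightarrow> (\<forall>e\<in>S. entry_ok k d M g S e)"

fun step :: "instr list \<Rightarrow> (nat \<Rightarrow> nat) \<Rightarrow> instr list" where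
  "step (Run (Assign x n) # r) s = r"
| "step (Run (Decr x) # r) s = r"
| "step (Run (IncrIid x D y) # r) s = Draw x D (s y) # r"
| "step (Run (IfLess x n P Q) # r) s = Run (if s x < n then P else Q) # r"
| "step (Run (Seq P Q) # r) s = Run P # Run Q # r"
| "step (Draw x D (Suc m) # r) s = Draw x D m # r"
| "step (i # r) s = r"
| "step [] s = []"

fun is_draw :: "instr list \<Rightarrow> bool" where
  "is_draw (Draw x D (Suc m) # r) = True"
| "is_draw _ = False"

text \<open>The two halves of a sequence weigh together one less than the whole. Every program
  weighs at least 1, so its replacement by draws of weight 0 is a decrease whatever their
  count.\<close>

primrec prog_weight :: "instr \<Rightarrow> nat" where
  "prog_weight (Run P) = 2 * size P + 1"
| "prog_weight (Draw x D m) = 0"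

primrec draw_weight :: "instr \<Rightarrow> nat" where
  "draw_weight (Run P) = 0"
| "draw_weight (Draw x D m) = Suc m"

text \<open>Lexicographic, because a sampling statement may create arbitrarily many draws at the
  moment its own weight disappears.\<close>

definition cont_rel :: "(instr list \<times> instr list) set" where
  "cont_rel = measures [\<lambda>is. sum_list (map prog_weight is), \<lambda>is. sum_list (map draw_weight is)]"

lemma wf_cont_rel: "wf cont_rel" by (simp add: cont_rel_def)

lemma step_rel: "is \<noteq> [] \<Longrightarrow> (step is s, is) \<in> cont_rel"
  by (induction "is" s rule: step.induct) (auto simp: cont_rel_def)

lemma step_ok: "list_all (instr_ok k) is \<Longrightarrow> list_all (instr_ok k) (step is s)"
  by (induction "is" s rule: step.induct) auto

text \<open>Dimensions never grow along a run, so the bound for the initial program serves all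
  continuations of a table.\<close>

lemma step_cont_dim: "cont_dim (step is s) \<le> cont_dim is"
proof (induction "is" s rule: step.induct)
  case (4 x n P Q r s)
  have "wp_dim (if s x < n then P else Q) \<le> (n + 1) * (wp_dim P + wp_dim Q)" by auto
  then show ?case by (auto intro: mult_le_mono1 simp del: mult_Suc)
qed (auto simp: mult.assoc)

lemma next_cont_step:
  "is \<noteq> [] \<Longrightarrow> list_all (instr_ok k) is \<Longrightarrow> next_cont (cont_code is) s = cont_code (step is (el s))"
  by (induction "is" "el s" rule: step.induct) (auto simp: next_cont_def Let_def cont_code_Cons)

lemma is_draw_code:
  "list_all (instr_ok k) is \<Longrightarrow> is \<noteq> [] \<Longrightarrow>
    is_draw is \<longleftrightarrow> itag (cont_code is) = 6 \<and> 0 < psnd (psnd (iarg (cont_code is)))"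
proof (induction "is" rule: is_draw.induct)
  case ("2_2" P r)
  then show ?case by (cases P) (auto simp: cont_code_Cons)
qed (auto simp: cont_code_Cons)

lemma st_eqI: "(\<And>i. i < k \<Longrightarrow> el s i = f i) \<Longrightarrow> (\<And>i. \<not> i < k \<Longrightarrow> f i = 0) \<Longrightarrow> st k s = f"
  by (auto simp: st_def fun_eq_iff)

lemma wps_step:
  assumes ok: "list_all (instr_ok k) is" and nd: "\<not> is_draw is" and ne: "is \<noteq> []"
    and s': "\<And>i. i < k \<Longrightarrow> el s' i = next_state (cont_code is) s i"
  shows "wps is f (st k s) = wps (step is (el s)) f (st k s')"
proof -
  obtain i r where ir: "is = i # r" using ne by (cases "is") auto
  have same: "st k s' = st k s" if "itag (cont_code is) \<noteq> 0" "itag (cont_code is) \<noteq> 1"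
    using s' that by (auto simp: st_def fun_eq_iff next_state_def)
  show ?thesis
  proof (cases i)
    case (Run P)
    show ?thesis
    proof (cases P)
      case (Assign x n)
      have "st k s' = (st k s)(x := n)"
        by (rule st_eqI) (use s' ok in \<open>auto simp: ir Run Assign cont_code_Cons next_state_def st_def\<close>)
      then show ?thesis by (simp add: ir Run Assign)
    next
      case (Decr x)
      have "st k s' = (st k s)(x := st k s x - 1)"
        by (rule st_eqI) (use s' ok in \<open>auto simp: ir Run Decr cont_code_Cons next_state_def st_def\<close>)
      then show ?thesis by (simp add: ir Run Decr)
    next
      case (IncrIid x D y)
      have "st k s y = el s y" using ok by (simp add: ir Run IncrIid st_def)
      then show ?thesis using same by (simp add: ir Run IncrIid cont_code_Cons)
    next
      case (IfLess x n P1 P2)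
      have "st k s x = el s x" using ok by (simp add: ir Run IfLess st_def)
      then show ?thesis using same by (simp add: ir Run IfLess cont_code_Cons)
    next
      case (Seq P1 P2)
      then show ?thesis using same by (simp add: ir Run cont_code_Cons)
    next
      case (WhileLess x n P1)
      then show ?thesis using ok by (simp add: ir Run)
    qed
  next
    case (Draw x D m)
    then have "m = 0" using nd by (cases m) (auto simp: ir)
    then show ?thesis using same by (simp add: ir Draw cont_code_Cons)
  qed
qed

definition gvals :: "nat \<Rightarrow> nat \<Rightarrow> nat \<Rightarrow> obs" where
  "gvals k M g = pvals k (gridpt (digit M g))"

lemma unit_bounded_gvals: "unit_bounded (gvals k M g)"
  unfolding gvals_def by (rule unit_bounded_pvals) (rule gridpt_iv)

lemma gvals_eq: "gvals k M g (st k s) = (\<Prod>i<k. (1 / real (Suc (Suc (digit M g i)))) ^ el s i)"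
  unfolding gvals_def pvals_def gridpt_def by (rule prod.cong) (auto simp: st_def add.commute)

lemma draw_sequence:
  fixes s :: "nat \<Rightarrow> nat" and M g :: nat
  assumes ok: "list_all (instr_ok k) (Draw x D (Suc m) # r)" and d: "cont_dim (Draw x D (Suc m) # r) \<le> d"
  defines "F \<equiv> \<lambda>n. wps (Draw x D m # r) (gvals k M g) (s(x := s x + n))"
  shows "sbounded F" "determined d F" "wps (Draw x D (Suc m) # r) (gvals k M g) s = shift_series (dist_fps D) F 0"
proof -
  have ok': "list_all (instr_ok k) (Draw x D m # r)" and x: "x < k" using ok by auto
  have "unit_bounded (wps (Draw x D m # r) (gvals k M g))" by (rule wps_unit_bounded[OF ok' unit_bounded_gvals])
  then show "sbounded F" unfolding F_def unit_bounded_def sbounded_def by blast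
  show "determined d F" unfolding F_def gvals_def
    by (rule wps_determined[OF ok' gridpt_iv x]) (use d in simp)
  show "wps (Draw x D (Suc m) # r) (gvals k M g) s = shift_series (dist_fps D) F 0"
    by (simp add: F_def drawop_shift_series)
qed

lemma shifted_state:
  "(\<forall>i<k. el s' i = el s i + (if i = x then n else 0)) \<Longrightarrow> x < k \<Longrightarrow>
    st k s' = (st k s)(x := st k s x + n)"
  by (auto simp: st_def fun_eq_iff)

text \<open>An accepted entry refers to entries for the next continuation, which is smaller in
  \<open>cont_rel\<close>. The local checks therefore add up by induction, although a table carries
  no order on its entries.\<close>

lemma entry_sound:
  assumes S: "closed_entries k d M g S"
  shows "list_all (instr_ok k) is \<Longrightarrow> cont_dim is \<le> d \<Longrightarrow> e \<in> S \<Longrightarrow> ec e = cont_code is \<Longrightarrow>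
    rat_val (ev e) = wps is (gvals k M g) (st k (es e))"
proof (induction "is" arbitrary: e rule: wf_induct_rule[OF wf_cont_rel])
  case (1 "is")
  note ok = 1(2) and d = 1(3)
  have e: "entry_ok k d M g S e" using S 1(4) by (auto simp: closed_entries_def)
  show ?case
  proof (cases "is = []")
    case True
    then show ?thesis using e 1(5) by (simp add: entry_ok_def Let_def cont_code_Cons gvals_eq)
  next
    case False
    then have c0: "cont_code is \<noteq> 0" by (cases "is") (auto simp: cont_code_Cons seq_cons_def)
    have IH: "rat_val (ev e') = wps (step is (el (es e))) (gvals k M g) (st k (es e'))"
      if "e' \<in> S" "ec e' = next_cont (cont_code is) (es e)" for e'
      using 1(1)[OF step_rel[OF False] step_ok[OF ok] order_trans[OF step_cont_dim d] that(1)] that(2)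
      by (simp add: next_cont_step[OF False ok])
    show ?thesis
    proof (cases "is_draw is")
      case True
      then obtain x P Q m r where is': "is = Draw x (Ratio P Q) (Suc m) # r"
        by (cases "is" rule: is_draw.cases) (auto, metis dist.exhaust)
      let ?s = "st k (es e)" and ?w = "ew e"
      let ?F = "\<lambda>n. wps (Draw x (Ratio P Q) m # r) (gvals k M g) (?s(x := ?s x + n))"
      have x: "x < k" and v: "valid_dist (Ratio P Q)" using ok by (simp_all add: is' del: valid_dist.simps)
      have arg: "iarg (cont_code is) = prod_encode (x, prod_encode (dist_encode (Ratio P Q), Suc m))" "itag (cont_code is) = 6"
        by (simp_all add: is' cont_code_Cons)
      have e': "draw_ok d (poly_encode P) (poly_encode Q) (ev e) ?w"
        "\<And>n. n < d + el ?w 0 + el ?w 0 \<Longrightarrow> \<exists>e'\<in>S. ec e' = next_cont (cont_code is) (es e) \<and> ev e' = el (el ?w 6) n \<and>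
           (\<forall>i<k. el (es e') i = el (es e) i + (if i = x then n else 0))"
        using e[unfolded entry_ok_def Let_def 1(5)] c0 by (simp_all add: arg)
      note F = draw_sequence[OF ok[unfolded is'] d[unfolded is'], of M g ?s]
      have "rat_val (ev e) = shift_series (dist_fps (Ratio P Q)) ?F 0"
      proof (rule draw_sound[OF v e'(1) F(1,2)])
        fix n assume "n < d + el ?w 0 + el ?w 0"
        from e'(2)[OF this] obtain e' where e': "e' \<in> S" "ec e' = next_cont (cont_code is) (es e)"
          "ev e' = el (el ?w 6) n" "\<forall>i<k. el (es e') i = el (es e) i + (if i = x then n else 0)" by blast
        show "rat_val (el (el ?w 6) n) = ?F n"
          using IH[OF e'(1,2)] shifted_state[OF e'(4) x] e'(3) by (simp add: is')
      qed
      then show ?thesis using F(3) by (simp only: is')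
    next
      case nd: False
      then have "\<exists>e'\<in>S. ec e' = next_cont (cont_code is) (es e) \<and> ev e' = ev e \<and>
          (\<forall>i<k. el (es e') i = next_state (cont_code is) (es e) i)"
        using e c0 is_draw_code[OF ok False] unfolding entry_ok_def Let_def 1(5) by (simp only: if_False)
      then obtain e' where e': "e' \<in> S" "ec e' = next_cont (cont_code is) (es e)" "ev e' = ev e"
          "\<And>i. i < k \<Longrightarrow> el (es e') i = next_state (cont_code is) (es e) i" by blast
      show ?thesis using IH[OF e'(1,2)] wps_step[OF ok nd False e'(4)] e'(3) by simp
    qed
  qed
qed

lemma entry_ok_mono: "entry_ok k d M g S e \<Longrightarrow> S \<subseteq> S' \<Longrightarrow> entry_ok k d M g S' e"
proof -
  assume ok: "entry_ok k d M g S e" and sub: "S \<subseteq> S'"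
  have mono: "\<exists>e'\<in>S. R e' \<Longrightarrow> \<exists>e'\<in>S'. R e'" for R using sub by blast
  show ?thesis
  proof (cases "ec e = 0")
    case True
    then show ?thesis using ok by (simp add: entry_ok_def)
  next
    case c: False
    show ?thesis
    proof (cases "itag (ec e) = 6 \<and> 0 < psnd (psnd (iarg (ec e)))")
      case True
      note o = ok[unfolded entry_ok_def Let_def if_not_P[OF c] if_P[OF True]]
      show ?thesis unfolding entry_ok_def Let_def if_not_P[OF c] if_P[OF True]
      proof (rule conjI[OF o[THEN conjunct1]], intro allI impI)
        fix n assume n: "n < d + el (ew e) 0 + el (ew e) 0"
        show "\<exists>e'\<in>S'. ec e' = next_cont (ec e) (es e) \<and> ev e' = el (el (ew e) 6) n \<and>
            (\<forall>i<k. el (es e') i = el (es e) i + (if i = pfst (iarg (ec e)) then n else 0))"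
          using o[THEN conjunct2, rule_format, OF n] by (rule mono)
      qed
    next
      case False
      show ?thesis using ok unfolding entry_ok_def Let_def if_not_P[OF c] if_not_P[OF False]
        by (rule mono)
    qed
  qed
qed

lemma closed_insert:
  assumes "closed_entries k d M g S" "entry_ok k d M g S e"
  shows "closed_entries k d M g (insert e S)"
  unfolding closed_entries_def
proof
  fix e' assume "e' \<in> insert e S"
  then have "entry_ok k d M g S e'" using assms unfolding closed_entries_def by blast
  then show "entry_ok k d M g (insert e S) e'" by (rule entry_ok_mono[OF _ subset_insertI])
qed

lemma closed_UN:
  assumes "\<And>i. i \<in> I \<Longrightarrow> closed_entries k d M g (S i)"
  shows "closed_entries k d M g (\<Union>i\<in>I. S i)"
  unfolding closed_entries_def
proof
  fix e assume "e \<in> (\<Union>i\<in>I. S i)"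
  then obtain i where i: "i \<in> I" "e \<in> S i" by blast
  then have "entry_ok k d M g (S i) e" using assms[OF i(1)] unfolding closed_entries_def by blast
  then show "entry_ok k d M g (\<Union>i\<in>I. S i) e" by (rule entry_ok_mono) (use i(1) in blast)
qed

text \<open>Rationality of the values comes out of the construction: the entries built recursively
  carry rational values, and soundness identifies these with the true ones.\<close>

lemma entry_complete:
  "list_all (instr_ok k) is \<Longrightarrow> cont_dim is \<le> d \<Longrightarrow>
    \<exists>S e. finite S \<and> closed_entries k d M g S \<and> e \<in> S \<and> ec e = cont_code is \<and> es e = s"
proof (induction "is" arbitrary: s rule: wf_induct_rule[OF wf_cont_rel])
  case (1 "is")
  note ok = 1(2) and d = 1(3)
  show ?case
  proof (cases "is = []")
    case True
    have "(\<Prod>i<k. (1 / real (Suc (Suc (digit M g i)))) ^ el s i) \<in> \<rat>"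
      by (intro Rats_prod Rats_power Rats_divide) auto
    then obtain v where v: "rat_val v = (\<Prod>i<k. (1 / real (Suc (Suc (digit M g i)))) ^ el s i)"
      using rat_val_surj by blast
    let ?e = "prod_encode (0, prod_encode (s, prod_encode (v, 0)))"
    have "entry_ok k d M g {} ?e" by (simp add: entry_ok_def Let_def v)
    then have "closed_entries k d M g {?e}" by (intro closed_insert) (simp add: closed_entries_def)
    then show ?thesis using True by (intro exI[of _ "{?e}"] exI[of _ ?e]) (simp add: cont_code_Cons)
  next
    case False
    then have c0: "cont_code is \<noteq> 0" by (cases "is") (auto simp: cont_code_Cons seq_cons_def)
    have IH: "\<exists>S e. finite S \<and> closed_entries k d M g S \<and> e \<in> S \<and>
        ec e = next_cont (cont_code is) s \<and> es e = s'" for s'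
      using 1(1)[OF step_rel[OF False] step_ok[OF ok] order_trans[OF step_cont_dim d]]
      by (simp add: next_cont_step[OF False ok])
    show ?thesis
    proof (cases "is_draw is")
      case True
      then obtain x P Q m r where is': "is = Draw x (Ratio P Q) (Suc m) # r"
        by (cases "is" rule: is_draw.cases) (auto, metis dist.exhaust)
      let ?s = "st k s"
      let ?F = "\<lambda>n. wps (Draw x (Ratio P Q) m # r) (gvals k M g) (?s(x := ?s x + n))"
      have x: "x < k" and v: "valid_dist (Ratio P Q)" using ok by (simp_all add: is' del: valid_dist.simps)
      have arg: "iarg (cont_code is) = prod_encode (x, prod_encode (dist_encode (Ratio P Q), Suc m))" "itag (cont_code is) = 6"
        by (simp_all add: is' cont_code_Cons)
      have next_c: "next_cont (cont_code is) s = cont_code (Draw x (Ratio P Q) m # r)"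
        using next_cont_step[OF False ok, of s] by (simp add: is')
      \<comment> \<open>How many outcomes are needed depends on the witness, which in turn depends
        on their values. So entries are provided for every \<open>n\<close>, and once the witness is
        known the table keeps those with \<open>n < d + l + l\<close>.\<close>
      have "\<forall>n. \<exists>S e. finite S \<and> closed_entries k d M g S \<and> e \<in> S \<and> ec e = next_cont (cont_code is) s \<and>
          (\<forall>i<k. el (es e) i = el s i + (if i = x then n else 0))"
      proof
        fix n
        obtain s' where s': "\<And>i. el s' i = (if i < k then el s i + (if i = x then n else 0) else 0)"
          using seq_code[of k "\<lambda>i. el s i + (if i = x then n else 0)"] by blast
        obtain S e where Se: "finite S" "closed_entries k d M g S" "e \<in> S" "ec e = next_cont (cont_code is) s" "es e = s'"
          using IH[of s'] by blast
        have "\<forall>i<k. el (es e) i = el s i + (if i = x then n else 0)" unfolding Se(5) using s' by simp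
        then show "\<exists>S e. finite S \<and> closed_entries k d M g S \<and> e \<in> S \<and> ec e = next_cont (cont_code is) s \<and>
          (\<forall>i<k. el (es e) i = el s i + (if i = x then n else 0))"
          using Se(1-4) by (intro exI[of _ S] exI[of _ e] conjI)
      qed
      then obtain S E where SE: "\<And>n. finite (S n)" "\<And>n. closed_entries k d M g (S n)" "\<And>n. E n \<in> S n"
        "\<And>n. ec (E n) = next_cont (cont_code is) s" "\<And>n. \<forall>i<k. el (es (E n)) i = el s i + (if i = x then n else 0)"
        by metis
      note F = draw_sequence[OF ok[unfolded is'] d[unfolded is'], of M g ?s]
      have Fn: "?F n = rat_val (ev (E n))" for n
      proof -
        have dm: "cont_dim (Draw x (Ratio P Q) m # r) \<le> d" using d by (simp add: is')
        have ok': "list_all (instr_ok k) (Draw x (Ratio P Q) m # r)" using ok by (simp add: is')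
        have "rat_val (ev (E n)) = wps (Draw x (Ratio P Q) m # r) (gvals k M g) (st k (es (E n)))"
          by (rule entry_sound[OF SE(2) ok' dm SE(3)]) (simp only: SE(4) next_c)
        then show ?thesis by (simp add: shifted_state[OF SE(5) x])
      qed
      obtain v w where vw: "draw_ok d (poly_encode P) (poly_encode Q) v w"
        "\<forall>n<d + el w 0 + el w 0. el (el w 6) n = ev (E n)"
        using draw_complete[OF v F(1,2) Fn] by blast
      let ?N = "d + el w 0 + el w 0"
      let ?S = "\<Union>n\<in>{..<?N}. S n"
      let ?e = "prod_encode (cont_code is, prod_encode (s, prod_encode (v, w)))"
      have "\<exists>e'\<in>?S. ec e' = next_cont (cont_code is) s \<and> ev e' = el (el w 6) n \<and>
           (\<forall>i<k. el (es e') i = el s i + (if i = x then n else 0))" if "n < ?N" for n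
        by (rule bexI[of _ "E n"]) (use that SE vw(2) in auto)
      then have "entry_ok k d M g ?S ?e"
        using vw(1) c0 unfolding entry_ok_def Let_def by (simp add: arg)
      then have "closed_entries k d M g (insert ?e ?S)"
        by (intro closed_insert closed_UN SE(2))
      then show ?thesis using SE(1) by (intro exI[of _ "insert ?e ?S"] exI[of _ ?e]) simp
    next
      case nd: False
      obtain s' where s': "\<And>i. el s' i = (if i < k then next_state (cont_code is) s i else 0)"
        using seq_code[of k "next_state (cont_code is) s"] by blast
      obtain S e' where S: "finite S" "closed_entries k d M g S" "e' \<in> S" "ec e' = next_cont (cont_code is) s" "es e' = s'"
        using IH[of s'] by blast
      let ?e = "prod_encode (cont_code is, prod_encode (s, prod_encode (ev e', 0)))"
      have "\<exists>e''\<in>S. ec e'' = next_cont (cont_code is) s \<and> ev e'' = ev e' \<and> (\<forall>i<k. el (es e'') i = next_state (cont_code is) s i)"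
        by (rule bexI[of _ e']) (use S s' in auto)
      then have "entry_ok k d M g S ?e"
        using c0 is_draw_code[OF ok False] nd unfolding entry_ok_def Let_def
        by (simp only: prod_encode_inverse fst_conv snd_conv if_False)
      then have "closed_entries k d M g (insert ?e S)" by (rule closed_insert[OF S(2)])
      then show ?thesis using S(1) by (intro exI[of _ "insert ?e S"] exI[of _ ?e]) simp
    qed
  qed
qed

lemma table_code: "finite S \<Longrightarrow> \<exists>T. tab_ents T = S"
proof -
  assume "finite S"
  then obtain xs where xs: "set xs = S" using finite_list by blast
  have "tab_ents (prod_encode (length xs, list_encode xs)) = S"
    unfolding tab_ents_def xs[symmetric] by (auto simp: el_list_encode in_set_conv_nth image_iff)
  then show ?thesis by blast
qed

subsection \<open>The decision procedure\<close>

text \<open>Under a bounded quantifier, sum or product the argument becomes the pair of the old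
  argument and the bound variable; parameters are lifted once per level of nesting.\<close>

lemma tot_rec_lift: "tot_rec f \<Longrightarrow> tot_rec (\<lambda>z. f (pfst z))"
  by (rule tot_rec_comp[OF _ tot_rec_fst0])

lemmas rec_intros = tot_rec_fst tot_rec_snd tot_rec_pair tot_rec_Suc tot_rec_const tot_rec_id tot_rec_add tot_rec_mult tot_rec_diff
  tot_rec_power tot_rec_div tot_rec_mod tot_rec_If tot_rec_el tot_rec_seq_tl tot_rec_seq_cons
  dec_pred_less dec_pred_not dec_pred_conj dec_pred_imp dec_pred_eq dec_pred_If dec_pred_all dec_pred_ex dec_pred_req
  rat_rec_val rat_rec_const_nat rat_rec_inverse_Suc rat_rec_mult rat_rec_add rat_rec_If rat_rec_sum rat_rec_prod rat_rec_power rat_rec_int_code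

lemma rat_rec_tcoeff: "tot_rec l \<Longrightarrow> tot_rec p \<Longrightarrow> tot_rec i \<Longrightarrow> rat_rec (\<lambda>z. tcoeff (l z) (p z) (i z))"
  unfolding tcoeff_def by (intro rec_intros)

lemma dec_pred_draw_ok:
  assumes "tot_rec d" "tot_rec P" "tot_rec Q" "tot_rec v" "tot_rec w"
  shows "dec_pred (\<lambda>z. draw_ok (d z) (P z) (Q z) (v z) (w z))"
proof -
  note 1 = assms
  note 2 = 1[THEN tot_rec_lift]
  note 3 = 2[THEN tot_rec_lift]
  note 4 = 3[THEN tot_rec_lift]
  show ?thesis unfolding draw_ok_def Let_def
    by (intro rec_intros rat_rec_tcoeff 1 2 3 4)
qed

lemma tot_rec_next_cont: "tot_rec c \<Longrightarrow> tot_rec s \<Longrightarrow> tot_rec (\<lambda>z. next_cont (c z) (s z))"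
  unfolding next_cont_def Let_def by (intro rec_intros)

lemma tot_rec_next_state: "tot_rec c \<Longrightarrow> tot_rec s \<Longrightarrow> tot_rec i \<Longrightarrow> tot_rec (\<lambda>z. next_state (c z) (s z) (i z))"
  unfolding next_state_def by (intro rec_intros)

lemma tot_rec_digit: "tot_rec M \<Longrightarrow> tot_rec g \<Longrightarrow> tot_rec i \<Longrightarrow> tot_rec (\<lambda>z. digit (M z) (g z) (i z))"
  unfolding digit_def by (intro rec_intros)

lemma bex_tab_ents: "(\<exists>e\<in>tab_ents T. R e) \<longleftrightarrow> (\<exists>j<pfst T. R (el (psnd T) j))"
  by (auto simp: tab_ents_def)

lemma dec_pred_entry_ok:
  assumes "tot_rec k" "tot_rec d" "tot_rec M" "tot_rec g" "tot_rec T" "tot_rec e"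
  shows "dec_pred (\<lambda>z. entry_ok (k z) (d z) (M z) (g z) (tab_ents (T z)) (e z))"
proof -
  note 1 = assms
  note 2 = 1[THEN tot_rec_lift]
  note 3 = 2[THEN tot_rec_lift]
  note 4 = 3[THEN tot_rec_lift]
  show ?thesis unfolding entry_ok_def Let_def bex_tab_ents
    by (intro rec_intros dec_pred_draw_ok tot_rec_next_cont tot_rec_next_state tot_rec_digit 1 2 3 4)
qed

text \<open>The instance code \<open>a\<close> bounds the codes of both programs. Two dimensions of
  at most \<open>2^a\<close> add up to \<open>dbound a\<close>, two degree factors of at most
  \<open>(dbound a + 2)^a\<close> enter \<open>mbound a\<close>, and \<open>pfst a\<close> is the
  number of variables.\<close>

definition dbound :: "nat \<Rightarrow> nat" where "dbound a = 2 ^ Suc a"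
definition mbound :: "nat \<Rightarrow> nat" where
  "mbound a = Suc (2 * (dbound a + 2) ^ a * (pfst a * dbound a + 1))"

definition starts :: "nat \<Rightarrow> nat \<Rightarrow> nat \<Rightarrow> nat \<Rightarrow> nat \<Rightarrow> bool" where
  "starts k d c z e \<longleftrightarrow> ec e = seq_cons c 0 \<and> (\<forall>i<k. el (es e) i = digit d z i)"

text \<open>\<open>C\<close> lists one table for each grid point \<open>g\<close>. Besides passing
  the local checks, a table must contain entries for both programs in each start state of the cube,
  given by the digits of \<open>z\<close>.\<close>

definition certificate :: "nat \<Rightarrow> nat \<Rightarrow> bool" where
  "certificate a C \<longleftrightarrow> (\<forall>g<mbound a ^ pfst a.
     (\<forall>j<pfst (el C g). entry_ok (pfst a) (dbound a) (mbound a) g (tab_ents (el C g)) (el (psnd (el C g)) j)) \<and>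
     (\<forall>z<dbound a ^ pfst a.
        (\<exists>j<pfst (el C g). starts (pfst a) (dbound a) (pfst (psnd a)) z (el (psnd (el C g)) j)) \<and>
        (\<exists>j<pfst (el C g). starts (pfst a) (dbound a) (psnd (psnd a)) z (el (psnd (el C g)) j))))"

text \<open>All pairs of matching entries are compared. By soundness they carry the true values, so
  the answer does not depend on the certificate that was found.\<close>

definition values_agree :: "nat \<Rightarrow> nat \<Rightarrow> bool" where
  "values_agree a C \<longleftrightarrow> (\<forall>g<mbound a ^ pfst a. \<forall>z<dbound a ^ pfst a.
     \<forall>i<pfst (el C g). \<forall>j<pfst (el C g).
       starts (pfst a) (dbound a) (pfst (psnd a)) z (el (psnd (el C g)) i) \<longrightarrow>
       starts (pfst a) (dbound a) (psnd (psnd a)) z (el (psnd (el C g)) j) \<longrightarrow>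
       rat_val (ev (el (psnd (el C g)) i)) = rat_val (ev (el (psnd (el C g)) j)))"

lemma tot_rec_bounds:
  assumes a: "tot_rec a"
  shows "tot_rec (\<lambda>z. dbound (a z))" "tot_rec (\<lambda>z. mbound (a z))"
  unfolding mbound_def dbound_def by (intro rec_intros a)+

lemma dec_pred_starts:
  assumes "tot_rec k" "tot_rec d" "tot_rec c" "tot_rec w" "tot_rec e"
  shows "dec_pred (\<lambda>z. starts (k z) (d z) (c z) (w z) (e z))"
  unfolding starts_def by (intro rec_intros tot_rec_digit assms assms[THEN tot_rec_lift])

lemma dec_pred_certificate: "dec_pred (\<lambda>z. certificate (pfst z) (psnd z))"
  unfolding certificate_def
  by (intro rec_intros dec_pred_entry_ok dec_pred_starts tot_rec_bounds)

lemma dec_pred_values_agree: "dec_pred (\<lambda>z. values_agree (pfst z) (psnd z))"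
  unfolding values_agree_def
  by (intro rec_intros dec_pred_starts tot_rec_bounds)

lemma digits_exist: "(\<And>i. i < k \<Longrightarrow> \<gamma> i < M) \<Longrightarrow> \<exists>g<M ^ k. \<forall>i<k. digit M g i = \<gamma> i"
proof (induction k arbitrary: \<gamma>)
  case (Suc k)
  obtain g where g: "g < M ^ k" "\<And>i. i < k \<Longrightarrow> digit M g i = \<gamma> (Suc i)"
    using Suc.IH[of "\<lambda>i. \<gamma> (Suc i)"] Suc.prems by auto
  have \<gamma>0: "\<gamma> 0 < M" using Suc.prems by simp
  let ?g = "\<gamma> 0 + M * g"
  have "?g < M * Suc g" using \<gamma>0 by simp
  also have "\<dots> \<le> M * M ^ k" using g(1) by (intro mult_le_mono2) simp
  finally have lt: "?g < M ^ Suc k" by simp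
  have "digit M ?g i = \<gamma> i" if "i < Suc k" for i
  proof (cases i)
    case 0
    then show ?thesis using \<gamma>0 by (simp add: digit_def)
  next
    case (Suc j)
    have "?g div M ^ Suc j = g div M ^ j" using \<gamma>0 by (simp add: div_mult2_eq)
    then show ?thesis using g(2)[of j] that Suc by (simp add: digit_def)
  qed
  then show ?case using lt by blast
qed simp

context
  fixes k :: nat and P Q :: prog and a :: nat
  assumes P: "loop_free P" "redip k P" and Q: "loop_free Q" "redip k Q"
    and a: "a = instance_encode (k, P, Q)"
begin

lemma codes: "pfst a = k" "pfst (psnd a) = prog_encode P" "psnd (psnd a) = prog_encode Q"
  by (simp_all add: a)

lemma code_bounds: "prog_encode P \<le> a" "prog_encode Q \<le> a"
  using prod_encode_ge[of k "prod_encode (prog_encode P, prog_encode Q)"]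
    prod_encode_ge[of "prog_encode P" "prog_encode Q"] by (simp_all add: a)

lemma cont_dim_bound: "wp_dim P + wp_dim Q \<le> dbound a"
proof -
  have "wp_dim R \<le> 2 ^ a" if "prog_encode R \<le> a" for R
  proof (rule order_trans)
    show "wp_dim R \<le> 2 ^ prog_encode R" using wp_dim_wp_deg_bound by blast
    show "(2::nat) ^ prog_encode R \<le> 2 ^ a" by (rule power_increasing) (use that in simp_all)
  qed
  from add_mono[OF this[OF code_bounds(1)] this[OF code_bounds(2)]]
  show ?thesis by (simp add: dbound_def)
qed

lemma degrees_bound: "(wp_deg (dbound a) P + wp_deg (dbound a) Q) * (k * dbound a + 1) < mbound a"
proof -
  have le: "wp_deg (dbound a) R \<le> (dbound a + 2) ^ a" if "prog_encode R \<le> a" for R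
  proof (rule order_trans)
    show "wp_deg (dbound a) R \<le> (dbound a + 2) ^ prog_encode R" using wp_dim_wp_deg_bound by blast
    show "(dbound a + 2) ^ prog_encode R \<le> (dbound a + 2) ^ a" by (rule power_increasing) (use that in simp_all)
  qed
  have "wp_deg (dbound a) P + wp_deg (dbound a) Q \<le> 2 * (dbound a + 2) ^ a"
    using le[OF code_bounds(1)] le[OF code_bounds(2)] by linarith
  from mult_le_mono1[OF this, of "k * dbound a + 1"]
  show ?thesis unfolding mbound_def codes by (simp only: less_Suc_eq_le)
qed

lemma start_value:
  assumes C: "certificate a C" and g: "g < mbound a ^ k" and j: "j < pfst (el C g)"
    and R: "R = P \<or> R = Q" and e: "starts k (dbound a) (prog_encode R) z (el (psnd (el C g)) j)"
    and s: "s \<in> states k" "\<And>i. i < k \<Longrightarrow> s i = digit (dbound a) z i"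
  shows "rat_val (ev (el (psnd (el C g)) j)) = wp R (gvals k (mbound a) g) s"
proof -
  let ?e = "el (psnd (el C g)) j" and ?S = "tab_ents (el C g)"
  have "closed_entries k (dbound a) (mbound a) g ?S"
    using C g unfolding certificate_def codes closed_entries_def by (auto simp: tab_ents_def)
  moreover have "list_all (instr_ok k) [Run R]" using P Q R by auto
  moreover have "cont_dim [Run R] \<le> dbound a" using cont_dim_bound R by auto
  moreover have "?e \<in> ?S" using j by (auto simp: tab_ents_def)
  moreover have "ec ?e = cont_code [Run R]" using e by (simp add: starts_def cont_code_Cons)
  ultimately have "rat_val (ev ?e) = wps [Run R] (gvals k (mbound a) g) (st k (es ?e))"
    by (rule entry_sound)
  moreover have "st k (es ?e) = s"
    by (rule st_eqI) (use e s in \<open>auto simp: starts_def states_def\<close>)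
  ultimately show ?thesis by simp
qed

lemma certificate_correct:
  assumes C: "certificate a C"
  shows "values_agree a C \<longleftrightarrow> denotation k P = denotation k Q"
proof
  assume agree: "values_agree a C"
  have "wp P (pvals k (gridpt \<gamma>)) s = wp Q (pvals k (gridpt \<gamma>)) s"
    if \<gamma>: "\<And>i. i < k \<Longrightarrow> \<gamma> i < mbound a" and s: "s \<in> states k" "\<And>i. i < k \<Longrightarrow> s i < dbound a" for \<gamma> s
  proof -
    have "\<exists>g<mbound a ^ k. \<forall>i<k. digit (mbound a) g i = \<gamma> i" by (rule digits_exist) (rule \<gamma>)
    then obtain g where g: "g < mbound a ^ k" "\<forall>i<k. digit (mbound a) g i = \<gamma> i" by (elim exE conjE) (rule that)
    have "\<exists>z<dbound a ^ k. \<forall>i<k. digit (dbound a) z i = s i" by (rule digits_exist) (rule s(2))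
    then obtain z where z: "z < dbound a ^ k" "\<forall>i<k. digit (dbound a) z i = s i" by (elim exE conjE) (rule that)
    have cg: "(\<exists>j<pfst (el C g). starts k (dbound a) (prog_encode P) z (el (psnd (el C g)) j)) \<and>
        (\<exists>j<pfst (el C g). starts k (dbound a) (prog_encode Q) z (el (psnd (el C g)) j))"
      using C[unfolded certificate_def codes, rule_format, OF g(1), THEN conjunct2, rule_format, OF z(1)] .
    obtain i j where ij: "i < pfst (el C g)" "starts k (dbound a) (prog_encode P) z (el (psnd (el C g)) i)"
      "j < pfst (el C g)" "starts k (dbound a) (prog_encode Q) z (el (psnd (el C g)) j)"
      using cg by (elim conjE exE) (rule that)
    have "gvals k (mbound a) g = pvals k (gridpt \<gamma>)"
      unfolding gvals_def by (rule pvals_cong) (use g(2) in \<open>simp add: gridpt_def\<close>)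
    moreover have "rat_val (ev (el (psnd (el C g)) i)) = rat_val (ev (el (psnd (el C g)) j))"
      by (rule agree[unfolded values_agree_def codes, rule_format, OF g(1) z(1) ij(1,3,2,4)])
    moreover have "rat_val (ev (el (psnd (el C g)) i)) = wp P (gvals k (mbound a) g) s"
      by (rule start_value[OF C g(1) ij(1) _ ij(2) s(1)]) (use z(2) in simp_all)
    moreover have "rat_val (ev (el (psnd (el C g)) j)) = wp Q (gvals k (mbound a) g) s"
      by (rule start_value[OF C g(1) ij(3) _ ij(4) s(1)]) (use z(2) in simp_all)
    ultimately show ?thesis by (simp only:)
  qed
  then have "wp P (pvals k u) s = wp Q (pvals k u) s" if "\<forall>i. 0 < u i \<and> u i < 1" "s \<in> states k" for u s
    using wp_eq_grid[OF P Q cont_dim_bound degrees_bound] that by blast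
  then show "denotation k P = denotation k Q" using denotation_eq_iff_wp[OF P Q] by blast
next
  assume eq: "denotation k P = denotation k Q"
  show "values_agree a C"
    unfolding values_agree_def codes
  proof (intro allI impI)
    fix g z i j
    assume g: "g < mbound a ^ k" and z: "z < dbound a ^ k" and i: "i < pfst (el C g)" and j: "j < pfst (el C g)"
      and si: "starts k (dbound a) (prog_encode P) z (el (psnd (el C g)) i)"
      and sj: "starts k (dbound a) (prog_encode Q) z (el (psnd (el C g)) j)"
    define s where "s i = (if i < k then digit (dbound a) z i else 0)" for i
    have s: "s \<in> states k" "\<And>i. i < k \<Longrightarrow> s i = digit (dbound a) z i" by (auto simp: s_def states_def)
    have "wp P (gvals k (mbound a) g) s = wp Q (gvals k (mbound a) g) s"
      using eq denotation_eq_iff_wp[OF P Q] s(1) gridpt_iv unfolding gvals_def by blast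
    moreover have "rat_val (ev (el (psnd (el C g)) i)) = wp P (gvals k (mbound a) g) s"
      by (rule start_value[OF C g i _ si s]) simp
    moreover have "rat_val (ev (el (psnd (el C g)) j)) = wp Q (gvals k (mbound a) g) s"
      by (rule start_value[OF C g j _ sj s]) simp
    ultimately show "rat_val (ev (el (psnd (el C g)) i)) = rat_val (ev (el (psnd (el C g)) j))"
      by (simp only:)
  qed
qed

lemma certificate_exists: "\<exists>C. certificate a C"
proof -
  \<comment> \<open>One finite closed set is taken for each start state and program; closedness
    survives unions, so together they form the table of a grid point.\<close>
  have table: "\<exists>T. closed_entries k (dbound a) (mbound a) g (tab_ents T) \<and>
      (\<forall>z<dbound a ^ k. \<forall>R\<in>{P, Q}. \<exists>e\<in>tab_ents T. starts k (dbound a) (prog_encode R) z e)" for g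
  proof -
    have "\<forall>p. \<exists>S e. snd p \<in> {P, Q} \<longrightarrow> finite S \<and> closed_entries k (dbound a) (mbound a) g S \<and> e \<in> S \<and>
        starts k (dbound a) (prog_encode (snd p)) (fst p) e"
    proof
      fix p :: "nat \<times> prog"
      obtain s where s: "\<And>i. el s i = (if i < k then digit (dbound a) (fst p) i else 0)"
        using seq_code[of k "digit (dbound a) (fst p)"] by blast
      show "\<exists>S e. snd p \<in> {P, Q} \<longrightarrow> finite S \<and> closed_entries k (dbound a) (mbound a) g S \<and> e \<in> S \<and>
        starts k (dbound a) (prog_encode (snd p)) (fst p) e"
      proof (cases "snd p \<in> {P, Q}")
        case True
        have ok: "list_all (instr_ok k) [Run (snd p)]" using P Q True by auto
        have dim: "cont_dim [Run (snd p)] \<le> dbound a" using cont_dim_bound True by auto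
        obtain S e where "finite S" "closed_entries k (dbound a) (mbound a) g S" "e \<in> S"
            "ec e = cont_code [Run (snd p)]" "es e = s"
          using entry_complete[OF ok dim, of "mbound a" g s] by blast
        then show ?thesis using s by (intro exI[of _ S] exI[of _ e]) (simp add: starts_def cont_code_Cons)
      qed simp
    qed
    then obtain S E where SE: "\<And>z R. R \<in> {P, Q} \<Longrightarrow> finite (S (z, R)) \<and> closed_entries k (dbound a) (mbound a) g (S (z, R)) \<and>
        E (z, R) \<in> S (z, R) \<and> starts k (dbound a) (prog_encode R) z (E (z, R))"
      by (metis fst_conv snd_conv)
    let ?I = "{..<dbound a ^ k} \<times> {P, Q}"
    let ?S = "\<Union>p\<in>?I. S p"
    have "finite ?S" using SE by auto
    then obtain T where T: "tab_ents T = ?S" using table_code by blast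
    have "closed_entries k (dbound a) (mbound a) g ?S" by (rule closed_UN) (use SE in auto)
    moreover have "\<forall>z<dbound a ^ k. \<forall>R\<in>{P, Q}. \<exists>e\<in>?S. starts k (dbound a) (prog_encode R) z e"
    proof (intro allI impI ballI)
      fix z R assume z: "z < dbound a ^ k" and R: "R \<in> {P, Q}"
      have "(z, R) \<in> ?I" using z R by blast
      then have "E (z, R) \<in> ?S" using SE[OF R, of z] by blast
      then show "\<exists>e\<in>?S. starts k (dbound a) (prog_encode R) z e" using SE[OF R, of z] by blast
    qed
    ultimately show ?thesis unfolding T[symmetric] by blast
  qed
  then obtain \<tau> where \<tau>: "\<And>g. closed_entries k (dbound a) (mbound a) g (tab_ents (\<tau> g))"
    "\<And>g z R. z < dbound a ^ k \<Longrightarrow> R \<in> {P, Q} \<Longrightarrow> \<exists>e\<in>tab_ents (\<tau> g). starts k (dbound a) (prog_encode R) z e"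
    by metis
  obtain C where C: "\<And>g. el C g = (if g < mbound a ^ k then \<tau> g else 0)"
    using seq_code[of "mbound a ^ k" \<tau>] by blast
  have "certificate a C"
    unfolding certificate_def codes
  proof (intro allI impI conjI)
    fix g assume g: "g < mbound a ^ k"
    fix j assume "j < pfst (el C g)"
    then have "el (psnd (el C g)) j \<in> tab_ents (el C g)" by (auto simp: tab_ents_def)
    then show "entry_ok k (dbound a) (mbound a) g (tab_ents (el C g)) (el (psnd (el C g)) j)"
      using \<tau>(1)[of g] g C unfolding closed_entries_def by simp
  next
    fix g z assume g: "g < mbound a ^ k" and z: "z < dbound a ^ k"
    show "\<exists>j<pfst (el C g). starts k (dbound a) (prog_encode P) z (el (psnd (el C g)) j)"
      using \<tau>(2)[OF z, of P g] g C by (simp add: bex_tab_ents)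
    show "\<exists>j<pfst (el C g). starts k (dbound a) (prog_encode Q) z (el (psnd (el C g)) j)"
      using \<tau>(2)[OF z, of Q g] g C by (simp add: bex_tab_ents)
  qed
  then show ?thesis by blast
qed

end

text \<open>Every valid instance has a certificate, so the search ends, and whichever certificate it
  meets gives the right answer.\<close>

lemma decidable_loop_free_equivalence:
  "\<exists>d. partial_recursive d \<and> (\<forall>k P Q. loop_free P \<longrightarrow> redip k P \<longrightarrow> loop_free Q \<longrightarrow> redip k Q \<longrightarrow>
     d (instance_encode (k, P, Q)) = Some (if denotation k P = denotation k Q then 1 else 0))"
proof -
  obtain d where d: "partial_recursive d"
    "\<And>a. \<exists>C. certificate a C \<Longrightarrow> \<exists>C. certificate a C \<and> d a = Some (if values_agree a C then 1 else 0)"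
    using search_partial_recursive[OF dec_pred_certificate dec_pred_values_agree] by blast
  have "d (instance_encode (k, P, Q)) = Some (if denotation k P = denotation k Q then 1 else 0)"
    if "loop_free P" "redip k P" "loop_free Q" "redip k Q" for k P Q
    using d(2)[OF certificate_exists[OF that refl]] certificate_correct[OF that refl] by auto
  then show ?thesis using d(1) by blast
qed

section \<open>Reduction of the loop problem to loop-free equivalence\<close>

text \<open>\<open>pfst (psnd a)\<close> codes the loop, and \<open>L\<close> is what remains
  without its tag: the pair \<open>(x, n)\<close> of the guard and the body. They are reassembled
  under the tags 3, 4 and 2 of the conditional, the sequence and the skip.\<close>

definition reduction :: "nat \<Rightarrow> nat" where
  "reduction a = (let k = pfst a; L = psnd (pfst (psnd a)); I = psnd (psnd a) in
     prod_encode (k, prod_encode (I,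
       prod_encode (3, prod_encode (pfst L,
         prod_encode (prod_encode (4, prod_encode (psnd L, I)),
           prod_encode (2, prod_encode (pfst (pfst L),
             prod_encode (dist_encode (Ratio 1 1), pfst (pfst L))))))))))"

lemma reduction:
  "reduction (instance_encode (k, WhileLess x n P, I)) =
    instance_encode (k, I, IfLess x n (Seq P I) (skip x))"
  by (simp add: reduction_def Let_def skip_def)

lemma tot_rec_reduction: "tot_rec reduction"
proof -
  have "tot_rec (\<lambda>a. reduction a)" unfolding reduction_def Let_def by (intro rec_intros)
  then show ?thesis by simp
qed

theorem theorem4:
  shows "decidable_on instance_encode
    {(k, L, I) | k L I x n P.
       L = WhileLess x n P \<and> loop_free P \<and> redip k L \<and> universally_ast k L \<and>
       loop_free I \<and> redip k I}
    (\<lambda>(k, L, I). denotation k L = denotation k I)"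
proof -
  obtain d where d: "partial_recursive d"
    "\<And>k P Q. loop_free P \<Longrightarrow> redip k P \<Longrightarrow> loop_free Q \<Longrightarrow> redip k Q \<Longrightarrow>
     d (instance_encode (k, P, Q)) = Some (if denotation k P = denotation k Q then 1 else 0)"
    using decidable_loop_free_equivalence by blast
  have "partial_recursive (\<lambda>a. Option.bind (Some (reduction a)) d)"
    by (rule partial_recursive.comp[OF d(1)]) (rule tot_rec_reduction[unfolded tot_rec_def])
  moreover have "d (reduction (instance_encode (k, WhileLess x n P, I))) =
      Some (if denotation k (WhileLess x n P) = denotation k I then 1 else 0)"
    if "loop_free P" "redip k (WhileLess x n P)" "universally_ast k (WhileLess x n P)" "loop_free I" "redip k I"
    for k x n P I
  proof -
    let ?Q = "IfLess x n (Seq P I) (skip x)"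
    have lf: "loop_free ?Q" using that redip_skip by simp
    have "x < k" using that(2) by simp
    then have r: "redip k ?Q" using that redip_skip by simp
    have "redip k P" using that(2) by simp
    from loop_eq_iff[OF that(1) this that(3-5)]
    show ?thesis unfolding reduction d(2)[OF that(4,5) lf r] by (simp only:)
  qed
  ultimately show ?thesis unfolding decidable_on_def
    by (intro exI[of _ "\<lambda>a. Option.bind (Some (reduction a)) d"]) auto
qed

end
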